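(* Let $1\le p<\infty$ and let $E$ be a Banach space. Then, the following statements are equivalent. (i) $E$ has the $p$-approximation property. (ii) $\mathcal H(F)\otimes E$ is $\tau_\omega$-dense in $\mathcal H_{K_p}(F;E)$ for all Banach spaces $F$.
   Context: Banach spaces are complex; $B_E$ is the closed unit ball of $E$. $\mathcal H(F;E)$ is the space of entire functions from $F$ to $E$, $\mathcal H(F)$ the scalar-valued case; $\mathcal H(F)\otimes E$ is the set of finite sums $x\mapsto\sum_jf_j(x)e_j$ with $f_j\in\mathcal H(F)$, $e_j\in E$. A set $K\subset E$ is relatively $p$-compact if it is contained in the closure of $\{\sum_n\alpha_nx_n:(\alpha_n)_n\in B_{\ell_q}\}$ for some $p$-summable sequence $(x_n)_n$ in $E$, $\frac1p+\frac1q=1$. $\mathcal H_{K_p}(F;E)$ is the space of $f\in\mathcal H(F;E)$ that are $p$-compact, i.e. such that each $x\in F$ has a neighborhood $V$ with $f(V)$ relatively $p$-compact in $E$. The Nachbin topology $\tau_\omega$ on $\mathcal H(F;E)$ is generated by the seminorms $s$ ported by compact sets: there is a compact $K\subset F$ such that for every open $V\supset K$ there is $C_V>0$ with $s(f)\le C_V\sup_{x\in V}\|f(x)\|$ for all $f$ (equivalently, by the seminorms $f\mapsto\sum_{m\ge0}\sup_{x\in K+a_mB_F}\|P_mf(0)(x)\|$, with $K\subset F$ absolutely convex compact, $(a_m)_m$ a null sequence of positive numbers, and $P_mf(0)$ the $m$-homogeneous Taylor polynomial of $f$ at $0$). $E$ has the $p$-approximation property if for every $p$-compact set $K\subset E$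 and every $\varepsilon>0$ there is a finite rank bounded operator $T:E\to E$ with $\sup_{x\in K}\|Tx-x\|<\varepsilon$. *)

theory Defs
  imports "HOL-Analysis.Analysis"
begin

section \<open>Complex Banach spaces as types\<close>

class complex_banach = banach +
  fixes scaleC :: "complex \<Rightarrow> 'a \<Rightarrow> 'a"
  assumes scaleC_add_right: "scaleC c (x + y) = scaleC c x + scaleC c y"
    and scaleC_add_left: "scaleC (c + d) x = scaleC c x + scaleC d x"
    and scaleC_scaleC: "scaleC c (scaleC d x) = scaleC (c * d) x"
    and scaleC_one: "scaleC 1 x = x"
    and scaleC_of_real: "scaleC (complex_of_real r) x = scaleR r x"
    and norm_scaleC: "norm (scaleC c x) = cmod c * norm x"

instantiation complex :: complex_banach
begin

definition scaleC_complex :: "complex \<Rightarrow> complex \<Rightarrow> complex" where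
  "scaleC_complex c z = c * z"

instance
  by standard (simp_all add: scaleC_complex_def algebra_simps scaleR_conv_of_real norm_mult)

end

lemma vector_space_scaleC: "vector_space (scaleC :: complex \<Rightarrow> 'a \<Rightarrow> 'a::complex_banach)"
  by standard (simp_all add: scaleC_add_right scaleC_add_left scaleC_scaleC scaleC_one)


section \<open>Complex Banach spaces with an explicit carrier\<close>

text \<open>
  HOL formulas cannot quantify over types. A Banach space that has to be quantified over inside
  a formula is therefore a record whose carrier is a subset of some type; the values of the
  operations off the carrier are irrelevant. The theorem about a Banach space \<open>'e\<close> takes
  carriers inside \<open>'e + 'u\<close>: as \<open>'u\<close> is an arbitrary type, Banach spaces of every cardinality
  are covered, and the summand \<open>'e\<close> makes the range of the quantifier large enough, whatever \<open>'u\<close>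
  is, for a property of all these spaces to have consequences for \<open>'e\<close>.
\<close>

record 'f cspace =
  points :: "'f set"
  vadd :: "'f \<Rightarrow> 'f \<Rightarrow> 'f"
  vzero :: "'f"
  vscale :: "complex \<Rightarrow> 'f \<Rightarrow> 'f"
  vnorm :: "'f \<Rightarrow> real"

definition vdiff :: "'f cspace \<Rightarrow> 'f \<Rightarrow> 'f \<Rightarrow> 'f" where
  "vdiff F x y = vadd F x (vscale F (-1) y)"

text \<open>The library's locale of metric spaces wants a nonnegative symmetric distance on the
  whole type, hence the default value 0 off the carrier.\<close>

definition vdist :: "'f cspace \<Rightarrow> 'f \<Rightarrow> 'f \<Rightarrow> real" where
  "vdist F x y = (if x \<in> points F \<and> y \<in> points F then vnorm F (vdiff F x y) else 0)"

abbreviation vtopology :: "'f cspace \<Rightarrow> 'f topology" where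
  "vtopology F \<equiv> Metric_space.mtopology (points F) (vdist F)"

locale complex_banach_space =
  fixes F :: "'f cspace"
  assumes zero_closed: "vzero F \<in> points F"
    and add_closed: "\<lbrakk>x \<in> points F; y \<in> points F\<rbrakk> \<Longrightarrow> vadd F x y \<in> points F"
    and scale_closed: "x \<in> points F \<Longrightarrow> vscale F c x \<in> points F"
    and add_assoc: "\<lbrakk>x \<in> points F; y \<in> points F; z \<in> points F\<rbrakk>
          \<Longrightarrow> vadd F (vadd F x y) z = vadd F x (vadd F y z)"
    and add_commute: "\<lbrakk>x \<in> points F; y \<in> points F\<rbrakk> \<Longrightarrow> vadd F x y = vadd F y x"
    and add_zero: "x \<in> points F \<Longrightarrow> vadd F x (vzero F) = x"
    and add_inverse: "x \<in> points F \<Longrightarrow> \<exists>y\<in>points F. vadd F x y = vzero F"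
    and scale_add_right: "\<lbrakk>x \<in> points F; y \<in> points F\<rbrakk>
          \<Longrightarrow> vscale F c (vadd F x y) = vadd F (vscale F c x) (vscale F c y)"
    and scale_add_left: "x \<in> points F
          \<Longrightarrow> vscale F (c + d) x = vadd F (vscale F c x) (vscale F d x)"
    and scale_scale: "x \<in> points F \<Longrightarrow> vscale F c (vscale F d x) = vscale F (c * d) x"
    and scale_one: "x \<in> points F \<Longrightarrow> vscale F 1 x = x"
    and norm_nonneg: "x \<in> points F \<Longrightarrow> 0 \<le> vnorm F x"
    and norm_eq_0: "\<lbrakk>x \<in> points F; vnorm F x = 0\<rbrakk> \<Longrightarrow> x = vzero F"
    and norm_triangle: "\<lbrakk>x \<in> points F; y \<in> points F\<rbrakk>
          \<Longrightarrow> vnorm F (vadd F x y) \<le> vnorm F x + vnorm F y"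
    and norm_scale: "x \<in> points F \<Longrightarrow> vnorm F (vscale F c x) = cmod c * vnorm F x"
    and complete: "Metric_space.mcomplete (points F) (vdist F)"

lemma (in complex_banach_space) Metric_space_vdist: "Metric_space (points F) (vdist F)"
proof -
  have cl: "vdiff F x y \<in> points F" if "x \<in> points F" "y \<in> points F" for x y
    using that by (simp add: vdiff_def add_closed scale_closed)
  have z: "vscale F 0 x = vzero F" if x: "x \<in> points F" for x
  proof -
    have "vnorm F (vscale F 0 x) = 0" using norm_scale[OF x, of 0] by simp
    then show ?thesis using norm_eq_0 scale_closed x by blast
  qed
  have n0: "vnorm F (vzero F) = 0"
    using z[OF zero_closed] norm_scale[OF zero_closed, of 0] by simp
  have neg: "vadd F (vscale F (-1) x) x = vzero F" if x: "x \<in> points F" for x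
    using scale_add_left[OF x, of "-1" 1] scale_one[OF x] z[OF x] by simp
  have zadd: "vadd F (vzero F) x = x" if x: "x \<in> points F" for x
    using add_zero add_commute zero_closed x by metis
  have tel: "vadd F (vdiff F x y) (vdiff F y z) = vdiff F x z"
    if "x \<in> points F" "y \<in> points F" "z \<in> points F" for x y z
  proof -
    have "vadd F (vadd F x (vscale F (-1) y)) (vadd F y (vscale F (-1) z))
       = vadd F x (vadd F (vadd F (vscale F (-1) y) y) (vscale F (-1) z))"
      using that by (simp add: add_assoc add_closed scale_closed)
    then show ?thesis using that by (simp add: vdiff_def neg zadd scale_closed)
  qed
  have eq0: "vdiff F x y = vzero F \<longleftrightarrow> x = y" if xy: "x \<in> points F" "y \<in> points F" for x y
  proof
    assume a: "vdiff F x y = vzero F"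
    have "x = vadd F x (vadd F (vscale F (-1) y) y)" using xy by (simp add: neg add_zero)
    also have "\<dots> = vadd F (vdiff F x y) y" using xy by (simp add: vdiff_def add_assoc scale_closed)
    finally show "x = y" using xy a by (simp add: zadd)
  next
    assume "x = y"
    then show "vdiff F x y = vzero F"
      using xy neg[of y] add_commute[of y "vscale F (-1) y"] by (simp add: vdiff_def scale_closed)
  qed
  have sym: "vnorm F (vdiff F x y) = vnorm F (vdiff F y x)"
    if xy: "x \<in> points F" "y \<in> points F" for x y
  proof -
    have "vscale F (-1) (vdiff F x y) = vdiff F y x"
      using xy by (simp add: vdiff_def scale_add_right scale_closed scale_scale scale_one add_commute)
    then show ?thesis using norm_scale[OF cl[OF xy], of "-1"] by simp
  qed
  show ?thesis
  proof
    fix x y assume "x \<in> points F" "y \<in> points F"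
    then show "vdist F x y = 0 \<longleftrightarrow> x = y"
      unfolding vdist_def using eq0 cl norm_eq_0 n0 by metis
  next
    fix x y z assume "x \<in> points F" "y \<in> points F" "z \<in> points F"
    then show "vdist F x z \<le> vdist F x y + vdist F y z"
      using norm_triangle[OF cl[of x y] cl[of y z]] tel[of x y z] by (simp add: vdist_def)
  qed (auto simp: vdist_def sym cl norm_nonneg)
qed


section \<open>\<open>p\<close>-compact sets and the \<open>p\<close>-approximation property\<close>

definition conjugate_exponent :: "real \<Rightarrow> ereal" where
  "conjugate_exponent p = (if p = 1 then \<infinity> else ereal (p / (p - 1)))"

definition ell_ball :: "ereal \<Rightarrow> (nat \<Rightarrow> complex) set" where
  "ell_ball q = (if q = \<infinity> then {\<alpha>. \<forall>n. cmod (\<alpha> n) \<le> 1}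
     else {\<alpha>. summable (\<lambda>n. cmod (\<alpha> n) powr real_of_ereal q) \<and>
              (\<Sum>n. cmod (\<alpha> n) powr real_of_ereal q) \<le> 1})"

definition p_summable :: "real \<Rightarrow> (nat \<Rightarrow> 'e::complex_banach) \<Rightarrow> bool" where
  "p_summable p x \<longleftrightarrow> summable (\<lambda>n. norm (x n) powr p)"

definition relatively_p_compact :: "real \<Rightarrow> 'e::complex_banach set \<Rightarrow> bool" where
  "relatively_p_compact p K \<longleftrightarrow> (\<exists>x. p_summable p x \<and>
     K \<subseteq> closure {\<Sum>n. scaleC (\<alpha> n) (x n) | \<alpha>. \<alpha> \<in> ell_ball (conjugate_exponent p)})"

definition p_compact :: "real \<Rightarrow> 'e::complex_banach set \<Rightarrow> bool" where
  "p_compact p K \<longleftrightarrow> closed K \<and> relatively_p_compact p K"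

definition finite_rank_operator :: "('e::complex_banach \<Rightarrow> 'e) \<Rightarrow> bool" where
  "finite_rank_operator T \<longleftrightarrow> bounded_linear T \<and> (\<forall>c x. T (scaleC c x) = scaleC c (T x)) \<and>
     (\<exists>B. finite B \<and> range T \<subseteq> module.span scaleC B)"

definition p_approximation_property :: "real \<Rightarrow> 'e::complex_banach itself \<Rightarrow> bool" where
  "p_approximation_property p TYPE('e) \<longleftrightarrow>
     (\<forall>K::'e set. p_compact p K \<longrightarrow> (\<forall>\<epsilon>>0. \<exists>T. finite_rank_operator T \<and>
        (SUP x\<in>K. ennreal (norm (T x - x))) < ennreal \<epsilon>))"


section \<open>Entire functions\<close>

text \<open>An \<open>m\<close>-linear map takes lists of length \<open>m\<close>. A function is entire if around every point it
  is the locally uniform sum of a series of continuous \<open>m\<close>-homogeneous polynomials.\<close>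

definition multilinear_map ::
    "'f cspace \<Rightarrow> nat \<Rightarrow> ('f list \<Rightarrow> 'e::complex_banach) \<Rightarrow> bool" where
  "multilinear_map F m A \<longleftrightarrow>
     (\<forall>xs i. length xs = m \<and> set xs \<subseteq> points F \<and> i < m \<longrightarrow>
        (\<forall>x\<in>points F. \<forall>y\<in>points F. A (xs[i := vadd F x y]) = A (xs[i := x]) + A (xs[i := y])) \<and>
        (\<forall>x\<in>points F. \<forall>c. A (xs[i := vscale F c x]) = scaleC c (A (xs[i := x]))))"

definition homogeneous_polynomial ::
    "'f cspace \<Rightarrow> nat \<Rightarrow> ('f \<Rightarrow> 'e::complex_banach) \<Rightarrow> bool" where
  "homogeneous_polynomial F m P \<longleftrightarrow>
     (\<exists>A. multilinear_map F m A \<and> (\<forall>x\<in>points F. P x = A (replicate m x))) \<and>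
     continuous_map (vtopology F) euclidean P"

definition entire_functions :: "'f cspace \<Rightarrow> ('f \<Rightarrow> 'e::complex_banach) set" where
  "entire_functions F = {f. \<forall>a\<in>points F. \<exists>r>0. \<exists>P. (\<forall>m. homogeneous_polynomial F m (P m)) \<and>
     uniform_limit {x \<in> points F. vnorm F (vdiff F x a) < r}
       (\<lambda>n x. \<Sum>m<n. P m (vdiff F x a)) f sequentially}"

definition p_compact_entire_functions ::
    "real \<Rightarrow> 'f cspace \<Rightarrow> ('f \<Rightarrow> 'e::complex_banach) set" where
  "p_compact_entire_functions p F = {f \<in> entire_functions F.
     \<forall>x\<in>points F. \<exists>V. openin (vtopology F) V \<and> x \<in> V \<and> relatively_p_compact p (f ` V)}"

definition entire_tensor :: "'f cspace \<Rightarrow> ('f \<Rightarrow> 'e::complex_banach) set" where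
  "entire_tensor F = {f. \<exists>n \<phi> e. (\<forall>j<n. \<phi> j \<in> entire_functions F) \<and>
     (\<forall>x\<in>points F. f x = (\<Sum>j<(n::nat). scaleC (\<phi> j x :: complex) (e j)))}"


section \<open>The Nachbin topology\<close>

definition entire_seminorm :: "'f cspace \<Rightarrow> (('f \<Rightarrow> 'e::complex_banach) \<Rightarrow> real) \<Rightarrow> bool" where
  "entire_seminorm F s \<longleftrightarrow>
     (\<forall>f\<in>entire_functions F. \<forall>g\<in>entire_functions F. s (\<lambda>x. f x + g x) \<le> s f + s g) \<and>
     (\<forall>f\<in>entire_functions F. \<forall>c. s (\<lambda>x. scaleC c (f x)) = cmod c * s f)"

text \<open>Functions that agree on the carrier are not distinguished by a ported seminorm, since the
  bound below is a supremum over a subset of the carrier. The supremum may be infinite.\<close>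

definition ported_seminorm :: "'f cspace \<Rightarrow> (('f \<Rightarrow> 'e::complex_banach) \<Rightarrow> real) \<Rightarrow> bool" where
  "ported_seminorm F s \<longleftrightarrow> entire_seminorm F s \<and>
     (\<exists>K. compactin (vtopology F) K \<and>
        (\<forall>V. openin (vtopology F) V \<and> K \<subseteq> V \<longrightarrow>
           (\<exists>C>0. \<forall>f\<in>entire_functions F.
              ennreal (s f) \<le> ennreal C * (SUP x\<in>V. ennreal (norm (f x))))))"

definition nachbin_topology :: "'f cspace \<Rightarrow> ('f \<Rightarrow> 'e::complex_banach) topology" where
  "nachbin_topology F = topology_generated_by
     {{g \<in> entire_functions F. s (\<lambda>x. g x - f x) < \<epsilon>} | s f \<epsilon>.
        ported_seminorm F s \<and> f \<in> entire_functions F \<and> 0 < \<epsilon>}"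

end

theory Submission
  imports Defs "HOL-Complex_Analysis.Cauchy_Integral_Formula"
begin

text \<open>
  If \<open>E\<close> has the \<open>p\<close>-approximation property and \<open>f\<close> is \<open>p\<close>-compact, then a compact \<open>K\<close> has an open
  neighbourhood \<open>V\<close> with \<open>f(V)\<close> relatively \<open>p\<close>-compact. A finite rank \<open>T\<close> close to the identity on \<open>f(V)\<close>
  makes \<open>T \<circ> f \<in> \<H>(F) \<otimes> E\<close> uniformly close to \<open>f\<close> on \<open>V\<close>, hence close for every seminorm ported by \<open>K\<close>.

  Conversely, let \<open>x\<close> be \<open>p\<close>-summable and write \<open>x n = w n * y n\<close> with \<open>w\<close> null and \<open>y\<close> still
  \<open>p\<close>-summable. Let \<open>D\<close> be the closed hull of \<open>y\<close> and \<open>F\<close> its span, normed by the gauge of \<open>D\<close>. The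
  inclusion of \<open>F\<close> into \<open>E\<close> is \<open>p\<close>-compact, so it is close to some \<open>g \<in> \<H>(F) \<otimes> E\<close> in the seminorm
  given by the derivative at \<open>0\<close> (ported by \<open>{0}\<close>, by Cauchy's inequality); the derivative of \<open>g\<close> is a
  finite sum of \<open>\<psi> j \<otimes> e j\<close> with \<open>\<psi> j\<close> in the dual of \<open>F\<close>. On the hull of \<open>x\<close>, which is the continuous
  image of a compact set of coefficients, each \<open>\<psi> j\<close> is at most \<open>\<epsilon> + C * norm\<close>, and the Mazur-Orlicz
  theorem then provides functionals on \<open>E\<close> that approximate it uniformly there.
\<close>

section \<open>Linear functionals dominated by convex functions\<close>

text \<open>The functionals \<psi> j are bounded only for the gauge of \<open>D\<close>, a norm that
  may be strictly finer than that of \<open>E\<close>. They need not extend continuously to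
  \<open>E\<close>; they are approximated on the hull of \<open>x\<close>, not extended. For this,
  smallness in the norm of \<open>E\<close> must force \<psi> j to be small up to \<epsilon>.
  Nothing guarantees that on \<open>D\<close> itself, but the null factor \<open>w\<close> makes the
  tails of the series in the hull of \<open>x\<close> uniformly small in the gauge. Compactness is
  then used on the side of the coefficients, in the topology of coordinatewise convergence, so a
  point of the hull may have many representations. The derivative at 0 enters because an approximant
  \<open>g\<close> need not be linear: it extracts the linear part of \<open>g\<close> and leaves
  the inclusion, which is linear, unchanged. The closure in \<open>D\<close> is what makes
  \<open>F\<close> complete and every gauge attained. Mazur-Orlicz yields a one-sided estimate for a
  real functional; since the hull of \<open>x\<close> is balanced, this becomes a bound for the
  modulus of a complex one.\<close>

definition sublinear :: "('a::real_vector \<Rightarrow> real) \<Rightarrow> bool" where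
  "sublinear q \<longleftrightarrow> (\<forall>x y. q (x + y) \<le> q x + q y) \<and> (\<forall>t>0. \<forall>x. q (t *\<^sub>R x) \<le> t * q x) \<and> 0 \<le> q 0"

lemma sublinear_zero: "sublinear q \<Longrightarrow> q 0 = 0"
proof -
  assume q: "sublinear q"
  have "q ((1/2) *\<^sub>R 0) \<le> (1/2) * q 0" using q unfolding sublinear_def by (metis half_gt_zero zero_less_one)
  then show ?thesis using q by (auto simp: sublinear_def)
qed

lemma sublinear_minus: "sublinear q \<Longrightarrow> - q (- x) \<le> q x"
  using sublinear_zero[of q] unfolding sublinear_def
  by (metis add.commute add.right_inverse diff_0 diff_le_eq)

text \<open>A sublinear functional that is not additive in some direction \<open>y\<close> can be
  lowered along \<open>y\<close> and stay sublinear; minimality excludes this.\<close>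

lemma minimal_sublinear_linear:
  assumes q: "sublinear q"
    and min: "\<And>r. \<lbrakk>sublinear r; \<And>x. r x \<le> q x\<rbrakk> \<Longrightarrow> r = q"
  shows "linear q"
proof -
  have sub: "q (x + y) \<le> q x + q y" for x y using q by (auto simp: sublinear_def)
  have hom_le: "t > 0 \<Longrightarrow> q (t *\<^sub>R x) \<le> t * q x" for t x using q by (auto simp: sublinear_def)
  \<comment> \<open>The one-sided inequality applied to \<open>inverse t\<close> gives the reverse
    one.\<close>
  have hom: "q (t *\<^sub>R x) = t * q x" if "t \<ge> 0" for t x
  proof (cases "t = 0")
    case False
    then have "t > 0" using that by simp
    have "q x = q (inverse t *\<^sub>R (t *\<^sub>R x))" using False by simp
    also have "\<dots> \<le> inverse t * q (t *\<^sub>R x)" by (rule hom_le) (use \<open>t > 0\<close> in simp)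
    finally have "t * q x \<le> q (t *\<^sub>R x)" using \<open>t > 0\<close> by (simp add: field_simps)
    then show ?thesis using hom_le[OF \<open>t > 0\<close>, of x] by simp
  qed (simp add: sublinear_zero[OF q])
  have add: "q (x + y) = q x + q y" for x y
  proof -
    \<comment> \<open>The index \<open>t = 0\<close> shows that \<open>r\<close> lies below
      \<open>q\<close>. Once minimality gives \<open>r = q\<close>, the index \<open>t = 1\<close>
      is the missing inequality \<open>q x + q y \<le> q (x + y)\<close>.\<close>
    define r where "r z = (INF t\<in>{0..}. q (z + t *\<^sub>R y) - t * q y)" for z
    have lower: "- q (- z) \<le> q (z + t *\<^sub>R y) - t * q y" if "t \<ge> 0" for t z
    proof -
      have "t * q y = q ((z + t *\<^sub>R y) + (- z))" using hom[OF that] by simp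
      also have "\<dots> \<le> q (z + t *\<^sub>R y) + q (- z)" by (rule sub)
      finally show ?thesis by simp
    qed
    have bdd: "bdd_below ((\<lambda>t. q (z + t *\<^sub>R y) - t * q y) ` {0..})" for z
      by (rule bdd_belowI2[where m="- q (- z)"]) (use lower in auto)
    have r_le: "r z \<le> q (z + t *\<^sub>R y) - t * q y" if "t \<ge> 0" for t z
      unfolding r_def by (rule cINF_lower[OF bdd]) (use that in auto)
    have r_ge: "c \<le> r z" if "\<And>t. t \<ge> 0 \<Longrightarrow> c \<le> q (z + t *\<^sub>R y) - t * q y" for c z
      unfolding r_def by (rule cINF_greatest) (use that in auto)
    have "sublinear r"
      unfolding sublinear_def
    proof (intro conjI allI impI)
      fix z w
      have "r (z + w) - (q (z + t *\<^sub>R y) - t * q y) \<le> r w" if t: "t \<ge> 0" for t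
      proof (rule r_ge)
        fix s :: real assume s: "s \<ge> 0"
        have "r (z + w) \<le> q (z + w + (t + s) *\<^sub>R y) - (t + s) * q y" using r_le[of "t + s"] s t by simp
        also have "z + w + (t + s) *\<^sub>R y = (z + t *\<^sub>R y) + (w + s *\<^sub>R y)" by (simp add: algebra_simps)
        also have "q \<dots> \<le> q (z + t *\<^sub>R y) + q (w + s *\<^sub>R y)" by (rule sub)
        finally show "r (z + w) - (q (z + t *\<^sub>R y) - t * q y) \<le> q (w + s *\<^sub>R y) - s * q y"
          by (simp add: algebra_simps)
      qed
      then have "r (z + w) - r w \<le> r z" by (intro r_ge) (simp add: algebra_simps)
      then show "r (z + w) \<le> r z + r w" by simp
    next
      fix t :: real and z assume t: "t > 0"
      have "r (t *\<^sub>R z) / t \<le> r z"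
      proof (rule r_ge)
        fix s :: real assume s: "s \<ge> 0"
        have "r (t *\<^sub>R z) \<le> q (t *\<^sub>R z + (t * s) *\<^sub>R y) - (t * s) * q y" using s t by (intro r_le) simp
        also have "t *\<^sub>R z + (t * s) *\<^sub>R y = t *\<^sub>R (z + s *\<^sub>R y)" by (simp add: algebra_simps)
        also have "q \<dots> = t * q (z + s *\<^sub>R y)" using t by (intro hom) simp
        finally show "r (t *\<^sub>R z) / t \<le> q (z + s *\<^sub>R y) - s * q y" using t by (simp add: field_simps)
      qed
      then show "r (t *\<^sub>R z) \<le> t * r z" using t by (simp add: field_simps)
    next
      show "0 \<le> r 0" by (rule r_ge) (simp add: hom)
    qed
    moreover have "r z \<le> q z" for z using r_le[of 0] by simp
    ultimately have "r = q" by (rule min)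
    then have "q x \<le> q (x + y) - q y" using r_le[of 1 x] by simp
    then show ?thesis using sub[of x y] by simp
  qed
  have neg: "q (- x) = - q x" for x
    using add[of x "- x"] sublinear_zero[OF q] by simp
  have "q (t *\<^sub>R x) = t *\<^sub>R q x" for t x
  proof (cases "t \<ge> 0")
    case False
    then have "q (t *\<^sub>R x) = - q ((- t) *\<^sub>R x)" using neg[of "t *\<^sub>R x"] by simp
    then show ?thesis using hom[of "- t"] False by simp
  qed (simp add: hom)
  then show "linear q" using add by (intro linearI)
qed

text \<open>Hahn-Banach in algebraic form, by Zorn's lemma on the sublinear functionals below
  \<open>p\<close>: a minimal one is linear, so no functional has to be extended from a
  subspace.\<close>

lemma sublinear_dominates_linear:
  fixes p :: "'a::real_vector \<Rightarrow> real"
  assumes p: "sublinear p"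
  obtains u where "linear u" "\<And>x. u x \<le> p x"
proof -
  define A where "A = {q. sublinear q \<and> (\<forall>x. q x \<le> p x)}"
  \<comment> \<open>The order is reversed: maximal elements are minimal functionals, and upper
    bounds of chains are pointwise infima.\<close>
  define P :: "('a \<Rightarrow> real) \<Rightarrow> ('a \<Rightarrow> real) \<Rightarrow> bool" where "P q r \<longleftrightarrow> (\<forall>x. r x \<le> q x)" for q r
  have "\<exists>m\<in>A. \<forall>a\<in>A. P m a \<longrightarrow> a = m"
  proof (rule predicate_Zorn)
    show "partial_order_on A (relation_of P A)"
      unfolding partial_order_on_def preorder_on_def refl_on_def trans_def antisym_def
        relation_of_def P_def
      by (auto intro!: ext intro: order_trans antisym)
  next
    fix C assume "C \<in> Chains (relation_of P A)"
    then have CA: "C \<subseteq> A" and chain: "\<And>q r. q \<in> C \<Longrightarrow> r \<in> C \<Longrightarrow> P q r \<or> P r q"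
      by (auto simp: Chains_def relation_of_def)
    show "\<exists>u\<in>A. \<forall>a\<in>C. P a u"
    proof (cases "C = {}")
      case True
      then show ?thesis using p by (auto simp: A_def)
    next
      case False
      define r where "r x = (INF q\<in>C. q x)" for x
      have sl: "sublinear q" and le: "q x \<le> p x" if "q \<in> C" for q x using that CA by (auto simp: A_def)
      \<comment> \<open>Any sublinear \<open>q\<close> below \<open>p\<close> satisfies
        \<open>- p (- x) \<le> - q (- x) \<le> q x\<close>, so the infimum is finite.\<close>
      have bdd: "bdd_below ((\<lambda>q. q x) ` C)" for x
        by (rule bdd_belowI2[where m="- p (- x)"]) (metis sl le sublinear_minus neg_le_iff_le order_trans)
      have r_le: "r x \<le> q x" if "q \<in> C" for q x
        unfolding r_def by (rule cINF_lower[OF bdd that])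
      have r_ge: "c \<le> r x" if "\<And>q. q \<in> C \<Longrightarrow> c \<le> q x" for c x
        unfolding r_def by (rule cINF_greatest) (use that False in auto)
      have "sublinear r"
        unfolding sublinear_def
      proof (intro conjI allI impI)
        fix x y
        have "r (x + y) - q x \<le> r y" if q: "q \<in> C" for q
        proof (rule r_ge)
          fix q' assume q': "q' \<in> C"
          \<comment> \<open>An infimum of sublinear functionals need not be subadditive; in a chain
            the smaller of two members serves for both summands.\<close>
          from chain[OF q q'] obtain q'' where q'': "q'' \<in> C" "q'' x \<le> q x" "q'' y \<le> q' y"
            using q q' unfolding P_def by (metis order_refl)
          have "r (x + y) \<le> q'' (x + y)" by (rule r_le) fact
          also have "\<dots> \<le> q'' x + q'' y" using sl[OF q''(1)] by (auto simp: sublinear_def)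
          finally show "r (x + y) - q x \<le> q' y" using q'' by simp
        qed
        then have "r (x + y) - r y \<le> r x" by (intro r_ge) (simp add: algebra_simps)
        then show "r (x + y) \<le> r x + r y" by simp
      next
        fix t :: real and x assume t: "t > 0"
        have "r (t *\<^sub>R x) / t \<le> r x"
        proof (rule r_ge)
          fix q assume q: "q \<in> C"
          have "r (t *\<^sub>R x) \<le> q (t *\<^sub>R x)" by (rule r_le) fact
          also have "\<dots> \<le> t * q x" using sl[OF q] t by (auto simp: sublinear_def)
          finally show "r (t *\<^sub>R x) / t \<le> q x" using t by (simp add: field_simps)
        qed
        then show "r (t *\<^sub>R x) \<le> t * r x" using t by (simp add: field_simps)
      next
        show "0 \<le> r 0" by (rule r_ge) (use sl in \<open>auto simp: sublinear_def\<close>)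
      qed
      moreover have "r x \<le> p x" for x
        using False r_le le by (meson all_not_in_conv order_trans)
      ultimately show ?thesis using r_le by (auto simp: A_def P_def)
    qed
  qed
  then obtain m where m: "m \<in> A" "\<And>a. a \<in> A \<Longrightarrow> P m a \<Longrightarrow> a = m" by blast
  have "linear m"
  proof (rule minimal_sublinear_linear)
    show "sublinear m" using m(1) by (simp add: A_def)
    show "r = m" if "sublinear r" "\<And>x. r x \<le> m x" for r
      by (rule m(2)) (use m(1) that in \<open>auto simp: A_def P_def intro: order_trans[OF that(2)]\<close>)
  qed
  with m(1) show thesis using that by (auto simp: A_def)
qed

text \<open>The infimum \<open>q\<close> of \<open>C * norm (x - t *\<^sub>R k) + t * b k\<close>
  over \<open>t \<ge> 0\<close> and \<open>k\<close> in \<open>L\<close> is sublinear, and any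
  linear functional below it obeys both bounds: take \<open>t = 0\<close> for the first, and
  \<open>t = 1\<close>, \<open>x = k\<close> for the second. The hypothesis \<open>pos\<close> keeps
  the infimum finite.\<close>

theorem mazur_orlicz:
  fixes L :: "'a::real_normed_vector set"
  assumes L: "convex L" and b: "convex_on L b" and C: "0 \<le> C"
    and pos: "\<And>k. k \<in> L \<Longrightarrow> 0 \<le> b k + C * norm k"
  obtains u where "linear u" "\<And>x. u x \<le> C * norm x" "\<And>k. k \<in> L \<Longrightarrow> u k \<le> b k"
proof (cases "L = {}")
  \<comment> \<open>For empty \<open>L\<close> the infimum used in the other case would be over the
    empty set.\<close>
  case True
  show thesis by (rule that[of "\<lambda>_. 0"]) (use True C in \<open>auto simp: linear_iff\<close>)
next
  case False
  define S where "S x = {C * norm (x - t *\<^sub>R k) + t * b k | t k. 0 \<le> t \<and> k \<in> L}" for x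
  define q where "q x = Inf (S x)" for x
  have lower: "- (C * norm x) \<le> C * norm (x - t *\<^sub>R k) + t * b k" if "0 \<le> t" "k \<in> L" for t k x
  proof -
    have "t * (b k + C * norm k) \<ge> 0" using that pos by simp
    moreover have "C * norm (t *\<^sub>R k) \<le> C * (norm x + norm (x - t *\<^sub>R k))"
      using norm_triangle_ineq4[of x "x - t *\<^sub>R k"] C by (intro mult_left_mono) auto
    ultimately show ?thesis using that by (simp add: algebra_simps)
  qed
  have bdd: "bdd_below (S x)" for x
    unfolding S_def by (rule bdd_belowI[where m="- (C * norm x)"]) (use lower in auto)
  have q_le: "q x \<le> C * norm (x - t *\<^sub>R k) + t * b k" if "0 \<le> t" "k \<in> L" for t k x
    unfolding q_def by (rule cInf_lower[OF _ bdd]) (use that in \<open>auto simp: S_def\<close>)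
  have q_ge: "c \<le> q x" if "\<And>t k. 0 \<le> t \<Longrightarrow> k \<in> L \<Longrightarrow> c \<le> C * norm (x - t *\<^sub>R k) + t * b k" for c x
    unfolding q_def
  proof (rule cInf_greatest)
    obtain k where "k \<in> L" using False by auto
    then show "S x \<noteq> {}" unfolding S_def by blast
  qed (use that in \<open>auto simp: S_def\<close>)
  have "sublinear q"
    unfolding sublinear_def
  proof (intro conjI allI impI)
    fix x y
    have "q (x + y) - (C * norm (x - t *\<^sub>R k) + t * b k) \<le> q y" if t: "0 \<le> t" "k \<in> L" for t k
    proof (rule q_ge)
      fix s :: real and l assume s: "0 \<le> s" "l \<in> L"
      \<comment> \<open>The mean of \<open>k\<close> and \<open>l\<close> with weights
        \<open>t\<close> and \<open>s\<close>: convexity of \<open>L\<close> and \<open>b\<close>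
        merges a competitor for \<open>x\<close> and one for \<open>y\<close> into one for
        \<open>x + y\<close>. If both weights vanish, any point of \<open>L\<close> will do.\<close>
      obtain j where j: "j \<in> L" "(t + s) *\<^sub>R j = t *\<^sub>R k + s *\<^sub>R l" "(t + s) * b j \<le> t * b k + s * b l"
      proof (cases "t + s = 0")
        case True
        then have "t = 0" "s = 0" using t s by auto
        then show ?thesis using that[of k] t by simp
      next
        case False
        then have ts: "t + s > 0" using t s by linarith
        define j where "j = (t / (t + s)) *\<^sub>R k + (s / (t + s)) *\<^sub>R l"
        have coeff: "t / (t + s) \<ge> 0" "s / (t + s) \<ge> 0" "t / (t + s) + s / (t + s) = 1"
          using ts t s False by (auto simp: add_divide_distrib[symmetric])
        have "j \<in> L" unfolding j_def using L t s coeff by (auto simp: convex_def)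
        moreover have "(t + s) *\<^sub>R j = t *\<^sub>R k + s *\<^sub>R l" unfolding j_def using ts by (simp add: scaleR_right_distrib)
        moreover have "b j \<le> (t / (t + s)) * b k + (s / (t + s)) * b l"
          using b coeff t(2) s(2) unfolding j_def convex_on_def by metis
        then have "(t + s) * b j \<le> (t + s) * ((t / (t + s)) * b k + (s / (t + s)) * b l)"
          using ts by (intro mult_left_mono) auto
        then have "(t + s) * b j \<le> t * b k + s * b l" using ts by (simp add: distrib_left)
        ultimately show ?thesis by (rule that)
      qed
      have "q (x + y) \<le> C * norm (x + y - (t + s) *\<^sub>R j) + (t + s) * b j"
        using t s j by (intro q_le) auto
      also have "x + y - (t + s) *\<^sub>R j = (x - t *\<^sub>R k) + (y - s *\<^sub>R l)" using j by simp
      also have "C * norm \<dots> \<le> C * (norm (x - t *\<^sub>R k) + norm (y - s *\<^sub>R l))"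
        using C by (intro mult_left_mono norm_triangle_ineq)
      finally show "q (x + y) - (C * norm (x - t *\<^sub>R k) + t * b k) \<le> C * norm (y - s *\<^sub>R l) + s * b l"
        using j by (simp add: algebra_simps)
    qed
    then have "q (x + y) - q y \<le> q x" by (intro q_ge) (simp add: algebra_simps)
    then show "q (x + y) \<le> q x + q y" by simp
  next
    fix t :: real and x assume t: "t > 0"
    have "q (t *\<^sub>R x) / t \<le> q x"
    proof (rule q_ge)
      fix s k assume s: "0 \<le> (s::real)" "k \<in> L"
      have "q (t *\<^sub>R x) \<le> C * norm (t *\<^sub>R x - (t * s) *\<^sub>R k) + (t * s) * b k"
        using t s by (intro q_le) auto
      also have "t *\<^sub>R x - (t * s) *\<^sub>R k = t *\<^sub>R (x - s *\<^sub>R k)" by (simp add: algebra_simps)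
      also have "C * norm \<dots> + (t * s) * b k = t * (C * norm (x - s *\<^sub>R k) + s * b k)"
        using t by (simp add: distrib_left)
      finally show "q (t *\<^sub>R x) / t \<le> C * norm (x - s *\<^sub>R k) + s * b k"
        using t by (simp add: divide_le_eq mult.commute)
    qed
    then show "q (t *\<^sub>R x) \<le> t * q x" using t by (simp add: field_simps)
  next
    show "0 \<le> q 0" by (rule q_ge) (use lower[of _ _ 0] in auto)
  qed
  then obtain u where u: "linear u" "\<And>x. u x \<le> q x" using sublinear_dominates_linear by blast
  obtain k0 where "k0 \<in> L" using False by auto
  show thesis
  proof (rule that[OF u(1)])
    show "u x \<le> C * norm x" for x using q_le[of 0 k0 x] \<open>k0 \<in> L\<close> u(2)[of x] by simp
    show "u k \<le> b k" if "k \<in> L" for k using q_le[of 1 k k] that u(2)[of k] by simp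
  qed
qed

section \<open>Bounded complex-linear maps, norming functionals and finite rank\<close>

lemma bounded_linear_scaleC: "bounded_linear (scaleC c :: 'e \<Rightarrow> 'e::complex_banach)"
proof (rule bounded_linear_intro[of _ "cmod c"])
  show "scaleC c (r *\<^sub>R x) = r *\<^sub>R scaleC c x" for r and x :: 'e
    by (simp add: scaleC_of_real[symmetric] scaleC_scaleC mult.commute)
qed (simp_all add: scaleC_add_right norm_scaleC mult.commute)

definition bounded_clinear :: "('a::complex_banach \<Rightarrow> 'b::complex_banach) \<Rightarrow> bool" where
  "bounded_clinear T \<longleftrightarrow> bounded_linear T \<and> (\<forall>c x. T (scaleC c x) = scaleC c (T x))"

lemma cmod_rotate: obtains c where "cmod c = 1" "c * z = complex_of_real (cmod z)"
proof (cases "z = 0")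
  case False
  show ?thesis
  proof (rule that[of "cnj z / cmod z"])
    show "cmod (cnj z / cmod z) = 1" using False by (simp add: norm_divide)
    have "cnj z * z = (cmod z)\<^sup>2" by (metis complex_norm_square mult.commute)
    then show "cnj z / cmod z * z = cmod z" using False by (simp add: power2_eq_square)
  qed
qed (rule that[of 1]; simp)

text \<open>A complex functional is recovered from its real part. The constant \<open>C\<close>
  survives: rotating \<open>x\<close> by a unimodular scalar makes the value of \<open>h\<close>
  real and nonnegative, and there it equals \<open>u\<close>.\<close>

lemma bounded_clinear_of_real_part:
  fixes u :: "'e::complex_banach \<Rightarrow> real"
  assumes u: "linear u" and le: "\<And>x. u x \<le> C * norm x"
  defines "h \<equiv> \<lambda>x. Complex (u x) (- u (scaleC \<i> x))"
  shows "bounded_clinear h" and "\<And>x. cmod (h x) \<le> C * norm x"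
proof -
  interpret u: linear u by fact
  have add: "h (x + y) = h x + h y" for x y
    by (simp add: h_def complex_eq_iff u.add scaleC_add_right)
  have re: "h (r *\<^sub>R x) = r *\<^sub>R h x" for r x
  proof -
    have "scaleC \<i> (r *\<^sub>R x) = r *\<^sub>R scaleC \<i> x"
      by (simp add: scaleC_of_real[symmetric] scaleC_scaleC mult.commute)
    then show ?thesis by (simp add: h_def complex_eq_iff u.scaleR)
  qed
  have i: "h (scaleC \<i> x) = \<i> * h x" for x
  proof -
    have "scaleC \<i> (scaleC \<i> x) = - x"
      using scaleC_of_real[of "-1" x] by (simp add: scaleC_scaleC)
    then show ?thesis by (simp add: h_def complex_eq_iff u.neg)
  qed
  have sc: "h (scaleC c x) = c * h x" for c x
  proof -
    have "scaleC c x = Re c *\<^sub>R x + Im c *\<^sub>R scaleC \<i> x"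
      by (simp add: scaleC_of_real[symmetric] scaleC_scaleC scaleC_add_left[symmetric])
        (metis complex_eq mult.commute)
    then have "h (scaleC c x) = of_real (Re c) * h x + of_real (Im c) * (\<i> * h x)"
      by (simp add: add re i scaleR_conv_of_real)
    also have "\<dots> = (of_real (Re c) + \<i> * of_real (Im c)) * h x" by (simp add: algebra_simps)
    also have "\<dots> = c * h x" by (simp add: complex_eq[symmetric])
    finally show ?thesis .
  qed
  show bd: "cmod (h x) \<le> C * norm x" for x
  proof -
    obtain c where c: "cmod c = 1" "c * h x = complex_of_real (cmod (h x))" by (rule cmod_rotate)
    have "cmod (h x) = Re (h (scaleC c x))" using c by (simp add: sc)
    also have "\<dots> = u (scaleC c x)" by (simp add: h_def)
    also have "\<dots> \<le> C * norm (scaleC c x)" by (rule le)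
    finally show ?thesis using c by (simp add: norm_scaleC)
  qed
  have "bounded_linear h"
    by (rule bounded_linear_intro[of _ C]) (use add re bd in \<open>auto simp: mult.commute\<close>)
  then show "bounded_clinear h" using sc by (simp add: bounded_clinear_def scaleC_complex_def)
qed

text \<open>Mazur-Orlicz for the one-point set \<open>{- x}\<close> with the constant
  \<open>- norm x\<close> gives \<open>norm x \<le> u x\<close>. Together with
  \<open>cmod (h x) \<le> norm x\<close> this leaves no room for an imaginary part. The case
  \<open>x = 0\<close> needs no separate treatment.\<close>

lemma norming_functional:
  fixes x :: "'e::complex_banach"
  obtains h where "bounded_clinear h" "\<And>y. cmod (h y) \<le> norm y" "h x = norm x"
proof -
  obtain u where u: "linear u" "\<And>y. u y \<le> 1 * norm y" "\<And>k. k \<in> {- x} \<Longrightarrow> u k \<le> - norm x"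
  proof (rule mazur_orlicz[of "{- x}" "\<lambda>_. - norm x" 1])
    have "u * norm x + v * norm x = norm x" if "u + v = 1" for u v
      using that by (metis distrib_right mult_1)
    then show "convex_on {- x} (\<lambda>_. - norm x)" by (force simp: convex_on_def)
  qed auto
  define h where "h = (\<lambda>y. Complex (u y) (- u (scaleC \<i> y)))"
  have h: "bounded_clinear h" "\<And>y. cmod (h y) \<le> norm y"
    using bounded_clinear_of_real_part[OF u(1), of 1] u(2) by (simp_all add: h_def)
  have "norm x \<le> u x" using u(3)[of "- x"] u(1) by (simp add: linear_neg)
  then have "norm x \<le> Re (h x)" by (simp add: h_def)
  moreover have "(Re (h x))\<^sup>2 + (Im (h x))\<^sup>2 \<le> (norm x)\<^sup>2"
    using h(2)[of x] by (metis cmod_power2 norm_ge_zero power_mono)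
  moreover have "(norm x)\<^sup>2 \<le> (Re (h x))\<^sup>2" using calculation(1) by (intro power_mono) auto
  ultimately have "(Im (h x))\<^sup>2 = 0" by (smt (verit) zero_le_power2)
  moreover have "Re (h x) = norm x"
    using \<open>norm x \<le> Re (h x)\<close> h(2)[of x] complex_Re_le_cmod[of "h x"] by linarith
  ultimately have "h x = norm x" by (simp add: complex_eq_iff)
  with h show thesis by (rule that)
qed

lemma bounded_clinear_scaleC: "bounded_clinear (scaleC c)"
  by (simp add: bounded_clinear_def bounded_linear_scaleC scaleC_scaleC mult.commute)

lemma scaleC_zero_left: "scaleC 0 (x :: 'e::complex_banach) = 0"
  using scaleC_of_real[of 0 x] by simp

lemma scaleC_minus_one: "scaleC (-1) (x :: 'e::complex_banach) = - x"
  using scaleC_of_real[of "-1" x] by simp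

lemma scaleC_scaleR: "scaleC c (r *\<^sub>R v) = scaleC (c * of_real r) (v :: 'e::complex_banach)"
  by (simp add: scaleC_scaleC[symmetric] scaleC_of_real)

lemma bounded_clinear_add: "bounded_clinear T \<Longrightarrow> T (x + y) = T x + T y"
  and bounded_clinear_diff: "bounded_clinear T \<Longrightarrow> T (x - y) = T x - T y"
  and bounded_clinear_zero: "bounded_clinear T \<Longrightarrow> T 0 = 0"
  unfolding bounded_clinear_def
  by (auto simp: linear_add linear_diff linear_0 dest!: bounded_linear.linear)

lemma bounded_clinear_scale: "bounded_clinear T \<Longrightarrow> T (scaleC c x) = scaleC c (T x)"
  by (simp add: bounded_clinear_def)

lemma bounded_clinear_compose:
  "bounded_clinear S \<Longrightarrow> bounded_clinear T \<Longrightarrow> bounded_clinear (\<lambda>x. S (T x))"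
  by (simp add: bounded_clinear_def bounded_linear_compose)

lemma bounded_linear_scaleC_left: "bounded_linear (\<lambda>c. scaleC c (v :: 'e::complex_banach))"
proof (rule bounded_linear_intro[of _ "norm v"])
  show "scaleC (r *\<^sub>R c) v = r *\<^sub>R scaleC c v" for r c
    by (simp add: scaleR_conv_of_real scaleC_scaleC[symmetric] scaleC_of_real)
qed (simp_all add: scaleC_add_left norm_scaleC)

lemma bounded_clinear_rank_one:
  "bounded_clinear h \<Longrightarrow> bounded_clinear (\<lambda>x. scaleC (h x) (v :: 'e::complex_banach))"
  using bounded_linear_compose[OF bounded_linear_scaleC_left]
  by (auto simp: bounded_clinear_def scaleC_complex_def scaleC_scaleC)

lemma bounded_clinear_diff_fun:
  "bounded_clinear S \<Longrightarrow> bounded_clinear T \<Longrightarrow> bounded_clinear (\<lambda>x. S x - T x)"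
proof -
  have "scaleC c (x - y) = scaleC c x - scaleC c y" for c and x y :: 'b
    by (rule linear_diff[OF bounded_linear.linear[OF bounded_linear_scaleC]])
  then show "bounded_clinear S \<Longrightarrow> bounded_clinear T \<Longrightarrow> ?thesis"
    by (simp add: bounded_clinear_def bounded_linear_sub)
qed

lemma bounded_clinear_sum:
  fixes T :: "'i \<Rightarrow> 'a::complex_banach \<Rightarrow> 'b::complex_banach"
  shows "(\<And>i. i \<in> I \<Longrightarrow> bounded_clinear (T i)) \<Longrightarrow> bounded_clinear (\<lambda>x. \<Sum>i\<in>I. T i x)"
proof -
  have "scaleC c (\<Sum>i\<in>I. f i) = (\<Sum>i\<in>I. scaleC c (f i))" for c and f :: "'i \<Rightarrow> 'b"
    by (rule linear_sum[OF bounded_linear.linear[OF bounded_linear_scaleC]])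
  then show "(\<And>i. i \<in> I \<Longrightarrow> bounded_clinear (T i)) \<Longrightarrow> ?thesis"
    by (simp add: bounded_clinear_def bounded_linear_sum)
qed

text \<open>Induction on the number of spanning vectors, which may be dependent. The map
  \<open>\<pi>\<close> subtracts the component along \<open>b\<close>, kills \<open>b\<close>, and
  carries the span of \<open>B\<close> into the span of the images of the remaining vectors.
  Choosing that component by a norming functional keeps all coefficients continuous.\<close>

lemma finite_rank_decomposition:
  fixes T :: "'a::complex_banach \<Rightarrow> 'b::complex_banach"
  assumes "bounded_clinear T" "finite B" "range T \<subseteq> module.span scaleC B"
  shows "\<exists>n h e. (\<forall>j<n. bounded_clinear (h j)) \<and> (\<forall>x. T x = (\<Sum>j<(n::nat). scaleC (h j x :: complex) (e j)))"
  using assms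
proof (induction "card B" arbitrary: B T rule: less_induct)
  case (less B T)
  interpret vs: vector_space "scaleC :: complex \<Rightarrow> 'b \<Rightarrow> 'b" by (rule vector_space_scaleC)
  show ?case
  proof (cases "B = {}")
    case True
    then have "T x = 0" for x using less.prems(3) by auto
    then show ?thesis by (intro exI[of _ 0]) simp
  next
    case False
    then obtain b where b: "b \<in> B" by blast
    obtain h :: "'b \<Rightarrow> complex" where h: "bounded_clinear h" "h b = complex_of_real (norm b)" by (rule norming_functional[of b]) blast
    define k where "k = (\<lambda>y. scaleC (1 / complex_of_real (norm b)) (h y))"
    have k: "bounded_clinear k"
      unfolding k_def by (rule bounded_clinear_compose[OF bounded_clinear_scaleC h(1)])
    \<comment> \<open>For \<open>b = 0\<close> the quotient in \<open>k\<close> is 0 by convention,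
      and the identity still holds.\<close>
    have kb: "scaleC (k b) b = b"
      by (cases "b = 0") (simp_all add: k_def h(2) scaleC_complex_def scaleC_one)
    define \<pi> where "\<pi> y = y - scaleC (k y) b" for y
    have \<pi>: "bounded_clinear \<pi>"
      unfolding \<pi>_def
      by (intro bounded_clinear_diff_fun bounded_clinear_rank_one k)
        (simp add: bounded_clinear_def bounded_linear_ident)
    have "\<pi> y \<in> vs.span (\<pi> ` (B - {b}))" if "y \<in> vs.span B" for y
      using that
    proof (induction rule: vs.span_induct_alt)
      case base
      then show ?case by (simp add: bounded_clinear_zero[OF \<pi>] vs.span_zero)
    next
      case (step c x y)
      have "\<pi> x \<in> vs.span (\<pi> ` (B - {b}))"
      proof (cases "x = b")
        case True
        then show ?thesis by (simp add: \<pi>_def kb vs.span_zero)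
      next
        case False
        then show ?thesis using step.hyps by (intro vs.span_base) blast
      qed
      then show ?case using step
        by (simp add: bounded_clinear_add[OF \<pi>] bounded_clinear_scale[OF \<pi>] vs.span_add vs.span_scale)
    qed
    then have range: "range (\<lambda>x. \<pi> (T x)) \<subseteq> vs.span (\<pi> ` (B - {b}))"
      using less.prems(3) by blast
    have "card (\<pi> ` (B - {b})) < card B"
      by (rule le_less_trans[OF card_image_le card_Diff1_less]) (use less.prems(2) b in auto)
    from less.hyps[OF this bounded_clinear_compose[OF \<pi> less.prems(1)] finite_imageI[OF finite_Diff[OF less.prems(2)]] range]
    obtain n h' e where *: "\<And>j. j < n \<Longrightarrow> bounded_clinear (h' j)"
      "\<And>x. \<pi> (T x) = (\<Sum>j<(n::nat). scaleC (h' j x :: complex) (e j))" by blast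
    define H where "H = h'(n := \<lambda>x. k (T x))"
    define E where "E = e(n := b)"
    have "T x = (\<Sum>j<Suc n. scaleC (H j x) (E j))" for x
    proof -
      have "(\<Sum>j<n. scaleC (H j x) (E j)) = \<pi> (T x)"
        unfolding *(2) by (rule sum.cong) (auto simp: H_def E_def)
      then show ?thesis by (simp add: H_def E_def \<pi>_def)
    qed
    moreover have "bounded_clinear (H j)" if "j < Suc n" for j
      using that *(1) bounded_clinear_compose[OF k less.prems(1)] by (auto simp: H_def less_Suc_eq)
    ultimately show ?thesis by blast
  qed
qed

section \<open>Hulls of \<open>p\<close>-summable sequences\<close>

abbreviation conj_ball :: "real \<Rightarrow> (nat \<Rightarrow> complex) set" where
  "conj_ball p \<equiv> ell_ball (conjugate_exponent p)"

lemma conj_ball_1: "\<alpha> \<in> conj_ball 1 \<longleftrightarrow> (\<forall>n. cmod (\<alpha> n) \<le> 1)"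
  by (simp add: ell_ball_def conjugate_exponent_def)

text \<open>In this form each condition sees only finitely many coordinates, which is what
  closedness under coordinatewise limits rests on.\<close>

lemma conj_ball_iff:
  assumes "1 < p"
  shows "\<alpha> \<in> conj_ball p \<longleftrightarrow> (\<forall>N. (\<Sum>n<N. cmod (\<alpha> n) powr (p / (p - 1))) \<le> 1)"
proof -
  let ?f = "\<lambda>n. cmod (\<alpha> n) powr (p / (p - 1))"
  have "summable ?f \<and> suminf ?f \<le> 1 \<longleftrightarrow> (\<forall>N. sum ?f {..<N} \<le> 1)"
  proof safe
    fix N assume "summable ?f" "suminf ?f \<le> 1"
    then show "sum ?f {..<N} \<le> 1" using sum_le_suminf[of ?f "{..<N}"] by force
  next
    assume b: "\<forall>N. sum ?f {..<N} \<le> 1"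
    show s: "summable ?f" by (rule bounded_imp_summable[of _ 1]) (use b in \<open>auto simp: lessThan_Suc_atMost[symmetric] simp del: sum.lessThan_Suc\<close>)
    show "suminf ?f \<le> 1" by (rule suminf_le_const[OF s]) (use b in auto)
  qed
  then show ?thesis using assms by (simp add: ell_ball_def conjugate_exponent_def)
qed

lemma conj_ball_solid:
  assumes p: "1 \<le> p" and \<beta>: "\<beta> \<in> conj_ball p" and le: "\<And>n. cmod (\<alpha> n) \<le> cmod (\<beta> n)"
  shows "\<alpha> \<in> conj_ball p"
proof (cases "p = 1")
  case True
  then show ?thesis using \<beta> le by (simp add: conj_ball_1) (meson order_trans)
next
  case False
  then have p: "1 < p" using p by simp
  have "(\<Sum>n<N. cmod (\<alpha> n) powr (p / (p - 1))) \<le> (\<Sum>n<N. cmod (\<beta> n) powr (p / (p - 1)))" for N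
    using p le by (intro sum_mono powr_mono2) auto
  then show ?thesis using \<beta> p by (simp add: conj_ball_iff) (meson order_trans)
qed

lemma conj_ball_le_1:
  assumes p: "1 \<le> p" and \<alpha>: "\<alpha> \<in> conj_ball p"
  shows "cmod (\<alpha> n) \<le> 1"
proof (cases "p = 1")
  case True
  then show ?thesis using \<alpha> by (simp add: conj_ball_1)
next
  case False
  then have p: "1 < p" using p by simp
  have "cmod (\<alpha> n) powr (p / (p - 1)) \<le> (\<Sum>n<Suc n. cmod (\<alpha> n) powr (p / (p - 1)))"
    by (rule member_le_sum) auto
  also have "\<dots> \<le> 1" using \<alpha> p by (simp add: conj_ball_iff del: sum.lessThan_Suc)
  finally have "cmod (\<alpha> n) powr (p / (p - 1)) \<le> 1" .
  then show ?thesis using p powr_less_mono2[of "p / (p - 1)" 1 "cmod (\<alpha> n)"] by (simp add: not_less[symmetric]) (metis not_less)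
qed

lemma zero_in_conj_ball: "1 \<le> p \<Longrightarrow> (\<lambda>_. 0) \<in> conj_ball p"
  by (cases "p = 1") (auto simp: conj_ball_1 conj_ball_iff)

text \<open>Convexity of the power is applied to positive arguments only. If \<open>a\<close> or
  \<open>b\<close> vanishes, the claim reduces to \<open>w powr q \<le> w\<close> for weights
  \<open>w\<close> in the unit interval.\<close>

lemma powr_convex_combination:
  fixes a b q u v :: real
  assumes q: "1 \<le> q" and ab: "0 \<le> a" "0 \<le> b" and uv: "0 \<le> u" "0 \<le> v" "u + v = 1"
  shows "(u * a + v * b) powr q \<le> u * a powr q + v * b powr q"
proof -
  have w: "(w * c) powr q \<le> w * c powr q" if "0 \<le> w" "w \<le> 1" "0 \<le> c" for w c :: real
  proof -
    have "w powr q \<le> w powr 1"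
      using that q by (intro powr_mono') auto
    then have "w powr q * c powr q \<le> w * c powr q" using that by (intro mult_right_mono) auto
    then show ?thesis using that by (simp add: powr_mult)
  qed
  show ?thesis
  proof (cases "a = 0 \<or> b = 0")
    case True
    then show ?thesis using w[of v b] w[of u a] ab uv q by auto
  next
    case False
    then show ?thesis using powr_convex[OF q] ab uv unfolding convex_on_def by simp
  qed
qed

lemma conj_ball_convex:
  assumes p: "1 \<le> p" and \<alpha>: "\<alpha> \<in> conj_ball p" and \<beta>: "\<beta> \<in> conj_ball p"
    and uv: "0 \<le> u" "0 \<le> v" "u + v = 1"
  shows "(\<lambda>n. of_real u * \<alpha> n + of_real v * \<beta> n) \<in> conj_ball p"
proof -
  have tri: "cmod (of_real u * \<alpha> n + of_real v * \<beta> n) \<le> u * cmod (\<alpha> n) + v * cmod (\<beta> n)" for n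
    using norm_triangle_ineq[of "of_real u * \<alpha> n" "of_real v * \<beta> n"] uv by (simp add: norm_mult)
  show ?thesis
  proof (cases "p = 1")
    case True
    have "u * cmod (\<alpha> n) + v * cmod (\<beta> n) \<le> 1" for n
      using conj_ball_le_1[OF p \<alpha>, of n] conj_ball_le_1[OF p \<beta>, of n] uv convex_bound_le by blast
    then show ?thesis using True tri by (auto simp: conj_ball_1 intro: order_trans)
  next
    case False
    then have p: "1 < p" using p by simp
    define q where "q = p / (p - 1)"
    have q: "1 \<le> q" using p by (simp add: q_def field_simps)
    have term_le: "cmod (of_real u * \<alpha> n + of_real v * \<beta> n) powr q
        \<le> u * cmod (\<alpha> n) powr q + v * cmod (\<beta> n) powr q" for n
    proof -
      have "cmod (of_real u * \<alpha> n + of_real v * \<beta> n) powr q \<le> (u * cmod (\<alpha> n) + v * cmod (\<beta> n)) powr q"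
        using q tri by (intro powr_mono2) auto
      also have "\<dots> \<le> u * cmod (\<alpha> n) powr q + v * cmod (\<beta> n) powr q"
        by (rule powr_convex_combination) (use q uv in auto)
      finally show ?thesis .
    qed
    have "(\<Sum>n<N. cmod (of_real u * \<alpha> n + of_real v * \<beta> n) powr q) \<le> 1" for N
    proof -
      have "(\<Sum>n<N. cmod (of_real u * \<alpha> n + of_real v * \<beta> n) powr q)
          \<le> (\<Sum>n<N. u * cmod (\<alpha> n) powr q + v * cmod (\<beta> n) powr q)"
        by (intro sum_mono term_le)
      also have "\<dots> = u * (\<Sum>n<N. cmod (\<alpha> n) powr q) + v * (\<Sum>n<N. cmod (\<beta> n) powr q)"
        by (simp add: sum.distrib sum_distrib_left)
      also have "\<dots> \<le> 1"
        using \<alpha> \<beta> p uv unfolding conj_ball_iff[OF p] q_def by (intro convex_bound_le) auto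
      finally show ?thesis .
    qed
    then show ?thesis using p by (simp add: conj_ball_iff q_def)
  qed
qed

text \<open>The ball is not norm compact, but in the product topology it is a closed subset of a
  product of closed unit discs, which is compact by Tychonoff. This is the topology in which
  coefficient sequences are varied later.\<close>

lemma conj_ball_compact:
  assumes p: "1 \<le> p"
  shows "compact (conj_ball p)"
proof -
  define K :: "(nat \<Rightarrow> complex) set" where "K = PiE UNIV (\<lambda>_. cball 0 1)"
  have "compactin (product_topology (\<lambda>_. euclidean) UNIV) K"
    unfolding K_def by (subst compactin_PiE) simp
  then have K: "compact K" by (simp add: euclidean_product_topology)
  have "closed (conj_ball p)"
  proof (cases "p = 1")
    case True
    have "conj_ball 1 = (\<Inter>n. {\<alpha>. cmod (\<alpha> n) \<le> 1})" by (auto simp: conj_ball_1)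
    also have "closed \<dots>"
      by (intro closed_INT ballI closed_Collect_le continuous_intros continuous_on_product_coordinates)
    finally show ?thesis using True by simp
  next
    case False
    then have p: "1 < p" using p by simp
    have "conj_ball p = (\<Inter>N. {\<alpha>. (\<Sum>n<N. cmod (\<alpha> n) powr (p / (p - 1))) \<le> 1})"
      using p by (auto simp: conj_ball_iff)
    also have "closed \<dots>"
      using p by (intro closed_INT ballI closed_Collect_le continuous_intros continuous_on_powr'
          continuous_on_product_coordinates) auto
    finally show ?thesis .
  qed
  moreover have "conj_ball p \<subseteq> K" using conj_ball_le_1[OF p] by (auto simp: K_def)
  ultimately show ?thesis using K by (metis compact_Int_closed inf.absorb_iff2)
qed

text \<open>Allows a coefficient sequence to be spread over a subset of the indices. It serves to
  interleave two sequences and to produce the coordinate sequences.\<close>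

lemma conj_ball_pad:
  assumes p: "1 \<le> p" and \<alpha>: "\<alpha> \<in> conj_ball p" and g: "strict_mono g"
    and \<beta>: "\<And>n. \<beta> (g n) = \<alpha> n" "\<And>m. m \<notin> range g \<Longrightarrow> \<beta> m = 0"
  shows "\<beta> \<in> conj_ball p"
proof (cases "p = 1")
  case True
  then show ?thesis using \<alpha> \<beta> by (simp add: conj_ball_1) (metis norm_zero rangeE zero_le_one)
next
  case False
  then have p: "1 < p" using p by simp
  let ?h = "\<lambda>m. cmod (\<beta> m) powr (p / (p - 1))"
  have "summable (\<lambda>n. ?h (g n)) = summable ?h" by (rule summable_mono_reindex[OF g]) (simp add: \<beta>)
  moreover have "(\<Sum>n. ?h (g n)) = suminf ?h" by (rule suminf_mono_reindex[OF g]) (simp add: \<beta>)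
  ultimately show ?thesis using \<alpha> p \<beta> by (simp add: ell_ball_def conjugate_exponent_def)
qed

section \<open>Hulls as images of the coefficient ball, and stability of relative
  p-compactness\<close>

definition p_hull :: "real \<Rightarrow> (nat \<Rightarrow> 'e::complex_banach) \<Rightarrow> 'e set" where
  "p_hull p x = {\<Sum>n. scaleC (\<alpha> n) (x n) | \<alpha>. \<alpha> \<in> conj_ball p}"

lemma relatively_p_compact_iff:
  "relatively_p_compact p K \<longleftrightarrow> (\<exists>x. p_summable p x \<and> K \<subseteq> closure (p_hull p x))"
  by (simp add: relatively_p_compact_def p_hull_def)

text \<open>Young's inequality termwise, with the factors \<open>1 / p\<close> and
  \<open>1 / q\<close> dropped. The constant is worse than the one from Hoelder's inequality, but
  only a bound uniform in \<alpha> is wanted.\<close>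

lemma conj_ball_summable_norm:
  assumes p: "1 \<le> p" and x: "p_summable p x" and \<alpha>: "\<alpha> \<in> conj_ball p"
  shows "summable (\<lambda>n. norm (scaleC (\<alpha> n) (x n)))"
    and "(\<Sum>n. norm (scaleC (\<alpha> n) (x n))) \<le> (\<Sum>n. norm (x n) powr p) + 1"
proof -
  have sx: "summable (\<lambda>n. norm (x n) powr p)" using x by (simp add: p_summable_def)
  have *: "summable (\<lambda>n. norm (scaleC (\<alpha> n) (x n))) \<and>
      (\<Sum>n. norm (scaleC (\<alpha> n) (x n))) \<le> (\<Sum>n. norm (x n) powr p) + 1"
  proof (cases "p = 1")
    case True
    have le: "norm (scaleC (\<alpha> n) (x n)) \<le> norm (x n) powr p" for n
      using conj_ball_le_1[OF p \<alpha>, of n] True by (simp add: norm_scaleC mult_left_le_one_le)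
    have s: "summable (\<lambda>n. norm (scaleC (\<alpha> n) (x n)))"
      by (rule summable_comparison_test'[OF sx, of 0]) (use le in auto)
    show ?thesis using s suminf_le[OF le s sx] by simp
  next
    case False
    then have p: "1 < p" using p by simp
    define q where "q = p / (p - 1)"
    have q: "1 < q" "1 / p + 1 / q = 1" using p by (auto simp: q_def field_simps)
    have sa: "summable (\<lambda>n. cmod (\<alpha> n) powr q)" "(\<Sum>n. cmod (\<alpha> n) powr q) \<le> 1"
      using \<alpha> p by (auto simp: ell_ball_def conjugate_exponent_def q_def)
    have le: "norm (scaleC (\<alpha> n) (x n)) \<le> norm (x n) powr p + cmod (\<alpha> n) powr q" for n
    proof -
      have "norm (x n) * cmod (\<alpha> n) \<le> norm (x n) powr p / p + cmod (\<alpha> n) powr q / q"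
        using p q by (intro Youngs_inequality) auto
      also have "\<dots> \<le> norm (x n) powr p / 1 + cmod (\<alpha> n) powr q / 1"
        using p q by (intro add_mono divide_left_mono) auto
      finally show ?thesis by (simp add: norm_scaleC mult.commute)
    qed
    have ss: "summable (\<lambda>n. norm (x n) powr p + cmod (\<alpha> n) powr q)"
      by (rule summable_add[OF sx sa(1)])
    have s: "summable (\<lambda>n. norm (scaleC (\<alpha> n) (x n)))"
      by (rule summable_comparison_test'[OF ss, of 0]) (use le in auto)
    show ?thesis using s suminf_le[OF le s ss] suminf_add[OF sx sa(1)] sa(2) by simp
  qed
  show "summable (\<lambda>n. norm (scaleC (\<alpha> n) (x n)))" using * by blast
  show "(\<Sum>n. norm (scaleC (\<alpha> n) (x n))) \<le> (\<Sum>n. norm (x n) powr p) + 1" using * by blast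
qed

lemma conj_ball_summable:
  assumes "1 \<le> p" "p_summable p x" "\<alpha> \<in> conj_ball p"
  shows "summable (\<lambda>n. scaleC (\<alpha> n) (x n))"
  using conj_ball_summable_norm(1)[OF assms] by (rule summable_norm_cancel)

lemma p_hull_bounded:
  assumes p: "1 \<le> p" and x: "p_summable p x" and y: "y \<in> p_hull p x"
  shows "norm y \<le> (\<Sum>n. norm (x n) powr p) + 1"
proof -
  obtain \<alpha> where \<alpha>: "\<alpha> \<in> conj_ball p" "y = (\<Sum>n. scaleC (\<alpha> n) (x n))"
    using y by (auto simp: p_hull_def)
  show ?thesis
    using summable_norm[OF conj_ball_summable_norm(1)[OF p x \<alpha>(1)]]
      conj_ball_summable_norm(2)[OF p x \<alpha>(1)] \<alpha>(2) by simp
qed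

lemma p_hull_convex:
  assumes p: "1 \<le> p" and x: "p_summable p x"
  shows "convex (p_hull p x)"
proof (rule convexI)
  fix y z u v assume yz: "y \<in> p_hull p x" "z \<in> p_hull p x" and uv: "0 \<le> u" "0 \<le> v" "u + v = (1::real)"
  obtain \<alpha> \<beta> where \<alpha>: "\<alpha> \<in> conj_ball p" "y = (\<Sum>n. scaleC (\<alpha> n) (x n))"
    and \<beta>: "\<beta> \<in> conj_ball p" "z = (\<Sum>n. scaleC (\<beta> n) (x n))"
    using yz by (auto simp: p_hull_def)
  note s = conj_ball_summable[OF p x]
  have "u *\<^sub>R y + v *\<^sub>R z = (\<Sum>n. u *\<^sub>R scaleC (\<alpha> n) (x n) + v *\<^sub>R scaleC (\<beta> n) (x n))"
    by (simp add: \<alpha>(2) \<beta>(2) suminf_add[symmetric] suminf_scaleR_right[symmetric] s \<alpha>(1) \<beta>(1)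
        summable_scaleR_right)
  also have "\<dots> = (\<Sum>n. scaleC (of_real u * \<alpha> n + of_real v * \<beta> n) (x n))"
    by (simp add: scaleC_add_left scaleC_of_real[symmetric] scaleC_scaleC)
  finally show "u *\<^sub>R y + v *\<^sub>R z \<in> p_hull p x"
    using conj_ball_convex[OF p \<alpha>(1) \<beta>(1) uv] by (auto simp: p_hull_def)
qed

lemma p_hull_balanced:
  assumes p: "1 \<le> p" and x: "p_summable p x" and y: "y \<in> p_hull p x" and c: "cmod c \<le> 1"
  shows "scaleC c y \<in> p_hull p x"
proof -
  obtain \<alpha> where \<alpha>: "\<alpha> \<in> conj_ball p" "y = (\<Sum>n. scaleC (\<alpha> n) (x n))"
    using y by (auto simp: p_hull_def)
  have "scaleC c y = (\<Sum>n. scaleC c (scaleC (\<alpha> n) (x n)))"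
    unfolding \<alpha>(2) by (rule bounded_linear.suminf[OF bounded_linear_scaleC conj_ball_summable[OF p x \<alpha>(1)]])
  moreover have "(\<lambda>n. c * \<alpha> n) \<in> conj_ball p"
    by (rule conj_ball_solid[OF p \<alpha>(1)]) (use c in \<open>simp add: norm_mult mult_left_le_one_le\<close>)
  ultimately show ?thesis by (auto simp: p_hull_def scaleC_scaleC)
qed

lemma zero_in_p_hull: "1 \<le> p \<Longrightarrow> 0 \<in> p_hull p x"
proof -
  assume p: "1 \<le> p"
  have "scaleC 0 y = 0" for y :: 'a using scaleC_of_real[of 0 y] by simp
  then show ?thesis using zero_in_conj_ball[OF p] by (auto simp: p_hull_def intro!: exI[of _ "\<lambda>_. 0"])
qed

lemma p_summable_bounded_linear:
  assumes p: "1 \<le> p" and T: "bounded_linear T" and x: "p_summable p x"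
  shows "p_summable p (\<lambda>n. T (x n))"
proof -
  obtain K where K: "K > 0" "\<And>y. norm (T y) \<le> norm y * K" using bounded_linear.pos_bounded[OF T] by blast
  have s: "summable (\<lambda>n. K powr p * norm (x n) powr p)"
    using x by (auto simp: p_summable_def intro: summable_mult)
  show ?thesis unfolding p_summable_def
  proof (rule summable_comparison_test'[OF s, of 0])
    fix n
    have "norm (T (x n)) powr p \<le> (norm (x n) * K) powr p" using p K by (intro powr_mono2) auto
    then show "norm (norm (T (x n)) powr p) \<le> K powr p * norm (x n) powr p"
      using K by (simp add: powr_mult mult.commute)
  qed
qed

lemma p_hull_image:
  assumes p: "1 \<le> p" and T: "bounded_linear T" "\<And>c x. T (scaleC c x) = scaleC c (T x)"
    and x: "p_summable p x"
  shows "T ` p_hull p x \<subseteq> p_hull p (\<lambda>n. T (x n))"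
proof
  fix z assume "z \<in> T ` p_hull p x"
  then obtain \<alpha> where \<alpha>: "\<alpha> \<in> conj_ball p" "z = T (\<Sum>n. scaleC (\<alpha> n) (x n))"
    by (auto simp: p_hull_def)
  have "z = (\<Sum>n. T (scaleC (\<alpha> n) (x n)))"
    unfolding \<alpha>(2) by (rule bounded_linear.suminf[OF T(1) conj_ball_summable[OF p x \<alpha>(1)]])
  then show "z \<in> p_hull p (\<lambda>n. T (x n))" using \<alpha>(1) by (auto simp: p_hull_def T(2))
qed

lemma relatively_p_compact_image:
  assumes p: "1 \<le> p" and T: "bounded_linear T" "\<And>c x. T (scaleC c x) = scaleC c (T x)"
    and K: "relatively_p_compact p K"
  shows "relatively_p_compact p (T ` K)"
proof -
  obtain x where x: "p_summable p x" "K \<subseteq> closure (p_hull p x)"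
    using K by (auto simp: relatively_p_compact_iff)
  have "T ` K \<subseteq> T ` closure (p_hull p x)" using x(2) by auto
  also have "\<dots> \<subseteq> closure (T ` p_hull p x)"
    using T(1) by (intro continuous_image_closure_subset[of UNIV] linear_continuous_on) auto
  also have "\<dots> \<subseteq> closure (p_hull p (\<lambda>n. T (x n)))"
    by (intro closure_mono p_hull_image p T x)
  finally show ?thesis
    using p_summable_bounded_linear[OF p T(1) x(1)] by (auto simp: relatively_p_compact_iff)
qed

lemma relatively_p_compact_mono:
  "relatively_p_compact p K \<Longrightarrow> L \<subseteq> K \<Longrightarrow> relatively_p_compact p L"
  unfolding relatively_p_compact_def by blast

lemma relatively_p_compact_empty: "relatively_p_compact p {}"
  unfolding relatively_p_compact_def p_summable_def by (auto intro: exI[of _ "\<lambda>_. 0"])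

lemma p_hull_pad:
  assumes p: "1 \<le> p" and g: "strict_mono g" and z: "\<And>n. z (g n) = x n"
  shows "p_hull p x \<subseteq> p_hull p z"
proof
  fix y assume "y \<in> p_hull p x"
  then obtain \<alpha> where \<alpha>: "\<alpha> \<in> conj_ball p" "y = (\<Sum>n. scaleC (\<alpha> n) (x n))"
    by (auto simp: p_hull_def)
  define \<beta> where "\<beta> m = (if m \<in> range g then \<alpha> (inv g m) else 0)" for m
  have inj: "inj g" using g by (rule strict_mono_imp_inj_on)
  have \<beta>g: "\<beta> (g n) = \<alpha> n" for n by (simp add: \<beta>_def inj)
  have "\<beta> \<in> conj_ball p" by (rule conj_ball_pad[OF p \<alpha>(1) g \<beta>g]) (simp add: \<beta>_def)
  moreover have "(\<Sum>n. scaleC (\<beta> (g n)) (z (g n))) = (\<Sum>m. scaleC (\<beta> m) (z m))"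
  proof (rule suminf_mono_reindex[OF g])
    show "scaleC (\<beta> m) (z m) = 0" if "m \<notin> range g" for m
      using that scaleC_of_real[of 0 "z m"] by (simp add: \<beta>_def)
  qed
  ultimately show "y \<in> p_hull p z" using \<alpha>(2) by (auto simp: p_hull_def \<beta>g z)
qed

text \<open>Interleave the two sequences on even and odd indices; coefficients supported on one
  parity recover either hull.\<close>

lemma relatively_p_compact_Un:
  assumes p: "1 \<le> p" and K: "relatively_p_compact p K" and L: "relatively_p_compact p L"
  shows "relatively_p_compact p (K \<union> L)"
proof -
  obtain x where x: "p_summable p x" "K \<subseteq> closure (p_hull p x)"
    using K by (auto simp: relatively_p_compact_iff)
  obtain y where y: "p_summable p y" "L \<subseteq> closure (p_hull p y)"
    using L by (auto simp: relatively_p_compact_iff)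
  define z where "z n = (if even n then x (n div 2) else y (n div 2))" for n
  have ev: "strict_mono (\<lambda>n::nat. 2 * n)" and od: "strict_mono (\<lambda>n::nat. Suc (2 * n))"
    by (auto simp: strict_mono_def)
  \<comment> \<open>The series for \<open>z\<close> splits by parity into \<open>f\<close> and
    \<open>h\<close>, each a reindexed summable series filled up with zeros.\<close>
  define f where "f n = (if even n then norm (x (n div 2)) powr p else 0)" for n
  define h where "h n = (if even n then 0 else norm (y (n div 2)) powr p)" for n
  have "summable f"
    by (subst summable_mono_reindex[OF ev, symmetric])
      (use x in \<open>auto simp: f_def p_summable_def elim!: evenE\<close>)
  moreover have "summable h"
    by (subst summable_mono_reindex[OF od, symmetric])
      (use y in \<open>auto simp: h_def p_summable_def elim!: oddE\<close>)
  ultimately have "summable (\<lambda>n. f n + h n)" by (rule summable_add)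
  moreover have "f n + h n = norm (z n) powr p" for n by (simp add: f_def h_def z_def)
  ultimately have "p_summable p z" by (simp add: p_summable_def)
  moreover have "p_hull p x \<subseteq> p_hull p z" by (rule p_hull_pad[OF p ev]) (simp add: z_def)
  moreover have "p_hull p y \<subseteq> p_hull p z" by (rule p_hull_pad[OF p od]) (simp add: z_def)
  ultimately show ?thesis
    using x(2) y(2) unfolding relatively_p_compact_iff by (meson Un_least closure_mono order_trans)
qed

lemma relatively_p_compact_UN:
  assumes p: "1 \<le> p" and "finite I" and "\<And>i. i \<in> I \<Longrightarrow> relatively_p_compact p (K i)"
  shows "relatively_p_compact p (\<Union>i\<in>I. K i)"
  using assms(2,3) by (induction I rule: finite_induct)
    (auto intro: relatively_p_compact_empty relatively_p_compact_Un[OF p])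

section \<open>Entire functions\<close>

lemma homogeneous_polynomial_bounded_clinear:
  assumes T: "bounded_clinear T" and P: "homogeneous_polynomial F m P"
  shows "homogeneous_polynomial F m (\<lambda>x. T (P x))"
proof -
  obtain A where A: "multilinear_map F m A" "\<And>x. x \<in> points F \<Longrightarrow> P x = A (replicate m x)"
    and cont: "continuous_map (vtopology F) euclidean P"
    using P by (auto simp: homogeneous_polynomial_def)
  interpret T: bounded_linear T using T by (simp add: bounded_clinear_def)
  have "multilinear_map F m (\<lambda>xs. T (A xs))"
    using A(1) T unfolding multilinear_map_def bounded_clinear_def by (simp add: T.add)
  moreover have "continuous_map euclidean euclidean T" using T.continuous_on[OF continuous_on_id] by simp
  then have "continuous_map (vtopology F) euclidean (\<lambda>x. T (P x))"
    using continuous_map_compose[OF cont, of euclidean T] by (simp add: o_def)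
  ultimately show ?thesis using A(2) unfolding homogeneous_polynomial_def by force
qed

lemma homogeneous_polynomial_add:
  assumes P: "homogeneous_polynomial F m P" and Q: "homogeneous_polynomial F m Q"
  shows "homogeneous_polynomial F m (\<lambda>x. P x + Q x)"
proof -
  obtain A where A: "multilinear_map F m A" "\<And>x. x \<in> points F \<Longrightarrow> P x = A (replicate m x)"
    and contP: "continuous_map (vtopology F) euclidean P"
    using P by (auto simp: homogeneous_polynomial_def)
  obtain B where B: "multilinear_map F m B" "\<And>x. x \<in> points F \<Longrightarrow> Q x = B (replicate m x)"
    and contQ: "continuous_map (vtopology F) euclidean Q"
    using Q by (auto simp: homogeneous_polynomial_def)
  have "multilinear_map F m (\<lambda>xs. A xs + B xs)"
    using A(1) B(1) unfolding multilinear_map_def by (simp add: scaleC_add_right)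
  moreover have "continuous_map (vtopology F) euclidean (\<lambda>x. P x + Q x)"
    using contP contQ by (rule continuous_map_add)
  ultimately show ?thesis using A(2) B(2) unfolding homogeneous_polynomial_def by force
qed

lemma entire_functionsE:
  assumes "f \<in> entire_functions F" "a \<in> points F"
  obtains r P where "0 < r" "\<And>m. homogeneous_polynomial F m (P m)"
    "uniform_limit {x \<in> points F. vnorm F (vdiff F x a) < r} (\<lambda>n x. \<Sum>m<n. P m (vdiff F x a)) f sequentially"
  using assms unfolding entire_functions_def by blast

lemma entire_bounded_clinear:
  assumes T: "bounded_clinear T" and f: "f \<in> entire_functions F"
  shows "(\<lambda>x. T (f x)) \<in> entire_functions F"
  unfolding entire_functions_def
proof (intro CollectI ballI)
  fix a assume "a \<in> points F"
  then obtain r P where r: "0 < r" and P: "\<And>m. homogeneous_polynomial F m (P m)"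
    and ul: "uniform_limit {x \<in> points F. vnorm F (vdiff F x a) < r} (\<lambda>n x. \<Sum>m<n. P m (vdiff F x a)) f sequentially"
    by (rule entire_functionsE[OF f]) blast
  interpret T: bounded_linear T using T by (simp add: bounded_clinear_def)
  have "uniform_limit {x \<in> points F. vnorm F (vdiff F x a) < r} (\<lambda>n x. T (\<Sum>m<n. P m (vdiff F x a))) (\<lambda>x. T (f x)) sequentially"
    by (rule T.uniform_limit[OF ul])
  then show "\<exists>r>0. \<exists>P. (\<forall>m. homogeneous_polynomial F m (P m)) \<and>
      uniform_limit {x \<in> points F. vnorm F (vdiff F x a) < r}
        (\<lambda>n x. \<Sum>m<n. P m (vdiff F x a)) (\<lambda>x. T (f x)) sequentially"
    using r homogeneous_polynomial_bounded_clinear[OF T P]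
    by (intro exI[of _ r] conjI exI[of _ "\<lambda>m x. T (P m x)"]) (simp_all add: T.sum)
qed

lemma entire_add:
  assumes f: "f \<in> entire_functions F" and g: "g \<in> entire_functions F"
  shows "(\<lambda>x. f x + g x) \<in> entire_functions F"
  unfolding entire_functions_def
proof (intro CollectI ballI)
  fix a assume a: "a \<in> points F"
  obtain r P where r: "0 < r" and P: "\<And>m. homogeneous_polynomial F m (P m)"
    and ulP: "uniform_limit {x \<in> points F. vnorm F (vdiff F x a) < r} (\<lambda>n x. \<Sum>m<n. P m (vdiff F x a)) f sequentially"
    by (rule entire_functionsE[OF f a]) blast
  obtain s Q where s: "0 < s" and Q: "\<And>m. homogeneous_polynomial F m (Q m)"
    and ulQ: "uniform_limit {x \<in> points F. vnorm F (vdiff F x a) < s} (\<lambda>n x. \<Sum>m<n. Q m (vdiff F x a)) g sequentially"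
    by (rule entire_functionsE[OF g a]) blast
  let ?S = "{x \<in> points F. vnorm F (vdiff F x a) < min r s}"
  have "uniform_limit ?S (\<lambda>n x. (\<Sum>m<n. P m (vdiff F x a)) + (\<Sum>m<n. Q m (vdiff F x a))) (\<lambda>x. f x + g x) sequentially"
    by (intro uniform_limit_add uniform_limit_on_subset[OF ulP] uniform_limit_on_subset[OF ulQ]) auto
  then show "\<exists>r>0. \<exists>P. (\<forall>m. homogeneous_polynomial F m (P m)) \<and>
      uniform_limit {x \<in> points F. vnorm F (vdiff F x a) < r}
        (\<lambda>n x. \<Sum>m<n. P m (vdiff F x a)) (\<lambda>x. f x + g x) sequentially"
    using r s homogeneous_polynomial_add[OF P Q]
    by (intro exI[of _ "min r s"] conjI exI[of _ "\<lambda>m x. P m x + Q m x"]) (simp_all add: sum.distrib)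
qed

lemma entire_diff:
  assumes f: "f \<in> entire_functions F" and g: "g \<in> entire_functions F"
  shows "(\<lambda>x. f x - g x) \<in> entire_functions F"
  using entire_add[OF f entire_bounded_clinear[OF bounded_clinear_scaleC[of "-1"] g]]
  by (simp add: scaleC_minus_one)

section \<open>Entire functions near the origin and along complex lines\<close>

context complex_banach_space
begin

lemma scale_0: "x \<in> points F \<Longrightarrow> vscale F 0 x = vzero F"
  using norm_scale[of x 0] norm_eq_0[of "vscale F 0 x"] scale_closed[of x 0] by simp

lemma scale_vzero: "vscale F c (vzero F) = vzero F"
  using scale_0[OF zero_closed] scale_scale[OF zero_closed, of c 0] by simp

lemma norm_vzero: "vnorm F (vzero F) = 0"
  using scale_0[OF zero_closed] norm_scale[OF zero_closed, of 0] by simp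

lemma vdiff_vzero: "x \<in> points F \<Longrightarrow> vdiff F x (vzero F) = x"
  by (simp add: vdiff_def scale_vzero add_zero)

lemma vdiff_scale: "x \<in> points F \<Longrightarrow> vdiff F (vscale F c x) (vscale F d x) = vscale F (c - d) x"
  by (simp add: vdiff_def scale_scale scale_add_left[symmetric])

lemma vdist_vzero: "x \<in> points F \<Longrightarrow> vdist F (vzero F) x = vnorm F x"
  using Metric_space.commute[OF Metric_space_vdist, of "vzero F" x]
  by (simp add: vdist_def zero_closed vdiff_vzero)

lemma open_vzero_ball:
  assumes V: "openin (vtopology F) V" "vzero F \<in> V"
  obtains \<rho> where "0 < \<rho>" "\<And>x. x \<in> points F \<Longrightarrow> vnorm F x < \<rho> \<Longrightarrow> x \<in> V"
proof -
  interpret M: Metric_space "points F" "vdist F" by (rule Metric_space_vdist)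
  obtain r where r: "r > 0" "M.mball (vzero F) r \<subseteq> V" using V by (auto simp: M.openin_mtopology)
  show thesis
  proof (rule that[OF r(1)])
    fix x assume "x \<in> points F" "vnorm F x < r"
    then show "x \<in> V" using r(2) by (force simp: M.in_mball zero_closed vdist_vzero)
  qed
qed

lemma continuous_map_near_vzero:
  fixes g :: "'f \<Rightarrow> 'e::complex_banach"
  assumes g: "continuous_map (vtopology F) euclidean g"
  obtains \<rho> where "0 < \<rho>" "\<And>x. x \<in> points F \<Longrightarrow> vnorm F x < \<rho> \<Longrightarrow> norm (g x - g (vzero F)) < 1"
proof -
  interpret M: Metric_space "points F" "vdist F" by (rule Metric_space_vdist)
  have "openin (vtopology F) {x \<in> topspace (vtopology F). g x \<in> ball (g (vzero F)) 1}"
    by (rule openin_continuous_map_preimage[OF g]) simp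
  moreover have "vzero F \<in> {x \<in> topspace (vtopology F). g x \<in> ball (g (vzero F)) 1}"
    by (simp add: zero_closed)
  ultimately obtain \<rho> where "0 < \<rho>"
    "\<And>x. x \<in> points F \<Longrightarrow> vnorm F x < \<rho> \<Longrightarrow> x \<in> {x \<in> topspace (vtopology F). g x \<in> ball (g (vzero F)) 1}"
    using open_vzero_ball by blast
  then show thesis by (intro that[of \<rho>]) (auto simp: dist_norm norm_minus_commute)
qed

lemma homogeneous_polynomial_scale:
  assumes P: "homogeneous_polynomial F m P" and x: "x \<in> points F"
  shows "P (vscale F c x) = scaleC (c ^ m) (P x)"
proof -
  obtain A where A: "multilinear_map F m A" "\<And>x. x \<in> points F \<Longrightarrow> P x = A (replicate m x)"
    using P by (auto simp: homogeneous_polynomial_def)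
  \<comment> \<open>The argument \<open>x\<close> is replaced by its multiple in one slot at a time,
    and each slot contributes one factor \<open>c\<close>.\<close>
  have "i \<le> m \<Longrightarrow> A (replicate i (vscale F c x) @ replicate (m - i) x) = scaleC (c ^ i) (A (replicate m x))" for i
  proof (induction i)
    case 0
    then show ?case by (simp add: scaleC_one)
  next
    case (Suc i)
    let ?xs = "replicate i (vscale F c x) @ replicate (m - i) x"
    have "m - i = Suc (m - Suc i)" using Suc.prems by simp
    then have split: "?xs = replicate i (vscale F c x) @ x # replicate (m - Suc i) x" by simp
    have "?xs[i := vscale F c x] = replicate i (vscale F c x) @ vscale F c x # replicate (m - Suc i) x"
      unfolding split by (simp add: list_update_append)
    also have "\<dots> = replicate (Suc i) (vscale F c x) @ replicate (m - Suc i) x"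
      by (simp add: replicate_app_Cons_same)
    finally have upd: "?xs[i := vscale F c x] = replicate (Suc i) (vscale F c x) @ replicate (m - Suc i) x" .
    have same: "?xs[i := x] = ?xs" unfolding split by (simp add: list_update_append)
    have "A (?xs[i := vscale F c x]) = scaleC c (A (?xs[i := x]))"
      using A(1) Suc.prems x scale_closed[OF x] unfolding multilinear_map_def
      by (auto simp: set_replicate_conv_if)
    then show ?case using Suc unfolding upd same by (simp add: scaleC_scaleC)
  qed
  from this[of m] show ?thesis using A(2) x scale_closed[OF x] by simp
qed

lemma linear_part_at_vzero:
  fixes P :: "'f \<Rightarrow> 'e::complex_banach"
  assumes P: "homogeneous_polynomial F 1 P"
  shows "\<And>x y. x \<in> points F \<Longrightarrow> y \<in> points F \<Longrightarrow> P (vadd F x y) = P x + P y"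
    and "\<exists>M\<ge>0. \<forall>x\<in>points F. norm (P x) \<le> M * vnorm F x"
proof -
  obtain A where A: "multilinear_map F 1 A" "\<And>x. x \<in> points F \<Longrightarrow> P x = A [x]"
    using P by (auto simp: homogeneous_polynomial_def)
  show "P (vadd F x y) = P x + P y" if "x \<in> points F" "y \<in> points F" for x y
  proof -
    have "A ([x][0 := vadd F x y]) = A ([x][0 := x]) + A ([x][0 := y])"
      using A(1)[unfolded multilinear_map_def, rule_format, of "[x]" 0] that by simp
    then show ?thesis using that A(2) add_closed by simp
  qed
  have sc: "P (vscale F c x) = scaleC c (P x)" if "x \<in> points F" for c x
    using homogeneous_polynomial_scale[OF P that, of c] by simp
  have "continuous_map (vtopology F) euclidean P" using P by (simp add: homogeneous_polynomial_def)
  then obtain \<rho> where \<rho>: "0 < \<rho>" "\<And>x. x \<in> points F \<Longrightarrow> vnorm F x < \<rho> \<Longrightarrow> norm (P x - P (vzero F)) < 1"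
    by (rule continuous_map_near_vzero) blast
  have P0: "P (vzero F) = 0"
    using sc[OF zero_closed, of 0] scaleC_of_real[of 0 "P (vzero F)"] by (simp add: scale_vzero)
  have "norm (P x) \<le> 2 / \<rho> * vnorm F x" if x: "x \<in> points F" for x
  proof (cases "vnorm F x = 0")
    case True
    then show ?thesis using norm_eq_0[OF x] P0 by simp
  next
    case False
    then have nx: "vnorm F x > 0" using norm_nonneg[OF x] by simp
    \<comment> \<open>Brings \<open>x\<close> to norm \<open>\<rho> / 2\<close>, inside the ball
      where \<open>P\<close> stays below 1; hence the bound \<open>2 / \<rho>\<close>.\<close>
    define c where "c = complex_of_real (\<rho> / (2 * vnorm F x))"
    have cc: "cmod c = \<rho> / (2 * vnorm F x)" using nx \<rho> unfolding c_def norm_of_real by simp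
    have "vnorm F (vscale F c x) < \<rho>" using nx \<rho> by (simp add: norm_scale[OF x] cc)
    then have "norm (P (vscale F c x)) < 1" using \<rho>(2) scale_closed[OF x] P0 by force
    then have "cmod c * norm (P x) < 1" by (simp add: sc[OF x] norm_scaleC)
    then show ?thesis using nx \<rho> by (simp add: cc field_simps)
  qed
  then show "\<exists>M\<ge>0. \<forall>x\<in>points F. norm (P x) \<le> M * vnorm F x"
    using \<rho>(1) by (intro exI[of _ "2 / \<rho>"]) auto
qed

text \<open>One partial sum of the expansion is uniformly within 1 of \<open>f\<close> and, being
  continuous, within 1 of its value at the origin on a smaller ball. This makes the supremum that
  defines the derivative seminorm finite.\<close>

lemma entire_locally_bounded_at_vzero:
  fixes f :: "'f \<Rightarrow> 'e::complex_banach"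
  assumes f: "f \<in> entire_functions F"
  obtains \<rho> B where "0 < \<rho>" "\<And>x. x \<in> points F \<Longrightarrow> vnorm F x < \<rho> \<Longrightarrow> norm (f x) \<le> B"
proof -
  obtain r P where r: "0 < r" and P: "\<And>m. homogeneous_polynomial F m (P m)"
    and ul: "uniform_limit {x \<in> points F. vnorm F (vdiff F x (vzero F)) < r}
      (\<lambda>n x. \<Sum>m<n. P m (vdiff F x (vzero F))) f sequentially"
    by (rule entire_functionsE[OF f zero_closed]) blast
  obtain n where "\<forall>x\<in>{x \<in> points F. vnorm F (vdiff F x (vzero F)) < r}.
      dist (\<Sum>m<n. P m (vdiff F x (vzero F))) (f x) < 1"
    using eventually_happens'[OF sequentially_bot uniform_limitD[OF ul zero_less_one]] by blast
  then have n: "dist (\<Sum>m<n. P m x) (f x) < 1" if "x \<in> points F" "vnorm F x < r" for x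
    using that by (force simp: vdiff_vzero)
  have "continuous_map (vtopology F) euclidean (\<lambda>x. \<Sum>m<n. P m x)"
    using P by (intro continuous_map_sum) (auto simp: homogeneous_polynomial_def)
  then obtain \<rho> where \<rho>: "0 < \<rho>"
    "\<And>x. x \<in> points F \<Longrightarrow> vnorm F x < \<rho> \<Longrightarrow> norm ((\<Sum>m<n. P m x) - (\<Sum>m<n. P m (vzero F))) < 1"
    by (rule continuous_map_near_vzero) blast
  show thesis
  proof (rule that[of "min r \<rho>" "2 + norm (\<Sum>m<n. P m (vzero F))"])
    fix x assume x: "x \<in> points F" "vnorm F x < min r \<rho>"
    have "norm (f x) \<le> norm (f x - (\<Sum>m<n. P m x)) + norm ((\<Sum>m<n. P m x) - (\<Sum>m<n. P m (vzero F)))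
        + norm (\<Sum>m<n. P m (vzero F))"
      using norm_triangle_ineq[of "f x - (\<Sum>m<n. P m x)" "(\<Sum>m<n. P m x) - (\<Sum>m<n. P m (vzero F))"]
        norm_triangle_ineq[of "f x - (\<Sum>m<n. P m (vzero F))" "\<Sum>m<n. P m (vzero F)"] by simp
    then show "norm (f x) \<le> 2 + norm (\<Sum>m<n. P m (vzero F))"
      using n[of x] \<rho>(2)[of x] x by (simp add: dist_norm norm_minus_commute)
  qed (use r \<rho> in auto)
qed

text \<open>On the line through 0 and \<open>x\<close>, the expansion of \<open>f\<close> about
  \<open>vscale F \<zeta> x\<close> is a power series in the increment with coefficients
  \<open>P m x\<close>, so its linear term is the derivative.\<close>

lemma entire_line_derivative:
  fixes f :: "'f \<Rightarrow> complex"
  assumes x: "x \<in> points F" and r: "0 < r" and P: "\<And>m. homogeneous_polynomial F m (P m)"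
    and ul: "uniform_limit {y \<in> points F. vnorm F (vdiff F y (vscale F \<zeta> x)) < r}
      (\<lambda>n y. \<Sum>m<n. P m (vdiff F y (vscale F \<zeta> x))) f sequentially"
  shows "((\<lambda>\<zeta>. f (vscale F \<zeta> x)) has_field_derivative P 1 x) (at \<zeta>)"
proof -
  \<comment> \<open>The added 1 avoids a division by zero at \<open>x = vzero F\<close>.\<close>
  define \<delta> where "\<delta> = r / (vnorm F x + 1)"
  have \<delta>: "0 < \<delta>" using r norm_nonneg[OF x] by (simp add: \<delta>_def add_nonneg_pos)
  define c where "c m = P m x" for m
  have sums: "(\<lambda>m. c m * w ^ m) sums f (vscale F (w + \<zeta>) x)" if w: "norm w < \<delta>" for w
  proof -
    have "cmod w * vnorm F x \<le> cmod w * (vnorm F x + 1)" by (intro mult_left_mono) auto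
    also have "\<dots> < r" using w norm_nonneg[OF x] unfolding \<delta>_def by (simp add: pos_less_divide_eq add_nonneg_pos)
    finally have "vnorm F (vscale F w x) < r" by (simp add: norm_scale[OF x])
    then have "vscale F (w + \<zeta>) x \<in> {y \<in> points F. vnorm F (vdiff F y (vscale F \<zeta> x)) < r}"
      using x by (simp add: vdiff_scale scale_closed)
    from tendsto_uniform_limitI[OF ul this] show ?thesis
      unfolding sums_def c_def
      by (simp add: vdiff_scale[OF x] homogeneous_polynomial_scale[OF P x] scaleC_complex_def mult.commute)
  qed
  have "((\<lambda>w. \<Sum>n. c n * w ^ n) has_field_derivative (\<Sum>n. diffs c n * 0 ^ n)) (at 0)"
    by (rule termdiffs_strong'[of \<delta>]) (use sums \<delta> in \<open>auto simp: sums_iff\<close>)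
  then have "((\<lambda>w. \<Sum>n. c n * w ^ n) has_field_derivative c 1) (at 0)"
    by (simp add: powser_zero diffs_def)
  then have "((\<lambda>w. f (vscale F (w + \<zeta>) x)) has_field_derivative c 1) (at 0)"
    by (rule has_field_derivative_transform_within_open[of _ _ _ "ball 0 \<delta>"])
      (use \<delta> sums in \<open>auto simp: sums_iff\<close>)
  then show ?thesis using DERIV_shift[of "\<lambda>\<zeta>. f (vscale F \<zeta> x)" "c 1" 0 \<zeta>] by (simp add: c_def)
qed

lemma entire_line_holomorphic:
  fixes f :: "'f \<Rightarrow> complex"
  assumes f: "f \<in> entire_functions F" and x: "x \<in> points F"
  shows "(\<lambda>\<zeta>. f (vscale F \<zeta> x)) holomorphic_on UNIV"
proof -
  have "(\<lambda>\<zeta>. f (vscale F \<zeta> x)) field_differentiable (at \<zeta>)" for \<zeta>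
  proof -
    obtain r P where "0 < r" "\<And>m. homogeneous_polynomial F m (P m)"
      "uniform_limit {y \<in> points F. vnorm F (vdiff F y (vscale F \<zeta> x)) < r}
        (\<lambda>n y. \<Sum>m<n. P m (vdiff F y (vscale F \<zeta> x))) f sequentially"
      by (rule entire_functionsE[OF f scale_closed[OF x]]) blast
    then show ?thesis unfolding field_differentiable_def by (blast intro: entire_line_derivative[OF x])
  qed
  then show ?thesis by (simp add: holomorphic_on_def)
qed

text \<open>The derivative is the degree-one term of the expansion at the origin, so a continuous
  linear functional on \<open>F\<close>.\<close>

lemma entire_derivative_at_vzero:
  fixes f :: "'f \<Rightarrow> complex"
  assumes f: "f \<in> entire_functions F"
  obtains \<psi> M where "0 \<le> M"
    "\<And>x. x \<in> points F \<Longrightarrow> deriv (\<lambda>\<zeta>. f (vscale F \<zeta> x)) 0 = \<psi> x"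
    "\<And>x y. x \<in> points F \<Longrightarrow> y \<in> points F \<Longrightarrow> \<psi> (vadd F x y) = \<psi> x + \<psi> y"
    "\<And>x c. x \<in> points F \<Longrightarrow> \<psi> (vscale F c x) = c * \<psi> x"
    "\<And>x. x \<in> points F \<Longrightarrow> cmod (\<psi> x) \<le> M * vnorm F x"
proof -
  obtain r P where r: "0 < r" and P: "\<And>m. homogeneous_polynomial F m (P m)"
    and ul: "uniform_limit {x \<in> points F. vnorm F (vdiff F x (vzero F)) < r}
      (\<lambda>n x. \<Sum>m<n. P m (vdiff F x (vzero F))) f sequentially"
    by (rule entire_functionsE[OF f zero_closed]) blast
  obtain M where M: "0 \<le> M" "\<And>x. x \<in> points F \<Longrightarrow> norm (P 1 x) \<le> M * vnorm F x"
    using linear_part_at_vzero(2)[OF P] by blast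
  show thesis
  proof (rule that[OF M(1)])
    show "deriv (\<lambda>\<zeta>. f (vscale F \<zeta> x)) 0 = P 1 x" if x: "x \<in> points F" for x
      by (rule DERIV_imp_deriv, rule entire_line_derivative[OF x r P])
        (use ul in \<open>simp add: scale_0[OF x]\<close>)
    show "P 1 (vscale F c x) = c * P 1 x" if "x \<in> points F" for c x
      using homogeneous_polynomial_scale[OF P that, of 1 c] by (simp add: scaleC_complex_def)
  qed (use linear_part_at_vzero(1)[OF P] M in auto)
qed

end

section \<open>From the approximation property to density\<close>

text \<open>The only property of the topology needed for density: closeness to \<open>f\<close> on
  an arbitrary neighbourhood of a suitable compact set puts \<open>g\<close> into \<open>U\<close>.
  The induction follows the generation of open sets; intersections take the union of the two compact
  sets.\<close>

lemma nachbin_neighbourhood: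
  fixes F :: "'f cspace" and f :: "'f \<Rightarrow> 'e::complex_banach"
  assumes F: "complex_banach_space F" and U: "openin (nachbin_topology F) U"
    and f: "f \<in> entire_functions F" "f \<in> U"
  shows "\<exists>K. compactin (vtopology F) K \<and>
    (\<forall>V. openin (vtopology F) V \<and> K \<subseteq> V \<longrightarrow>
      (\<exists>\<delta>>0. \<forall>g\<in>entire_functions F. (\<forall>x\<in>V. norm (g x - f x) \<le> \<delta>) \<longrightarrow> g \<in> U))"
proof -
  have "generate_topology_on {{g \<in> entire_functions F. s (\<lambda>x. g x - f x) < \<epsilon>} | (s :: ('f \<Rightarrow> 'e) \<Rightarrow> real) f \<epsilon>.
        ported_seminorm F s \<and> f \<in> entire_functions F \<and> 0 < \<epsilon>} U"
    using U unfolding nachbin_topology_def openin_topology_generated_by_iff .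
  then show ?thesis using f(2)
  proof (induction rule: generate_topology_on.induct)
    case Empty
    then show ?case by simp
  next
    case (Int A B)
    from Int.prems have fAB: "f \<in> A" "f \<in> B" by simp_all
    obtain K where K: "compactin (vtopology F) K"
        "\<forall>V. openin (vtopology F) V \<and> K \<subseteq> V \<longrightarrow>
          (\<exists>\<delta>>0. \<forall>g\<in>entire_functions F. (\<forall>x\<in>V. norm (g x - f x) \<le> \<delta>) \<longrightarrow> g \<in> A)"
      using Int.IH(1)[OF fAB(1)] by blast
    obtain L where L: "compactin (vtopology F) L"
        "\<forall>V. openin (vtopology F) V \<and> L \<subseteq> V \<longrightarrow>
          (\<exists>\<delta>>0. \<forall>g\<in>entire_functions F. (\<forall>x\<in>V. norm (g x - f x) \<le> \<delta>) \<longrightarrow> g \<in> B)"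
      using Int.IH(2)[OF fAB(2)] by blast
    show ?case
    proof (intro exI[of _ "K \<union> L"] conjI allI impI)
      show "compactin (vtopology F) (K \<union> L)" using K(1) L(1) by (rule compactin_Un)
      fix V assume V: "openin (vtopology F) V \<and> K \<union> L \<subseteq> V"
      obtain \<delta> where \<delta>: "\<delta> > 0" "\<forall>g\<in>entire_functions F. (\<forall>x\<in>V. norm (g x - f x) \<le> \<delta>) \<longrightarrow> g \<in> A"
        using K(2)[rule_format, of V] V by blast
      obtain \<eta> where \<eta>: "\<eta> > 0" "\<forall>g\<in>entire_functions F. (\<forall>x\<in>V. norm (g x - f x) \<le> \<eta>) \<longrightarrow> g \<in> B"
        using L(2)[rule_format, of V] V by blast
      show "\<exists>\<delta>>0. \<forall>g\<in>entire_functions F. (\<forall>x\<in>V. norm (g x - f x) \<le> \<delta>) \<longrightarrow> g \<in> A \<inter> B"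
        using \<delta> \<eta> by (intro exI[of _ "min \<delta> \<eta>"]) simp
    qed
  next
    case (UN \<U>)
    then obtain A where "A \<in> \<U>" "f \<in> A" by blast
    obtain K where K: "compactin (vtopology F) K"
        "\<forall>V. openin (vtopology F) V \<and> K \<subseteq> V \<longrightarrow>
          (\<exists>\<delta>>0. \<forall>g\<in>entire_functions F. (\<forall>x\<in>V. norm (g x - f x) \<le> \<delta>) \<longrightarrow> g \<in> A)"
      using UN.IH[OF \<open>A \<in> \<U>\<close> \<open>f \<in> A\<close>] by blast
    show ?case
    proof (intro exI[of _ K] conjI allI impI)
      fix V assume "openin (vtopology F) V \<and> K \<subseteq> V"
      then obtain \<delta> where "\<delta> > 0" "\<forall>g\<in>entire_functions F. (\<forall>x\<in>V. norm (g x - f x) \<le> \<delta>) \<longrightarrow> g \<in> A"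
        using K(2)[rule_format, of V] by blast
      then show "\<exists>\<delta>>0. \<forall>g\<in>entire_functions F. (\<forall>x\<in>V. norm (g x - f x) \<le> \<delta>) \<longrightarrow> g \<in> \<Union>\<U>"
        using \<open>A \<in> \<U>\<close> by (intro exI[of _ \<delta>] conjI ballI impI UnionI[of A]) simp_all
    qed (rule K(1))
  next
    case (Basis A)
    then obtain s :: "('f \<Rightarrow> 'e) \<Rightarrow> real" and f0 \<epsilon> where s: "ported_seminorm F s"
      and f0: "f0 \<in> entire_functions F" and A: "A = {g \<in> entire_functions F. s (\<lambda>x. g x - f0 x) < \<epsilon>}"
      by blast
    have sub: "s (\<lambda>x. g x + h x) \<le> s g + s h"
      if "g \<in> entire_functions F" "h \<in> entire_functions F" for g h
      using s that by (simp add: ported_seminorm_def entire_seminorm_def)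
    have fA: "s (\<lambda>x. f x - f0 x) < \<epsilon>" using Basis.prems A by simp
    obtain K where K: "compactin (vtopology F) K"
      "\<forall>V. openin (vtopology F) V \<and> K \<subseteq> V \<longrightarrow> (\<exists>C>0. \<forall>f\<in>entire_functions F.
              ennreal (s f) \<le> ennreal C * (SUP x\<in>V. ennreal (norm (f x))))"
      using conjunct2[OF s[unfolded ported_seminorm_def]] by (elim exE conjE)
    show ?case
    proof (intro exI[of _ K] conjI allI impI)
      fix V assume V: "openin (vtopology F) V \<and> K \<subseteq> V"
      then obtain C where C: "C > 0" "\<forall>f\<in>entire_functions F.
              ennreal (s f) \<le> ennreal C * (SUP x\<in>V. ennreal (norm (f x)))"
        using K(2)[rule_format, OF V] by (elim exE conjE)
      \<comment> \<open>The basic set is centred at \<open>f0\<close>, not at \<open>f\<close>. Half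
        of the remaining margin is spent on \<open>g - f\<close>, and division by \<open>C\<close>
        turns a bound on \<open>V\<close> into a bound for \<open>s\<close>.\<close>
      define \<delta> where "\<delta> = (\<epsilon> - s (\<lambda>x. f x - f0 x)) / (2 * C)"
      have \<delta>: "\<delta> > 0" using fA C(1) by (simp add: \<delta>_def)
      have "g \<in> A" if g: "g \<in> entire_functions F" and le: "\<forall>x\<in>V. norm (g x - f x) \<le> \<delta>" for g
      proof -
        have gf: "(\<lambda>x. g x - f x) \<in> entire_functions F" by (rule entire_diff[OF g f(1)])
        have ff: "(\<lambda>x. f x - f0 x) \<in> entire_functions F" by (rule entire_diff[OF f(1) f0])
        have "ennreal (s (\<lambda>x. g x - f x)) \<le> ennreal C * (SUP x\<in>V. ennreal (norm (g x - f x)))"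
          by (rule C(2)[rule_format, OF gf])
        also have "\<dots> \<le> ennreal C * ennreal \<delta>"
          using le by (intro mult_left_mono SUP_least) (auto intro: ennreal_leI)
        also have "\<dots> = ennreal (C * \<delta>)" using C(1) \<delta> by (simp add: ennreal_mult)
        finally have "s (\<lambda>x. g x - f x) \<le> C * \<delta>" using C(1) \<delta> by (simp add: ennreal_le_iff)
        also have "C * \<delta> = (\<epsilon> - s (\<lambda>x. f x - f0 x)) / 2" using C(1) by (simp add: \<delta>_def)
        finally have 1: "s (\<lambda>x. g x - f x) \<le> (\<epsilon> - s (\<lambda>x. f x - f0 x)) / 2" .
        have "s (\<lambda>x. (g x - f x) + (f x - f0 x)) \<le> s (\<lambda>x. g x - f x) + s (\<lambda>x. f x - f0 x)"
          by (rule sub[OF gf ff])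
        then have "s (\<lambda>x. g x - f0 x) < \<epsilon>" using 1 fA by simp
        then show "g \<in> A" using g A by simp
      qed
      then show "\<exists>\<delta>>0. \<forall>g\<in>entire_functions F. (\<forall>x\<in>V. norm (g x - f x) \<le> \<delta>) \<longrightarrow> g \<in> A"
        using \<delta> by blast
    qed (rule K(1))
  qed
qed

lemma topspace_nachbin_topology:
  "topspace (nachbin_topology F) = (entire_functions F :: ('f \<Rightarrow> 'e::complex_banach) set)"
proof (rule equalityI)
  show "topspace (nachbin_topology F) \<subseteq> (entire_functions F :: ('f \<Rightarrow> 'e) set)"
    unfolding nachbin_topology_def topology_generated_by_topspace by blast
  \<comment> \<open>The zero seminorm is ported, even by the empty set, and its basic sets contain
    every entire function.\<close>
  have zero: "ported_seminorm F (\<lambda>_ :: 'f \<Rightarrow> 'e. 0)"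
    unfolding ported_seminorm_def entire_seminorm_def
    by (auto intro!: exI[of _ "{}"] exI[of _ 1])
  show "(entire_functions F :: ('f \<Rightarrow> 'e) set) \<subseteq> topspace (nachbin_topology F)"
  proof
    fix f :: "'f \<Rightarrow> 'e" assume f: "f \<in> entire_functions F"
    have "openin (nachbin_topology F) {g \<in> entire_functions F. (\<lambda>_. 0 :: real) (\<lambda>x. g x - f x) < 1}"
      unfolding nachbin_topology_def
      by (rule topology_generated_by_Basis, rule CollectI, rule exI[of _ "\<lambda>_. 0"], rule exI[of _ f],
          rule exI[of _ 1]) (use zero f in simp)
    from openin_subset[OF this] f show "f \<in> topspace (nachbin_topology F)" by auto
  qed
qed

lemma p_compact_entire_functions_subset: "p_compact_entire_functions p F \<subseteq> entire_functions F"
  by (auto simp: p_compact_entire_functions_def)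

lemma p_compact_entire_bounded_clinear:
  assumes p: "1 \<le> p" and T: "bounded_clinear T" and f: "f \<in> p_compact_entire_functions p F"
  shows "(\<lambda>x. T (f x)) \<in> p_compact_entire_functions p F"
  unfolding p_compact_entire_functions_def
proof (intro CollectI conjI ballI)
  show "(\<lambda>x. T (f x)) \<in> entire_functions F"
    using f by (intro entire_bounded_clinear[OF T]) (simp add: p_compact_entire_functions_def)
  fix x assume "x \<in> points F"
  then obtain V where V: "openin (vtopology F) V" "x \<in> V" "relatively_p_compact p (f ` V)"
    using f by (auto simp: p_compact_entire_functions_def)
  have "relatively_p_compact p (T ` f ` V)"
    using T V(3) p by (intro relatively_p_compact_image) (auto simp: bounded_clinear_def)
  then show "\<exists>V. openin (vtopology F) V \<and> x \<in> V \<and> relatively_p_compact p ((\<lambda>x. T (f x)) ` V)"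
    using V by (auto simp: image_image)
qed

text \<open>Finitely many of the local neighbourhoods cover \<open>K\<close>, and relative
  p-compactness passes to finite unions.\<close>

lemma p_compact_image_near_compact:
  assumes p: "1 \<le> p" and f: "f \<in> p_compact_entire_functions p F" and K: "compactin (vtopology F) K"
    and F: "complex_banach_space F"
  obtains V where "openin (vtopology F) V" "K \<subseteq> V" "relatively_p_compact p (f ` V)"
proof -
  interpret M: Metric_space "points F" "vdist F" by (rule complex_banach_space.Metric_space_vdist[OF F])
  have "K \<subseteq> points F" using compactin_subset_topspace[OF K] by simp
  then have "\<exists>V. openin (vtopology F) V \<and> x \<in> V \<and> relatively_p_compact p (f ` V)" if "x \<in> K" for x
    using f that by (auto simp: p_compact_entire_functions_def)
  then obtain W where W: "\<And>x. x \<in> K \<Longrightarrow> openin (vtopology F) (W x) \<and> x \<in> W x \<and> relatively_p_compact p (f ` W x)"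
    by metis
  have "\<exists>\<F>. finite \<F> \<and> \<F> \<subseteq> W ` K \<and> K \<subseteq> \<Union>\<F>"
    by (rule compactinD[OF K]) (use W in auto)
  then obtain \<F> where \<F>: "finite \<F>" "\<F> \<subseteq> W ` K" "K \<subseteq> \<Union>\<F>" by blast
  obtain I where "I \<subseteq> K" "finite I" "\<F> = W ` I" using finite_subset_image[OF \<F>(1,2)] by blast
  with \<F>(3) have I: "finite I" "I \<subseteq> K" "K \<subseteq> \<Union>(W ` I)" by simp_all
  show thesis
  proof (rule that[of "\<Union>(W ` I)"])
    show "openin (vtopology F) (\<Union>(W ` I))" using I W by (intro openin_Union) auto
    have "f ` \<Union>(W ` I) = (\<Union>i\<in>I. f ` W i)" by blast
    moreover have "relatively_p_compact p (\<Union>i\<in>I. f ` W i)"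
      by (rule relatively_p_compact_UN[OF p I(1)]) (use I(2) W in auto)
    ultimately show "relatively_p_compact p (f ` \<Union>(W ` I))" by (simp only:)
  qed fact
qed

lemma approximation_property_imp_dense:
  fixes F :: "'f cspace"
  assumes p: "1 \<le> p" and ap: "p_approximation_property p TYPE('e::complex_banach)"
    and F: "complex_banach_space F"
  shows "subtopology (nachbin_topology F) (p_compact_entire_functions p F) closure_of
           (entire_tensor F :: ('f \<Rightarrow> 'e) set) = p_compact_entire_functions p F"
    (is "?X closure_of _ = ?H")
proof (rule equalityI)
  have top: "topspace ?X = ?H"
    using p_compact_entire_functions_subset[of p F] by (auto simp: topspace_nachbin_topology)
  show "?X closure_of entire_tensor F \<subseteq> ?H" using closure_of_subset_topspace[of ?X] top by simp
  show "?H \<subseteq> ?X closure_of entire_tensor F"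
  proof
    fix f :: "'f \<Rightarrow> 'e" assume f: "f \<in> ?H"
    then have fe: "f \<in> entire_functions F" using p_compact_entire_functions_subset by blast
    have "\<exists>g. g \<in> entire_tensor F \<and> g \<in> U'" if "f \<in> U'" "openin ?X U'" for U'
    proof -
      obtain U where U: "openin (nachbin_topology F) U" "U' = U \<inter> ?H"
        using \<open>openin ?X U'\<close> by (auto simp: openin_subtopology)
      have fU: "f \<in> U" using that U by blast
      obtain K where K: "compactin (vtopology F) K"
        "\<forall>V. openin (vtopology F) V \<and> K \<subseteq> V \<longrightarrow>
          (\<exists>\<delta>>0. \<forall>g\<in>entire_functions F. (\<forall>x\<in>V. norm (g x - f x) \<le> \<delta>) \<longrightarrow> g \<in> U)"
        using nachbin_neighbourhood[OF F U(1) fe fU] by (elim exE conjE)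
      obtain V where V: "openin (vtopology F) V" "K \<subseteq> V" "relatively_p_compact p (f ` V)"
        by (rule p_compact_image_near_compact[OF p f K(1) F])
      obtain \<delta> where \<delta>: "\<delta> > 0"
        "\<forall>g\<in>entire_functions F. (\<forall>x\<in>V. norm (g x - f x) \<le> \<delta>) \<longrightarrow> g \<in> U"
        using K(2)[rule_format, OF conjI[OF V(1,2)]] by (elim exE conjE)
      obtain y where y: "p_summable p y" "f ` V \<subseteq> closure (p_hull p y)"
        using V(3) unfolding relatively_p_compact_iff by blast
      \<comment> \<open>The approximation property is stated for closed sets, so it is applied to
        the closure of the image.\<close>
      have "p_compact p (closure (f ` V))"
        unfolding p_compact_def relatively_p_compact_iff
        by (intro conjI exI[of _ y] closed_closure closure_minimal y)
      from ap[unfolded p_approximation_property_def, rule_format, OF this \<delta>(1)]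
      obtain T where T: "finite_rank_operator T"
        "(SUP y\<in>closure (f ` V). ennreal (norm (T y - y))) < ennreal \<delta>"
        by (elim exE conjE)
      note finite_rank = T(1)[unfolded finite_rank_operator_def]
      have Tc: "bounded_clinear T"
        unfolding bounded_clinear_def
        by (rule conjI[OF conjunct1[OF finite_rank] conjunct1[OF conjunct2[OF finite_rank]]])
      obtain B where B: "finite B" "range T \<subseteq> module.span scaleC B"
        using conjunct2[OF conjunct2[OF finite_rank]] by (elim exE conjE)
      have close: "norm (T (f x) - f x) \<le> \<delta>" if "x \<in> V" for x
      proof -
        have "f x \<in> closure (f ` V)" using that by (intro subsetD[OF closure_subset] imageI)
        then have "ennreal (norm (T (f x) - f x)) \<le> (SUP y\<in>closure (f ` V). ennreal (norm (T y - y)))"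
          by (rule SUP_upper[where f = "\<lambda>y. ennreal (norm (T y - y))"])
        also have "\<dots> < ennreal \<delta>" by (rule T(2))
        finally show ?thesis using \<delta>(1) by (simp add: ennreal_less_iff)
      qed
      \<comment> \<open>Neighbourhoods are taken in the subspace of p-compact functions, so the
        approximant must be shown to lie there as well.\<close>
      have Tf: "(\<lambda>x. T (f x)) \<in> ?H" by (rule p_compact_entire_bounded_clinear[OF p Tc f])
      have "(\<lambda>x. T (f x)) \<in> U"
        using close by (intro \<delta>(2)[rule_format] entire_bounded_clinear[OF Tc fe]) simp
      with Tf have TU: "(\<lambda>x. T (f x)) \<in> U'" using U(2) by simp
      obtain n h e where h: "\<forall>j<n. bounded_clinear (h j)"
        "\<forall>x. T x = (\<Sum>j<(n::nat). scaleC (h j x :: complex) (e j))"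
        using finite_rank_decomposition[OF Tc B] by (elim exE conjE)
      have "(\<lambda>x. T (f x)) \<in> entire_tensor F"
        unfolding entire_tensor_def
        by (intro CollectI exI[of _ n] exI[of _ "\<lambda>j x. h j (f x)"] exI[of _ e] conjI allI impI ballI
            entire_bounded_clinear[OF h(1)[rule_format] fe] h(2)[rule_format])
      with TU show ?thesis by (intro exI conjI)
    qed
    with f show "f \<in> ?X closure_of entire_tensor F" unfolding in_closure_of top by simp
  qed
qed

section \<open>The derivative at the origin as a ported seminorm\<close>

context complex_banach_space
begin

text \<open>Testing with functionals of norm at most one reduces the derivative of a vector-valued
  function to derivatives of scalar functions of one complex variable.\<close>

definition unit_pairs :: "('f \<times> ('e::complex_banach \<Rightarrow> complex)) set" where
  "unit_pairs = {(x, h). x \<in> points F \<and> vnorm F x \<le> 1 \<and> bounded_clinear h \<and> (\<forall>y. cmod (h y) \<le> norm y)}"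

definition line_derivative :: "('f \<Rightarrow> 'e::complex_banach) \<Rightarrow> 'f \<times> ('e \<Rightarrow> complex) \<Rightarrow> complex" where
  "line_derivative f = (\<lambda>(x, h). deriv (\<lambda>\<zeta>. h (f (vscale F \<zeta> x))) 0)"

text \<open>By the norming functionals, this is the operator norm of the derivative of
  \<open>f\<close> at the origin.\<close>

definition derivative_seminorm :: "('f \<Rightarrow> 'e::complex_banach) \<Rightarrow> real" where
  "derivative_seminorm f = (SUP z\<in>unit_pairs. cmod (line_derivative f z))"

lemma unit_pairs_nonempty: "(unit_pairs :: ('f \<times> ('e::complex_banach \<Rightarrow> complex)) set) \<noteq> {}"
proof -
  have "(vzero F, \<lambda>_. 0) \<in> (unit_pairs :: ('f \<times> ('e::complex_banach \<Rightarrow> complex)) set)"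
    by (simp add: unit_pairs_def zero_closed norm_vzero bounded_clinear_def scaleC_complex_def)
  then show ?thesis by blast
qed

lemma line_differentiable:
  fixes f :: "'f \<Rightarrow> 'e::complex_banach"
  assumes f: "f \<in> entire_functions F" and x: "x \<in> points F" and h: "bounded_clinear h"
  shows "(\<lambda>\<zeta>. h (f (vscale F \<zeta> x)) :: complex) holomorphic_on UNIV"
    and "(\<lambda>\<zeta>. h (f (vscale F \<zeta> x)) :: complex) field_differentiable at \<zeta>"
proof -
  show hol: "(\<lambda>\<zeta>. h (f (vscale F \<zeta> x)) :: complex) holomorphic_on UNIV"
    by (rule entire_line_holomorphic[OF entire_bounded_clinear[OF h f] x])
  then show "(\<lambda>\<zeta>. h (f (vscale F \<zeta> x)) :: complex) field_differentiable at \<zeta>"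
    by (simp add: holomorphic_on_def)
qed

text \<open>Cauchy's inequality on the circle of radius \<open>\<rho> / 2\<close>: for
  \<open>x\<close> in the unit ball, the points of the line above that circle stay inside the ball
  where \<open>B\<close> bounds \<open>f\<close>.\<close>

lemma line_derivative_bound:
  fixes f :: "'f \<Rightarrow> 'e::complex_banach"
  assumes f: "f \<in> entire_functions F" and z: "z \<in> unit_pairs" and \<rho>: "0 < \<rho>"
    and B: "\<And>x. x \<in> points F \<Longrightarrow> vnorm F x < \<rho> \<Longrightarrow> norm (f x) \<le> B"
  shows "cmod (line_derivative f z) \<le> 2 / \<rho> * B"
proof -
  obtain x h where z: "z = (x, h)" "x \<in> points F" "vnorm F x \<le> 1" "bounded_clinear h" "\<And>y. cmod (h y) \<le> norm y"
    using z by (auto simp: unit_pairs_def)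
  let ?g = "\<lambda>\<zeta>. h (f (vscale F \<zeta> x))"
  have hol: "?g holomorphic_on UNIV" by (rule line_differentiable(1)[OF f z(2,4)])
  have "cmod ((deriv ^^ 1) ?g 0) \<le> fact 1 * B / (\<rho> / 2) ^ 1"
  proof (rule Cauchy_inequality)
    show "?g holomorphic_on ball 0 (\<rho> / 2)" using hol by (rule holomorphic_on_subset) simp
    show "continuous_on (cball 0 (\<rho> / 2)) ?g"
      using holomorphic_on_imp_continuous_on[OF hol] by (rule continuous_on_subset) simp
    fix \<zeta> :: complex assume "cmod (0 - \<zeta>) = \<rho> / 2"
    then have "vnorm F (vscale F \<zeta> x) \<le> \<rho> / 2 * 1"
      unfolding norm_scale[OF z(2)] using z(3) \<rho> by (intro mult_mono) (auto simp: norm_nonneg[OF z(2)])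
    then have "vnorm F (vscale F \<zeta> x) < \<rho>" using \<rho> by simp
    then have "norm (f (vscale F \<zeta> x)) \<le> B" using scale_closed[OF z(2)] B by blast
    then show "cmod (?g \<zeta>) \<le> B" using z(5) order_trans by blast
  qed (use \<rho> in simp)
  then show ?thesis by (simp add: line_derivative_def z(1) mult.commute)
qed

lemma line_derivative_le_seminorm:
  fixes f :: "'f \<Rightarrow> 'e::complex_banach"
  assumes f: "f \<in> entire_functions F" and z: "z \<in> unit_pairs"
  shows "cmod (line_derivative f z) \<le> derivative_seminorm f"
proof -
  obtain \<rho> B where "0 < \<rho>" "\<And>x. x \<in> points F \<Longrightarrow> vnorm F x < \<rho> \<Longrightarrow> norm (f x) \<le> B"
    by (rule entire_locally_bounded_at_vzero[OF f]) blast
  then have "bdd_above ((\<lambda>z. cmod (line_derivative f z)) ` unit_pairs)"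
    using line_derivative_bound[OF f] by (intro bdd_aboveI2) blast
  then show ?thesis unfolding derivative_seminorm_def by (intro cSUP_upper z)
qed

lemma derivative_seminorm_le:
  fixes f :: "'f \<Rightarrow> 'e::complex_banach"
  assumes "\<And>z. z \<in> unit_pairs \<Longrightarrow> cmod (line_derivative f z) \<le> B"
  shows "derivative_seminorm f \<le> B"
  unfolding derivative_seminorm_def by (rule cSUP_least[OF unit_pairs_nonempty assms])

lemma line_derivative_scaleC:
  fixes f :: "'f \<Rightarrow> 'e::complex_banach"
  assumes f: "f \<in> entire_functions F" and z: "z \<in> unit_pairs"
  shows "line_derivative (\<lambda>x. scaleC c (f x)) z = c * line_derivative f z"
  using z line_differentiable(2)[OF f]
  by (auto simp: unit_pairs_def line_derivative_def bounded_clinear_scale scaleC_complex_def deriv_cmult)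

lemma line_derivative_add:
  fixes f g :: "'f \<Rightarrow> 'e::complex_banach"
  assumes f: "f \<in> entire_functions F" and g: "g \<in> entire_functions F" and z: "z \<in> unit_pairs"
  shows "line_derivative (\<lambda>x. f x + g x) z = line_derivative f z + line_derivative g z"
  using z line_differentiable(2)[OF f] line_differentiable(2)[OF g]
  by (auto simp: unit_pairs_def line_derivative_def bounded_clinear_add deriv_add)

lemma entire_seminorm_derivative_seminorm:
  "entire_seminorm F (derivative_seminorm :: ('f \<Rightarrow> 'e::complex_banach) \<Rightarrow> real)"
  unfolding entire_seminorm_def
proof (intro conjI ballI allI)
  fix f g :: "'f \<Rightarrow> 'e" assume f: "f \<in> entire_functions F" and g: "g \<in> entire_functions F"
  show "derivative_seminorm (\<lambda>x. f x + g x) \<le> derivative_seminorm f + derivative_seminorm g"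
  proof (rule derivative_seminorm_le)
    fix z :: "'f \<times> ('e \<Rightarrow> complex)" assume z: "z \<in> unit_pairs"
    show "cmod (line_derivative (\<lambda>x. f x + g x) z) \<le> derivative_seminorm f + derivative_seminorm g"
      unfolding line_derivative_add[OF f g z]
      by (rule order_trans[OF norm_triangle_ineq add_mono[OF line_derivative_le_seminorm[OF f z]
            line_derivative_le_seminorm[OF g z]]])
  qed
next
  fix f :: "'f \<Rightarrow> 'e" and c assume f: "f \<in> entire_functions F"
  have le: "derivative_seminorm (\<lambda>x. scaleC c (f x)) \<le> cmod c * derivative_seminorm f"
    if f: "f \<in> entire_functions F" for c and f :: "'f \<Rightarrow> 'e"
    using line_derivative_le_seminorm[OF f]
    by (intro derivative_seminorm_le)
      (auto simp: line_derivative_scaleC[OF f] norm_mult intro!: mult_left_mono)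
  have cf: "(\<lambda>x. scaleC c (f x)) \<in> entire_functions F"
    by (rule entire_bounded_clinear[OF bounded_clinear_scaleC f])
  show "derivative_seminorm (\<lambda>x. scaleC c (f x)) = cmod c * derivative_seminorm f"
  \<comment> \<open>The reverse inequality is the same estimate with factor \<open>1 / c\<close>;
    for \<open>c = 0\<close> nonnegativity is enough.\<close>
  proof (rule antisym[OF le[OF f]], cases "c = 0")
    case True
    obtain z where "z \<in> (unit_pairs :: ('f \<times> ('e \<Rightarrow> complex)) set)" using unit_pairs_nonempty by blast
    from order_trans[OF norm_ge_zero line_derivative_le_seminorm[OF cf this]]
    show "cmod c * derivative_seminorm f \<le> derivative_seminorm (\<lambda>x. scaleC c (f x))"
      using True by simp
  next
    case False
    have "derivative_seminorm f \<le> cmod (1 / c) * derivative_seminorm (\<lambda>x. scaleC c (f x))"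
      using le[OF cf, of "1 / c"] False by (simp add: scaleC_scaleC scaleC_one)
    then show "cmod c * derivative_seminorm f \<le> derivative_seminorm (\<lambda>x. scaleC c (f x))"
      using False by (simp add: norm_divide field_simps)
  qed
qed

text \<open>Every open \<open>V\<close> around the origin contains a ball of some radius \<rho>, and
  Cauchy's inequality allows the constant \<open>2 / \<rho>\<close>.\<close>

lemma ported_derivative_seminorm:
  "ported_seminorm F (derivative_seminorm :: ('f \<Rightarrow> 'e::complex_banach) \<Rightarrow> real)"
  unfolding ported_seminorm_def
proof (intro conjI exI[of _ "{vzero F}"] allI impI)
  show "entire_seminorm F (derivative_seminorm :: ('f \<Rightarrow> 'e) \<Rightarrow> real)"
    by (rule entire_seminorm_derivative_seminorm)
  interpret M: Metric_space "points F" "vdist F" by (rule Metric_space_vdist)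
  show "compactin (vtopology F) {vzero F}" by (simp add: zero_closed)
  fix V assume V: "openin (vtopology F) V \<and> {vzero F} \<subseteq> V"
  then obtain \<rho> where \<rho>: "0 < \<rho>" "\<And>x. x \<in> points F \<Longrightarrow> vnorm F x < \<rho> \<Longrightarrow> x \<in> V"
    using open_vzero_ball[of V] by auto
  have "ennreal (derivative_seminorm f) \<le> ennreal (2 / \<rho>) * (SUP x\<in>V. ennreal (norm (f x)))"
    if f: "f \<in> entire_functions F" for f :: "'f \<Rightarrow> 'e"
  \<comment> \<open>An infinite supremum makes the right-hand side infinite, because the constant is
    positive.\<close>
  proof (cases "(SUP x\<in>V. ennreal (norm (f x))) = top")
    case True
    then show ?thesis unfolding True using \<rho>(1) by (subst ennreal_mult_top) (auto simp: ennreal_eq_0_iff)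
  next
    case False
    then obtain B where B: "0 \<le> B" "(SUP x\<in>V. ennreal (norm (f x))) = ennreal B"
      by (metis ennreal_cases)
    have "norm (f x) \<le> B" if "x \<in> points F" "vnorm F x < \<rho>" for x
    proof -
      have "ennreal (norm (f x)) \<le> ennreal B" unfolding B(2)[symmetric] by (rule SUP_upper) (use \<rho> that in auto)
      then show ?thesis using B(1) by (simp add: ennreal_le_iff)
    qed
    then have "derivative_seminorm f \<le> 2 / \<rho> * B"
      by (intro derivative_seminorm_le line_derivative_bound[OF f _ \<rho>(1)]) auto
    then have "ennreal (derivative_seminorm f) \<le> ennreal (2 / \<rho> * B)" by (rule ennreal_leI)
    also have "\<dots> = ennreal (2 / \<rho>) * ennreal B" using \<rho>(1) B(1) by (intro ennreal_mult) auto
    finally show ?thesis using B(2) by simp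
  qed
  then show "\<exists>C>0. \<forall>f\<in>entire_functions F. ennreal (derivative_seminorm f)
      \<le> ennreal C * (SUP x\<in>V. ennreal (norm (f x :: 'e)))"
    using \<rho>(1) by (intro exI[of _ "2 / \<rho>"]) auto
qed

end

section \<open>The Banach space spanned by a closed bounded disc\<close>

text \<open>Boundedness makes the gauge a norm that dominates a multiple of the norm of
  \<open>E\<close>; closedness makes it complete. Balancedness is complex, so that the span is a
  complex space.\<close>

locale banach_disc =
  fixes D :: "'e::complex_banach set"
  assumes closed: "closed D" and zero: "0 \<in> D" and convex: "convex D" and bounded: "bounded D"
    and balanced: "\<lbrakk>x \<in> D; cmod c \<le> 1\<rbrakk> \<Longrightarrow> scaleC c x \<in> D"
begin

definition carrier :: "'e set" where
  "carrier = {t *\<^sub>R d | t d. 0 \<le> t \<and> d \<in> D}"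

text \<open>The Minkowski functional of \<open>D\<close>. On \<open>carrier\<close> the set of
  admissible factors is nonempty, so the infimum is meaningful there.\<close>

definition gauge :: "'e \<Rightarrow> real" where
  "gauge x = Inf {t. 0 \<le> t \<and> x \<in> (\<lambda>d. t *\<^sub>R d) ` D}"

lemma scale_mono:
  assumes "0 \<le> t" "t \<le> s" "x \<in> (\<lambda>d. t *\<^sub>R d) ` D"
  shows "x \<in> (\<lambda>d. s *\<^sub>R d) ` D"
proof (cases "s = 0")
  case False
  obtain d where d: "d \<in> D" "x = t *\<^sub>R d" using assms(3) by auto
  have "scaleC (of_real (t / s)) d \<in> D"
    using assms False d by (intro balanced) (simp_all add: norm_divide)
  then have "(t / s) *\<^sub>R d \<in> D" by (simp only: scaleC_of_real)
  moreover have "x = s *\<^sub>R ((t / s) *\<^sub>R d)" using d False by simp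
  ultimately show ?thesis by blast
qed (use assms in auto)

lemma zero_multiple: "0 \<in> (\<lambda>d. t *\<^sub>R d) ` D"
  using zero by (intro image_eqI[of _ _ 0]) auto

lemma gauge_nonneg: "x \<in> carrier \<Longrightarrow> 0 \<le> gauge x"
  unfolding gauge_def carrier_def by (rule cInf_greatest) auto

lemma gauge_le: "\<lbrakk>0 \<le> t; x \<in> (\<lambda>d. t *\<^sub>R d) ` D\<rbrakk> \<Longrightarrow> x \<in> carrier \<and> gauge x \<le> t"
  unfolding gauge_def carrier_def by (auto intro!: cInf_lower bdd_belowI[of _ 0])

text \<open>With the infimum attained, \<open>gauge x \<le> t\<close> says exactly that
  \<open>x\<close> lies in \<open>t\<close> times \<open>D\<close>, and the norm axioms become
  statements about multiples of \<open>D\<close> with no error terms.\<close>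

lemma gauge_attained:
  assumes x: "x \<in> carrier"
  shows "x \<in> (\<lambda>d. gauge x *\<^sub>R d) ` D"
proof -
  let ?T = "{t. 0 \<le> t \<and> x \<in> (\<lambda>d. t *\<^sub>R d) ` D}"
  have g0: "0 \<le> gauge x" by (rule gauge_nonneg[OF x])
  have "\<exists>d. d \<in> D \<and> x = (gauge x + 1 / Suc n) *\<^sub>R d" for n
  proof -
    have "?T \<noteq> {}" using x by (auto simp: carrier_def)
    moreover have "Inf ?T < gauge x + 1 / Suc n" unfolding gauge_def by simp
    ultimately obtain t where t: "t \<in> ?T" "t < gauge x + 1 / Suc n"
      using cInf_lessD[of ?T] by blast
    then have "x \<in> (\<lambda>d. (gauge x + 1 / Suc n) *\<^sub>R d) ` D" using scale_mono[of t "gauge x + 1 / Suc n" x] by simp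
    then show ?thesis by blast
  qed
  then have "\<exists>d. \<forall>n. d n \<in> D \<and> x = (gauge x + 1 / Suc n) *\<^sub>R d n" by (intro choice allI)
  then obtain d where d: "\<And>n. d n \<in> D" "\<And>n. x = (gauge x + 1 / Suc n) *\<^sub>R d n" by blast
  have lim: "(\<lambda>n. gauge x + 1 / real (Suc n)) \<longlonglongrightarrow> gauge x"
    using tendsto_add[OF tendsto_const LIMSEQ_inverse_real_of_nat] by (simp add: inverse_eq_divide)
  show ?thesis
  \<comment> \<open>In the limit of the factors, boundedness of \<open>D\<close> forces
    \<open>x = 0\<close> if the gauge vanishes; otherwise the normalised vectors converge in the
    closed set \<open>D\<close>.\<close>
  proof (cases "gauge x = 0")
    case True
    obtain M where M: "\<And>d. d \<in> D \<Longrightarrow> norm d \<le> M" using bounded by (auto simp: bounded_iff)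
    have "norm x \<le> (gauge x + 1 / real (Suc n)) * M" for n
    proof -
      have "norm x = norm ((gauge x + 1 / real (Suc n)) *\<^sub>R d n)" by (rule arg_cong[OF d(2)])
      also have "\<dots> = (gauge x + 1 / real (Suc n)) * norm (d n)" using g0 by simp
      also have "\<dots> \<le> (gauge x + 1 / real (Suc n)) * M"
        using M[OF d(1)] g0 by (intro mult_left_mono) auto
      finally show ?thesis .
    qed
    then have "norm x \<le> gauge x * M"
      by (intro LIMSEQ_le_const[OF tendsto_mult[OF lim tendsto_const]]) auto
    then have "x = 0" using True by simp
    then show ?thesis using zero_multiple by simp
  next
    case False
    then have g: "0 < gauge x" using g0 by simp
    have deq: "d n = (1 / (gauge x + 1 / real (Suc n))) *\<^sub>R x" for n
    proof -
      have "gauge x + 1 / real (Suc n) \<noteq> 0" using g by (intro less_imp_neq[symmetric] add_pos_nonneg) auto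
      then have "d n = (1 / (gauge x + 1 / real (Suc n))) *\<^sub>R (gauge x + 1 / real (Suc n)) *\<^sub>R d n" by simp
      then show ?thesis unfolding d(2)[of n, symmetric] .
    qed
    have conv: "(\<lambda>n. (1 / (gauge x + 1 / real (Suc n))) *\<^sub>R x) \<longlonglongrightarrow> (1 / gauge x) *\<^sub>R x"
      by (intro tendsto_scaleR tendsto_divide tendsto_const lim False)
    have mem: "(1 / (gauge x + 1 / real (Suc n))) *\<^sub>R x \<in> D" for n
      using d(1)[of n] unfolding deq .
    have "(1 / gauge x) *\<^sub>R x \<in> D" by (rule closed_sequentially[OF closed mem conv])
    moreover have "x = gauge x *\<^sub>R (1 / gauge x) *\<^sub>R x" using g by simp
    ultimately show ?thesis by blast
  qed
qed

lemma gauge_le_iff: "\<lbrakk>x \<in> carrier; 0 \<le> t\<rbrakk> \<Longrightarrow> gauge x \<le> t \<longleftrightarrow> x \<in> (\<lambda>d. t *\<^sub>R d) ` D"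
  using gauge_le[of t x] scale_mono[of "gauge x" t x] gauge_attained[of x] gauge_nonneg[of x] by auto

lemma gauge_add:
  assumes x: "x \<in> carrier" and y: "y \<in> carrier"
  shows "x + y \<in> carrier" and "gauge (x + y) \<le> gauge x + gauge y"
proof -
  have "x + y \<in> (\<lambda>d. (s + t) *\<^sub>R d) ` D"
    if st: "0 \<le> s" "0 \<le> t" and sx: "x \<in> (\<lambda>d. s *\<^sub>R d) ` D" and ty: "y \<in> (\<lambda>d. t *\<^sub>R d) ` D" for s t
  proof (cases "s + t = 0")
    case True
    then have "s = 0" "t = 0" using st by auto
    then have "x + y = 0" using sx ty by auto
    then show ?thesis using zero_multiple by (simp only:)
  next
    case False
    then have pos: "0 < s + t" using st by simp
    obtain d e where d: "d \<in> D" "x = s *\<^sub>R d" and e: "e \<in> D" "y = t *\<^sub>R e"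
      using sx ty by blast
    have "(s / (s + t)) *\<^sub>R d + (t / (s + t)) *\<^sub>R e \<in> D"
      using convex d(1) e(1) st pos
      by (intro convexD) (simp_all add: add_divide_distrib[symmetric])
    moreover have "x + y = (s + t) *\<^sub>R ((s / (s + t)) *\<^sub>R d + (t / (s + t)) *\<^sub>R e)"
      using False d(2) e(2) by (simp add: scaleR_right_distrib)
    ultimately show ?thesis by blast
  qed
  from gauge_le[OF _ this[OF gauge_nonneg[OF x] gauge_nonneg[OF y] gauge_attained[OF x] gauge_attained[OF y]]]
  show "x + y \<in> carrier" and "gauge (x + y) \<le> gauge x + gauge y"
    using gauge_nonneg[OF x] gauge_nonneg[OF y] by simp_all
qed

lemma gauge_scaleC_le:
  assumes x: "x \<in> carrier"
  shows "scaleC c x \<in> carrier" and "gauge (scaleC c x) \<le> cmod c * gauge x"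
proof -
  obtain d where d: "d \<in> D" "x = gauge x *\<^sub>R d" using gauge_attained[OF x] by blast
  have "scaleC c x \<in> (\<lambda>d. (cmod c * gauge x) *\<^sub>R d) ` D"
  proof (cases "c = 0")
    case True
    then have "scaleC c x = 0" using scaleC_of_real[of 0 x] by simp
    then show ?thesis using zero_multiple by (simp only:)
  next
    case False
    have "scaleC c x = scaleC c (scaleC (of_real (gauge x)) d)"
      unfolding scaleC_of_real by (rule arg_cong[OF d(2)])
    also have "\<dots> = scaleC (of_real (cmod c * gauge x)) (scaleC (c / cmod c) d)"
      using False by (simp add: scaleC_scaleC mult.commute)
    also have "\<dots> = (cmod c * gauge x) *\<^sub>R scaleC (c / cmod c) d" by (rule scaleC_of_real)
    finally show ?thesis
      using balanced[OF d(1), of "c / cmod c"] False by (intro image_eqI) (simp_all add: norm_divide)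
  qed
  then show "scaleC c x \<in> carrier" and "gauge (scaleC c x) \<le> cmod c * gauge x"
    using gauge_le[of "cmod c * gauge x" "scaleC c x"] gauge_nonneg[OF x] by simp_all
qed

lemma gauge_scaleC:
  assumes x: "x \<in> carrier"
  shows "gauge (scaleC c x) = cmod c * gauge x"
proof (rule antisym)
  show "gauge (scaleC c x) \<le> cmod c * gauge x" by (rule gauge_scaleC_le[OF x])
  show "cmod c * gauge x \<le> gauge (scaleC c x)"
  proof (cases "c = 0")
    case True
    then show ?thesis using gauge_nonneg gauge_scaleC_le(1)[OF x] by simp
  next
    case False
    have "gauge x = gauge (scaleC (1 / c) (scaleC c x))"
      using False by (simp add: scaleC_scaleC scaleC_one)
    also have "\<dots> \<le> cmod (1 / c) * gauge (scaleC c x)"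
      by (rule gauge_scaleC_le(2)[OF gauge_scaleC_le(1)[OF x]])
    finally show ?thesis using False by (simp add: norm_divide field_simps)
  qed
qed

lemma norm_le_gauge:
  obtains M where "0 < M" "\<And>x. x \<in> carrier \<Longrightarrow> norm x \<le> M * gauge x"
proof -
  obtain M where M: "0 < M" "\<And>d. d \<in> D \<Longrightarrow> norm d \<le> M" using bounded by (auto simp: bounded_pos)
  show thesis
  proof (rule that[OF M(1)])
    fix x assume x: "x \<in> carrier"
    obtain d where d: "d \<in> D" "x = gauge x *\<^sub>R d" using gauge_attained[OF x] by blast
    have "norm x = gauge x * norm d" using arg_cong[OF d(2), of norm] gauge_nonneg[OF x] by simp
    also have "\<dots> \<le> gauge x * M" using M(2)[OF d(1)] gauge_nonneg[OF x] by (rule mult_left_mono)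
    finally show "norm x \<le> M * gauge x" by (simp add: mult.commute)
  qed
qed

lemma zero_carrier: "0 \<in> carrier"
  by (rule conjunct1[OF gauge_le[OF order_refl zero_multiple]])

lemma minus_carrier: "x \<in> carrier \<Longrightarrow> - x \<in> carrier"
  using gauge_scaleC_le(1)[of x "-1"] scaleC_of_real[of "-1" x] by simp

lemma diff_carrier: "\<lbrakk>x \<in> carrier; y \<in> carrier\<rbrakk> \<Longrightarrow> x - y \<in> carrier"
  using gauge_add(1)[of x "- y"] minus_carrier[of y] by simp

text \<open>A sequence that is Cauchy for the gauge is Cauchy in \<open>E\<close>, and its limit
  there is also the limit for the gauge: late differences lie in a small multiple of
  \<open>D\<close>, which is closed, so one index may be sent to infinity.\<close>

lemma gauge_complete:
  fixes x :: "nat \<Rightarrow> 'e"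
  assumes x: "\<And>n. x n \<in> carrier"
    and cauchy: "\<And>\<epsilon>. 0 < \<epsilon> \<Longrightarrow> \<exists>N. \<forall>m\<ge>N. \<forall>n\<ge>N. gauge (x m - x n) < \<epsilon>"
  obtains l where "l \<in> carrier" "\<forall>\<epsilon>>0. \<exists>N. \<forall>n\<ge>N. gauge (x n - l) < \<epsilon>"
proof -
  obtain M where M: "0 < M" "\<And>x. x \<in> carrier \<Longrightarrow> norm x \<le> M * gauge x" by (rule norm_le_gauge) blast
  have "Cauchy x"
  proof (rule CauchyI)
    fix e :: real assume "0 < e"
    then obtain N where N: "\<forall>m\<ge>N. \<forall>n\<ge>N. gauge (x m - x n) < e / M"
      using cauchy[of "e / M"] M(1) by auto
    show "\<exists>N. \<forall>m\<ge>N. \<forall>n\<ge>N. norm (x m - x n) < e"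
    proof (intro exI allI impI)
      fix m n assume "m \<ge> N" "n \<ge> N"
      then have "gauge (x m - x n) < e / M" using N by blast
      then have "M * gauge (x m - x n) < e" using M(1) by (simp add: field_simps)
      then show "norm (x m - x n) < e" using M(2)[OF diff_carrier[OF x x]] le_less_trans by blast
    qed
  qed
  then obtain l where l: "x \<longlonglongrightarrow> l" using Cauchy_convergent convergent_def by blast
  have close: "\<exists>N. \<forall>n\<ge>N. x n - l \<in> carrier \<and> gauge (x n - l) \<le> e" if e: "0 < e" for e
  proof -
    obtain N where N: "\<forall>m\<ge>N. \<forall>n\<ge>N. gauge (x m - x n) < e" using cauchy[OF e] by blast
    have "x n - l \<in> (\<lambda>d. e *\<^sub>R d) ` D" if n: "n \<ge> N" for n
    proof (rule Lim_in_closed_set)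
      show "closed ((\<lambda>d. e *\<^sub>R d) ` D)" using closed by (rule closed_scaling)
      show "(\<lambda>m. x n - x m) \<longlonglongrightarrow> x n - l" by (intro tendsto_intros l)
      have "x n - x m \<in> (\<lambda>d. e *\<^sub>R d) ` D" if "m \<ge> N" for m
      proof -
        have "gauge (x n - x m) \<le> e" using N n that by (simp add: less_imp_le)
        then show ?thesis using gauge_le_iff[OF diff_carrier[OF x x]] e by simp
      qed
      then show "\<forall>\<^sub>F m in sequentially. x n - x m \<in> (\<lambda>d. e *\<^sub>R d) ` D"
        unfolding eventually_sequentially by blast
    qed simp
    then have "x n - l \<in> carrier \<and> gauge (x n - l) \<le> e" if "n \<ge> N" for n
      using gauge_le[OF less_imp_le[OF e]] that by blast
    then show ?thesis by blast
  qed
  obtain N where N: "\<forall>n\<ge>N. x n - l \<in> carrier \<and> gauge (x n - l) \<le> 1"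
    using close[OF zero_less_one] ..
  have "x N - l \<in> carrier" using N[rule_format, of N] by simp
  from diff_carrier[OF x[of N] this] have "l \<in> carrier" by simp
  moreover have "\<exists>N. \<forall>n\<ge>N. gauge (x n - l) < \<epsilon>" if \<epsilon>: "0 < \<epsilon>" for \<epsilon>
  proof -
    obtain N where N: "\<forall>n\<ge>N. x n - l \<in> carrier \<and> gauge (x n - l) \<le> \<epsilon> / 2"
      using close[OF half_gt_zero[OF \<epsilon>]] ..
    show ?thesis
    proof (intro exI allI impI)
      fix n assume "n \<ge> N"
      then show "gauge (x n - l) < \<epsilon>" using N[rule_format, of n] \<epsilon> by linarith
    qed
  qed
  ultimately show thesis using that by blast
qed

definition space :: "('e + 'u) cspace" where
  "space = \<lparr>points = Inl ` carrier, vadd = (\<lambda>a b. Inl (projl a + projl b)), vzero = Inl 0,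
     vscale = (\<lambda>c a. Inl (scaleC c (projl a))), vnorm = (\<lambda>a. gauge (projl a))\<rparr>"

lemma space_simps [simp]:
  "points space = Inl ` carrier"
  "vadd space (Inl x) (Inl y) = Inl (x + y)"
  "vzero space = Inl 0"
  "vscale space c (Inl x) = Inl (scaleC c x)"
  "vnorm space (Inl x) = gauge x"
  "vdiff space (Inl x) (Inl y) = Inl (x - y)"
  by (simp_all add: space_def vdiff_def scaleC_minus_one)

lemma vdist_space: "\<lbrakk>x \<in> carrier; y \<in> carrier\<rbrakk> \<Longrightarrow> vdist space (Inl x) (Inl y) = gauge (x - y)"
  by (simp add: vdist_def)

lemma gauge_eq_0:
  assumes "x \<in> carrier" "gauge x = 0" shows "x = 0"
  using gauge_attained[OF assms(1)] assms(2) by auto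

lemma gauge_0: "gauge 0 = 0"
  using gauge_scaleC[OF zero_carrier, of 0] scaleC_of_real[of 0 "0::'e"] by simp

lemma gauge_diff_eq_0:
  assumes "x \<in> carrier" "y \<in> carrier"
  shows "gauge (x - y) = 0 \<longleftrightarrow> x = y"
  using gauge_eq_0[OF diff_carrier[OF assms]] gauge_0 by auto

lemma gauge_minus: "x \<in> carrier \<Longrightarrow> gauge (- x) = gauge x"
  using gauge_scaleC[of x "-1"] scaleC_of_real[of "-1" x] by simp

lemma Metric_space_space: "Metric_space (points (space :: ('e + 'u) cspace)) (vdist space)"
proof
  fix x y :: "'e + 'u"
  show "0 \<le> vdist space x y" by (auto simp: vdist_def diff_carrier gauge_nonneg)
  show "vdist space x y = vdist space y x"
    by (auto simp: vdist_def) (metis diff_carrier gauge_minus minus_diff_eq)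
next
  fix x y :: "'e + 'u" assume "x \<in> points space" "y \<in> points space"
  then show "vdist space x y = 0 \<longleftrightarrow> x = y"
    by (auto simp: vdist_space gauge_diff_eq_0 gauge_0)
next
  fix x y z :: "'e + 'u" assume "x \<in> points space" "y \<in> points space" "z \<in> points space"
  then show "vdist space x z \<le> vdist space x y + vdist space y z"
    using gauge_add(2)[of "projl x - projl y" "projl y - projl z"] diff_carrier by (auto simp: vdist_space)
qed

lemma mball_space:
  assumes "v \<in> carrier"
  shows "Metric_space.mball (Inl ` carrier) (vdist (space :: ('e + 'u) cspace)) (Inl v) r
    = Inl ` {u \<in> carrier. gauge (v - u) < r}"
proof -
  interpret M: Metric_space "Inl ` carrier" "vdist (space :: ('e + 'u) cspace)"
    using Metric_space_space by simp
  show ?thesis unfolding M.mball_def using assms by (auto simp: vdist_space)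
qed

lemma complex_banach_space_space: "complex_banach_space (space :: ('e + 'u) cspace)"
proof
  show "Metric_space.mcomplete (points (space :: ('e + 'u) cspace)) (vdist space)"
  proof -
    interpret M: Metric_space "points (space :: ('e + 'u) cspace)" "vdist space" by (rule Metric_space_space)
    show ?thesis unfolding M.mcomplete_def
    proof (intro allI impI)
      fix \<sigma> :: "nat \<Rightarrow> 'e + 'u" assume C: "M.MCauchy \<sigma>"
      define x where "x n = projl (\<sigma> n)" for n
      have range: "\<sigma> n \<in> Inl ` carrier" for n using C unfolding M.MCauchy_def by auto
      have x: "x n \<in> carrier" and \<sigma>: "\<sigma> n = Inl (x n)" for n
        unfolding x_def using range[of n] by auto
      have cau: "\<exists>N. \<forall>m\<ge>N. \<forall>n\<ge>N. gauge (x m - x n) < \<epsilon>" if "0 < \<epsilon>" for \<epsilon>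
        using C that unfolding M.MCauchy_def \<sigma> by (simp add: vdist_space x)
      obtain l where l: "l \<in> carrier" "\<forall>\<epsilon>>0. \<exists>N. \<forall>n\<ge>N. gauge (x n - l) < \<epsilon>"
        by (rule gauge_complete[OF x cau])
      have "limitin M.mtopology \<sigma> (Inl l) sequentially"
        unfolding M.limit_metric_sequentially \<sigma> using l by (simp add: x vdist_space)
      then show "\<exists>x. limitin M.mtopology \<sigma> x sequentially" by blast
    qed
  qed
  show "\<exists>y\<in>points space. vadd space x y = vzero space" if "x \<in> points (space :: ('e + 'u) cspace)" for x
    using that by (auto simp: minus_carrier intro!: bexI[of _ "- projl x"])
qed (auto simp: zero_carrier gauge_add gauge_scaleC gauge_scaleC_le(1) gauge_nonneg gauge_eq_0
      scaleC_add_right scaleC_add_left scaleC_scaleC scaleC_one)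

end

section \<open>From density to the approximation property\<close>

text \<open>The weights are square roots of the tails of the series. Dividing a term by the root of
  its tail leaves at most twice the difference of consecutive roots, and these differences
  telescope.\<close>

lemma summable_slower_weights:
  fixes a :: "nat \<Rightarrow> real"
  assumes a: "summable a" "\<And>n. 0 \<le> a n"
  obtains w where "\<And>n. 0 < w n" "\<And>n. w n \<le> 1" "w \<longlonglongrightarrow> 0" "summable (\<lambda>n. a n / w n)"
proof -
  \<comment> \<open>The geometric terms keep all tails strictly positive, even if \<open>a\<close>
    vanishes from some index on.\<close>
  define b where "b n = a n + (1 / 2) ^ n" for n
  define R where "R n = suminf b - sum b {..<n}" for n
  \<comment> \<open>Normalised by the total, so that the weights are at most 1.\<close>
  define w where "w n = sqrt (R n) / sqrt (R 0)" for n
  have b: "summable b" "\<And>n. 0 < b n"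
    using a unfolding b_def by (auto intro!: summable_add summable_geometric add_nonneg_pos)
  have R_step: "b n = R n - R (Suc n)" for n by (simp add: R_def)
  have "0 \<le> R n" for n
    using sum_le_suminf[OF b(1), of "{..<n}"] b(2) by (simp add: R_def less_imp_le)
  then have R_pos: "0 < R n" for n using R_step[of n] b(2)[of n] by (smt (verit))
  have "decseq R" by (rule decseq_SucI) (use R_step b(2) in \<open>simp add: less_imp_le\<close>)
  then have R_le: "R n \<le> R 0" for n by (simp add: decseqD)
  have "(\<lambda>n. suminf b - sum b {..<n}) \<longlonglongrightarrow> suminf b - suminf b"
    by (intro tendsto_diff tendsto_const summable_LIMSEQ b(1))
  then have "R \<longlonglongrightarrow> 0" by (simp add: R_def[abs_def])
  then have sqrt_lim: "(\<lambda>n. sqrt (R n)) \<longlonglongrightarrow> 0" using tendsto_real_sqrt by fastforce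
  show thesis
  proof (rule that)
    show "0 < w n" for n using R_pos by (simp add: w_def)
    show "w n \<le> 1" for n using R_pos[of 0] R_le[of n] by (simp add: w_def)
    show "w \<longlonglongrightarrow> 0" using tendsto_divide[OF sqrt_lim tendsto_const, of "sqrt (R 0)"] R_pos[of 0]
      by (simp add: w_def[abs_def])
    have "summable (\<lambda>n. sqrt (R n) - sqrt (R (Suc n)))" by (rule telescope_summable'[OF sqrt_lim])
    then have tel: "summable (\<lambda>n. (2 * sqrt (R 0)) * (sqrt (R n) - sqrt (R (Suc n))))"
      by (rule summable_mult)
    show "summable (\<lambda>n. a n / w n)"
    proof (rule summable_comparison_test'[OF tel, of 0])
      fix n
      let ?s = "sqrt (R n)" and ?t = "sqrt (R (Suc n))"
      have st: "0 < ?s" "0 < ?t" "?t \<le> ?s"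
        using R_pos \<open>decseq R\<close> by (auto simp: decseq_SucD)
      have "a n \<le> R n - R (Suc n)"
        using R_step[of n] zero_le_power[of "1 / 2 :: real" n] unfolding b_def by linarith
      also have "\<dots> = (?s - ?t) * (?s + ?t)"
        using R_pos[of n] R_pos[of "Suc n"] by (simp add: algebra_simps)
      also have "\<dots> \<le> (?s - ?t) * (2 * ?s)" using st by (intro mult_left_mono) auto
      finally have "a n \<le> (?s - ?t) * 2 * ?s" by (simp only: mult.assoc)
      then have "a n / ?s \<le> (?s - ?t) * 2" using st(1) by (simp only: pos_divide_le_eq)
      then have "sqrt (R 0) * (a n / ?s) \<le> sqrt (R 0) * ((?s - ?t) * 2)"
        using R_pos[of 0] by (intro mult_left_mono) auto
      then show "norm (a n / w n) \<le> (2 * sqrt (R 0)) * (?s - ?t)"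
        using a(2)[of n] st R_pos[of 0] by (simp add: w_def mult_ac)
    qed
  qed
qed

text \<open>A \<open>p\<close>-summable sequence \<open>x\<close> is a null sequence \<open>w\<close> times a \<open>p\<close>-summable sequence \<open>y\<close>;
  the gauge is that of the closed hull of \<open>y\<close>, in which the hull of \<open>x\<close> is small at infinity.\<close>

locale p_hull_disc =
  fixes p :: real and x y :: "nat \<Rightarrow> 'e::complex_banach" and w :: "nat \<Rightarrow> real"
  assumes p: "1 \<le> p" and y: "p_summable p y" and w: "\<And>n. 0 < w n" "\<And>n. w n \<le> 1" "w \<longlonglongrightarrow> 0"
    and x_eq: "\<And>n. x n = w n *\<^sub>R y n"
begin

abbreviation "D \<equiv> closure (p_hull p y)"

lemma banach_disc_D: "banach_disc D"
proof
  show "closed D" by simp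
  show "0 \<in> D" using zero_in_p_hull[OF p, of y] by (rule subsetD[OF closure_subset])
  show "convex D" by (intro convex_closure p_hull_convex p y)
  show "bounded D" using p_hull_bounded[OF p y] by (intro bounded_closure) (auto simp: bounded_iff)
  fix v c assume v: "v \<in> D" and c: "cmod c \<le> 1"
  have "scaleC c ` D \<subseteq> closure (scaleC c ` p_hull p y)"
    by (intro continuous_image_closure_subset[of UNIV] linear_continuous_on bounded_linear_scaleC) auto
  also have "\<dots> \<subseteq> D" by (intro closure_mono) (use p_hull_balanced[OF p y _ c] in auto)
  finally show "scaleC c v \<in> D" using v by blast
qed

sublocale disc: banach_disc D by (rule banach_disc_D)

lemma x_summable: "p_summable p x"
  unfolding p_summable_def
proof (rule summable_comparison_test'[of "\<lambda>n. norm (y n) powr p" 0])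
  show "summable (\<lambda>n. norm (y n) powr p)" using y by (simp add: p_summable_def)
  show "norm (norm (x n) powr p) \<le> norm (y n) powr p" for n
    using w(1,2)[of n] p by (auto intro!: powr_mono2 mult_left_le_one_le simp: x_eq)
qed

text \<open>Parametrises the hull of \<open>x\<close> by the compact coefficient ball, in general
  not injectively.\<close>

definition \<Phi> :: "(nat \<Rightarrow> complex) \<Rightarrow> 'e" where
  "\<Phi> \<alpha> = (\<Sum>n. scaleC (\<alpha> n) (x n))"

lemma p_hull_eq: "p_hull p x = \<Phi> ` conj_ball p"
  by (auto simp: p_hull_def \<Phi>_def)

text \<open>The null sequence pays off here: in the tail, \<open>w n / \<eta>\<close> is at most 1
  and can be absorbed into the coefficient of \<open>y n\<close>. The estimate is uniform in
  \<alpha>.\<close>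

lemma tail_in_disc:
  assumes \<alpha>: "\<alpha> \<in> conj_ball p" and \<eta>: "0 < \<eta>" "\<And>n. N \<le> n \<Longrightarrow> w n \<le> \<eta>"
  shows "\<Phi> \<alpha> - (\<Sum>n<N. scaleC (\<alpha> n) (x n)) \<in> (\<lambda>d. \<eta> *\<^sub>R d) ` D"
proof -
  define \<beta> where "\<beta> n = (if n < N then 0 else \<alpha> n * of_real (w n / \<eta>))" for n
  define f where "f n = (if n < N then scaleC (\<alpha> n) (x n) else 0)" for n
  have \<beta>: "\<beta> \<in> conj_ball p"
  proof (rule conj_ball_solid[OF p \<alpha>])
    fix n
    show "cmod (\<beta> n) \<le> cmod (\<alpha> n)"
    proof (cases "n < N")
      case False
      have "0 \<le> w n / \<eta>" using w(1)[of n] \<eta>(1) by simp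
      then have "cmod (\<beta> n) = cmod (\<alpha> n) * (w n / \<eta>)"
        by (simp only: \<beta>_def False if_False norm_mult norm_of_real abs_of_nonneg)
      also have "\<dots> \<le> cmod (\<alpha> n)"
        using \<eta>(1) \<eta>(2)[of n] False by (intro mult_left_le) auto
      finally show ?thesis .
    qed (simp add: \<beta>_def)
  qed
  have split: "scaleC (\<alpha> n) (x n) = f n + \<eta> *\<^sub>R scaleC (\<beta> n) (y n)" for n
    using \<eta>(1)
    by (simp add: f_def \<beta>_def x_eq scaleC_zero_left scaleC_scaleR scaleC_of_real[symmetric] scaleC_scaleC mult_ac)
  have f: "f sums (\<Sum>n<N. scaleC (\<alpha> n) (x n))"
    using sums_If_finite[of "\<lambda>n. n < N" "\<lambda>n. scaleC (\<alpha> n) (x n)"] by (simp add: f_def[abs_def] lessThan_def)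
  note s = conj_ball_summable[OF p y \<beta>]
  have "(\<lambda>n. f n + \<eta> *\<^sub>R scaleC (\<beta> n) (y n)) sums
      ((\<Sum>n<N. scaleC (\<alpha> n) (x n)) + \<eta> *\<^sub>R (\<Sum>n. scaleC (\<beta> n) (y n)))"
    by (intro sums_add f sums_scaleR_right summable_sums s)
  then have "\<Phi> \<alpha> - (\<Sum>n<N. scaleC (\<alpha> n) (x n)) = \<eta> *\<^sub>R (\<Sum>n. scaleC (\<beta> n) (y n))"
    unfolding \<Phi>_def split by (simp add: sums_iff)
  moreover have "(\<Sum>n. scaleC (\<beta> n) (y n)) \<in> p_hull p y" using \<beta> by (auto simp: p_hull_def)
  then have "(\<Sum>n. scaleC (\<beta> n) (y n)) \<in> D" by (rule subsetD[OF closure_subset])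
  ultimately show ?thesis by blast
qed

lemma \<Phi>_in_D: "\<alpha> \<in> conj_ball p \<Longrightarrow> \<Phi> \<alpha> \<in> D"
  using tail_in_disc[of \<alpha> 1 0] w(2) by simp

lemma D_carrier: "v \<in> D \<Longrightarrow> v \<in> disc.carrier \<and> disc.gauge v \<le> 1"
  using disc.gauge_le[of 1 v] by simp

text \<open>Partial sums depend continuously on finitely many coordinates, and after a linear map
  bounded for the gauge they still converge uniformly, by the tail estimate. It is applied both to a
  functional on the disc space and to its inclusion into \<open>E\<close>.\<close>

lemma \<Phi>_continuous:
  fixes \<psi> :: "'e \<Rightarrow> 'b::complex_banach"
  assumes add: "\<And>u v. u \<in> disc.carrier \<Longrightarrow> v \<in> disc.carrier \<Longrightarrow> \<psi> (u + v) = \<psi> u + \<psi> v"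
    and scale: "\<And>c v. v \<in> disc.carrier \<Longrightarrow> \<psi> (scaleC c v) = scaleC c (\<psi> v)"
    and bound: "\<And>v. v \<in> disc.carrier \<Longrightarrow> norm (\<psi> v) \<le> M * disc.gauge v"
  shows "continuous_on (conj_ball p) (\<lambda>\<alpha>. \<psi> (\<Phi> \<alpha>))"
proof -
  have yD: "y n \<in> disc.carrier" for n
  proof -
    \<comment> \<open>The coordinate sequence at \<open>n\<close>, obtained by shifting the one at
      0; it exhibits \<open>y n\<close> as a point of its own hull.\<close>
    define e :: "nat \<Rightarrow> complex" where "e m = (if m = n then 1 else 0)" for m
    have "e \<in> conj_ball p"
    proof (rule conj_ball_pad[OF p, of "\<lambda>m. if m = 0 then 1 else 0" "\<lambda>m. n + m"])
      show "(\<lambda>m. if m = 0 then 1 else 0) \<in> conj_ball p"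
      proof (cases "p = 1")
        case False
        then have p: "1 < p" using p by simp
        have "(\<Sum>m<N. cmod (if m = 0 then 1 else 0) powr (p / (p - 1))) \<le> 1" for N :: nat
        proof -
          have "(\<Sum>m<N. cmod (if m = 0 then 1 else 0) powr (p / (p - 1))) = (\<Sum>m<N. if m = 0 then 1 else 0)"
            by (rule sum.cong) auto
          then show ?thesis by simp
        qed
        then show ?thesis unfolding conj_ball_iff[OF p] by blast
      qed (simp add: conj_ball_1)
      show "e m = 0" if "m \<notin> range (\<lambda>m. n + m)" for m
        using that by (auto simp: e_def image_iff)
    qed (auto simp: e_def strict_mono_def)
    moreover have "(\<Sum>m. scaleC (e m) (y m)) = (\<Sum>m\<in>{n}. scaleC (e m) (y m))"
      by (rule suminf_finite) (auto simp: e_def scaleC_zero_left)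
    then have "(\<Sum>m. scaleC (e m) (y m)) = y n" by (simp add: e_def scaleC_one)
    ultimately have "y n \<in> p_hull p y"
      unfolding p_hull_def by (intro CollectI exI[of _ e] conjI) simp_all
    then show ?thesis using D_carrier subsetD[OF closure_subset] by blast
  qed
  have xD: "x n \<in> disc.carrier" for n
    using disc.gauge_scaleC_le(1)[OF yD, of "of_real (w n)" n] by (simp add: x_eq scaleC_of_real)
  have zero: "\<psi> 0 = 0" using bound[OF disc.zero_carrier] by (simp add: disc.gauge_0)
  have partial: "(\<Sum>n<N. scaleC (\<alpha> n) (x n)) \<in> disc.carrier
      \<and> \<psi> (\<Sum>n<N. scaleC (\<alpha> n) (x n)) = (\<Sum>n<N. scaleC (\<alpha> n) (\<psi> (x n)))" for \<alpha> N
    by (induction N)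
      (simp_all add: zero disc.zero_carrier add scale xD disc.gauge_add(1) disc.gauge_scaleC_le(1))
  have M: "0 \<le> M * disc.gauge v" if "v \<in> disc.carrier" for v
    using bound[OF that] norm_ge_zero order_trans by blast
  have "uniform_limit (conj_ball p) (\<lambda>N \<alpha>. \<psi> (\<Sum>n<N. scaleC (\<alpha> n) (x n))) (\<lambda>\<alpha>. \<psi> (\<Phi> \<alpha>)) sequentially"
  proof (rule uniform_limitI)
    fix \<epsilon> :: real assume \<epsilon>: "0 < \<epsilon>"
    define \<eta> where "\<eta> = \<epsilon> / (\<bar>M\<bar> + 1)"
    have \<eta>: "0 < \<eta>" "\<bar>M\<bar> * \<eta> < \<epsilon>"
      using \<epsilon> by (simp_all add: \<eta>_def field_simps)
    obtain N0 where N0: "\<And>n. N0 \<le> n \<Longrightarrow> w n \<le> \<eta>"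
      using order_tendstoD(2)[OF w(3) \<eta>(1)] unfolding eventually_sequentially by (meson less_imp_le)
    have "dist (\<psi> (\<Sum>n<N. scaleC (\<alpha> n) (x n))) (\<psi> (\<Phi> \<alpha>)) < \<epsilon>"
      if N: "N0 \<le> N" and \<alpha>: "\<alpha> \<in> conj_ball p" for N \<alpha>
    proof -
      let ?S = "\<Sum>n<N. scaleC (\<alpha> n) (x n)"
      have "\<Phi> \<alpha> - ?S \<in> (\<lambda>d. \<eta> *\<^sub>R d) ` D"
        by (rule tail_in_disc[OF \<alpha> \<eta>(1)]) (use N0 N in auto)
      then have tail: "\<Phi> \<alpha> - ?S \<in> disc.carrier" "disc.gauge (\<Phi> \<alpha> - ?S) \<le> \<eta>"
        using disc.gauge_le[of \<eta>] \<eta>(1) by auto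
      have "\<psi> (\<Phi> \<alpha>) = \<psi> ?S + \<psi> (\<Phi> \<alpha> - ?S)"
        using add[of ?S "\<Phi> \<alpha> - ?S", OF conjunct1[OF partial] tail(1)] by simp
      then have "dist (\<psi> ?S) (\<psi> (\<Phi> \<alpha>)) = norm (\<psi> (\<Phi> \<alpha> - ?S))" by (simp add: dist_norm)
      also have "\<dots> \<le> M * disc.gauge (\<Phi> \<alpha> - ?S)" by (rule bound[OF tail(1)])
      also have "\<dots> \<le> \<bar>M\<bar> * \<eta>"
        using tail(2) disc.gauge_nonneg[OF tail(1)] by (intro mult_mono) auto
      also have "\<dots> < \<epsilon>" by (rule \<eta>(2))
      finally show ?thesis .
    qed
    then show "\<forall>\<^sub>F N in sequentially. \<forall>\<alpha>\<in>conj_ball p. dist (\<psi> (\<Sum>n<N. scaleC (\<alpha> n) (x n))) (\<psi> (\<Phi> \<alpha>)) < \<epsilon>"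
      unfolding eventually_sequentially by blast
  qed
  moreover have "continuous_on (conj_ball p) (\<lambda>\<alpha>. \<psi> (\<Sum>n<N. scaleC (\<alpha> n) (x n)))" for N
  proof -
    have "continuous_on (conj_ball p) (\<lambda>\<alpha>. scaleC (\<alpha> n) (\<psi> (x n)))" for n
      by (rule bounded_linear.continuous_on[OF bounded_linear_scaleC_left])
        (rule continuous_on_subset[OF continuous_on_product_coordinates], simp)
    then show ?thesis unfolding conjunct2[OF partial] by (intro continuous_on_sum)
  qed
  ultimately show ?thesis
    by (intro uniform_limit_theorem[where F = sequentially]) auto
qed

text \<open>On the hull of \<open>x\<close>, \<psi> is dominated by \<epsilon> plus a multiple of
  the norm of \<open>E\<close>. By Mazur-Orlicz some real functional continuous on \<open>E\<close>
  then lies below \<open>\<epsilon> + Re (\<psi> v)\<close> there.\<close>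

lemma functional_approximation:
  fixes \<psi> :: "'e \<Rightarrow> complex"
  assumes add: "\<And>u v. u \<in> disc.carrier \<Longrightarrow> v \<in> disc.carrier \<Longrightarrow> \<psi> (u + v) = \<psi> u + \<psi> v"
    and scale: "\<And>c v. v \<in> disc.carrier \<Longrightarrow> \<psi> (scaleC c v) = c * \<psi> v"
    and bound: "\<And>v. v \<in> disc.carrier \<Longrightarrow> cmod (\<psi> v) \<le> M * disc.gauge v" and M: "0 \<le> M"
    and \<epsilon>: "0 < \<epsilon>"
  obtains h :: "'e \<Rightarrow> complex" where "bounded_clinear h" "\<And>v. v \<in> p_hull p x \<Longrightarrow> cmod (h v - \<psi> v) \<le> \<epsilon>"
proof -
  have hull: "v \<in> D" if "v \<in> p_hull p x" for v using that \<Phi>_in_D by (auto simp: p_hull_eq)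
  have cont_\<psi>: "continuous_on (conj_ball p) (\<lambda>\<alpha>. \<psi> (\<Phi> \<alpha>))"
    by (rule \<Phi>_continuous[OF add _ bound]) (simp_all add: scale scaleC_complex_def)
  obtain C0 where C0: "\<And>v. v \<in> disc.carrier \<Longrightarrow> norm v \<le> C0 * disc.gauge v"
    using disc.norm_le_gauge by blast
  have cont_\<Phi>: "continuous_on (conj_ball p) (\<lambda>\<alpha>. \<Phi> \<alpha>)"
    by (rule \<Phi>_continuous[of "\<lambda>v. v", OF _ _ C0]) simp_all
  \<comment> \<open>The bad set, where \<epsilon> alone does not dominate. It is compact, and
    \<open>\<Phi>\<close> does not vanish on it since \<open>\<psi> 0 = 0\<close>; the norm
    therefore has a positive minimum on it. As \<psi> is at most \<open>M\<close> on
    \<open>D\<close>, \<open>M\<close> divided by this minimum is a valid constant.\<close>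
  define S where "S = {\<alpha> \<in> conj_ball p. \<epsilon> \<le> cmod (\<psi> (\<Phi> \<alpha>))}"
  have "closed S"
    unfolding S_def
    by (intro continuous_on_closed_Collect_le continuous_on_const continuous_on_norm cont_\<psi>
        compact_imp_closed conj_ball_compact p)
  moreover have "S \<subseteq> conj_ball p" by (auto simp: S_def)
  ultimately have "compact S" using compact_Int_closed[OF conj_ball_compact[OF p]] by (metis inf.absorb2)
  obtain C where C: "0 \<le> C" "\<And>\<alpha>. \<alpha> \<in> conj_ball p \<Longrightarrow> cmod (\<psi> (\<Phi> \<alpha>)) \<le> \<epsilon> + C * norm (\<Phi> \<alpha>)"
  proof (cases "S = {}")
    case True
    then have "cmod (\<psi> (\<Phi> \<alpha>)) \<le> \<epsilon> + 0 * norm (\<Phi> \<alpha>)" if "\<alpha> \<in> conj_ball p" for \<alpha>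
      using that by (force simp: S_def)
    then show ?thesis using that[of 0] by blast
  next
    case False
    have "continuous_on S (\<lambda>\<alpha>. norm (\<Phi> \<alpha>))"
      using cont_\<Phi> \<open>S \<subseteq> conj_ball p\<close> by (intro continuous_on_norm) (rule continuous_on_subset)
    from continuous_attains_inf[OF \<open>compact S\<close> False this]
    obtain \<alpha>0 where \<alpha>0: "\<alpha>0 \<in> S" "\<And>\<alpha>. \<alpha> \<in> S \<Longrightarrow> norm (\<Phi> \<alpha>0) \<le> norm (\<Phi> \<alpha>)" by blast
    have "\<psi> 0 = 0" using bound[OF disc.zero_carrier] by (simp add: disc.gauge_0)
    then have "\<Phi> \<alpha>0 \<noteq> 0" using \<alpha>0(1) \<epsilon> by (auto simp: S_def)
    then have pos: "0 < norm (\<Phi> \<alpha>0)" by simp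
    show ?thesis
    proof (rule that[of "M / norm (\<Phi> \<alpha>0)"])
      show "0 \<le> M / norm (\<Phi> \<alpha>0)" using M by simp
      fix \<alpha> assume \<alpha>: "\<alpha> \<in> conj_ball p"
      show "cmod (\<psi> (\<Phi> \<alpha>)) \<le> \<epsilon> + M / norm (\<Phi> \<alpha>0) * norm (\<Phi> \<alpha>)"
      proof (cases "\<alpha> \<in> S")
        case True
        have g: "\<Phi> \<alpha> \<in> disc.carrier" "disc.gauge (\<Phi> \<alpha>) \<le> 1" using D_carrier[OF \<Phi>_in_D[OF \<alpha>]] by auto
        have "cmod (\<psi> (\<Phi> \<alpha>)) \<le> M * disc.gauge (\<Phi> \<alpha>)" by (rule bound[OF g(1)])
        also have "\<dots> \<le> M * 1" using g(2) M by (rule mult_left_mono)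
        also have "\<dots> = M / norm (\<Phi> \<alpha>0) * norm (\<Phi> \<alpha>0)" using pos by simp
        also have "\<dots> \<le> M / norm (\<Phi> \<alpha>0) * norm (\<Phi> \<alpha>)"
          using \<alpha>0(2)[OF True] M by (intro mult_left_mono) auto
        finally show ?thesis using \<epsilon> by simp
      next
        case False
        then have "cmod (\<psi> (\<Phi> \<alpha>)) \<le> \<epsilon>" using \<alpha> by (simp add: S_def)
        moreover have "0 \<le> M / norm (\<Phi> \<alpha>0) * norm (\<Phi> \<alpha>)" using M by simp
        ultimately show ?thesis by linarith
      qed
    qed
  qed
  have scaleR: "\<psi> (r *\<^sub>R v) = of_real r * \<psi> v" if "v \<in> disc.carrier" for r v
    using scale[OF that, of "of_real r"] by (simp add: scaleC_of_real)
  have scaleR_carrier: "r *\<^sub>R v \<in> disc.carrier" if "v \<in> disc.carrier" for r v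
    using disc.gauge_scaleC_le(1)[OF that, of "of_real r"] by (simp add: scaleC_of_real)
  have convex: "convex (p_hull p x)" by (rule p_hull_convex[OF p x_summable])
  \<comment> \<open>This function is real affine on the hull. The domination by
    \<open>\<epsilon> + C * norm v\<close> is precisely the positivity required by
    Mazur-Orlicz.\<close>
  have "convex_on (p_hull p x) (\<lambda>v. \<epsilon> + Re (\<psi> v))"
    unfolding convex_on_def
  proof (intro conjI ballI allI impI convex)
    fix u v and s t :: real
    assume uv: "u \<in> p_hull p x" "v \<in> p_hull p x" and st: "0 \<le> s" "0 \<le> t" "s + t = 1"
    have "u \<in> disc.carrier" "v \<in> disc.carrier" using D_carrier hull uv by blast+
    then have "Re (\<psi> (s *\<^sub>R u + t *\<^sub>R v)) = s * Re (\<psi> u) + t * Re (\<psi> v)"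
      by (simp add: add scaleR scaleR_carrier)
    moreover have "s * \<epsilon> + t * \<epsilon> = \<epsilon>" using st(3) by (metis distrib_right mult_1)
    ultimately show "\<epsilon> + Re (\<psi> (s *\<^sub>R u + t *\<^sub>R v)) \<le> s * (\<epsilon> + Re (\<psi> u)) + t * (\<epsilon> + Re (\<psi> v))"
      by (simp add: distrib_left)
  qed
  moreover have "0 \<le> \<epsilon> + Re (\<psi> v) + C * norm v" if "v \<in> p_hull p x" for v
  proof -
    have "cmod (\<psi> v) \<le> \<epsilon> + C * norm v" using that C(2) by (auto simp: p_hull_eq)
    then show ?thesis using abs_Re_le_cmod[of "\<psi> v"] by linarith
  qed
  ultimately obtain u where u: "linear u" "\<And>v. u v \<le> C * norm v"
      "\<And>v. v \<in> p_hull p x \<Longrightarrow> u v \<le> \<epsilon> + Re (\<psi> v)"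
    using mazur_orlicz[OF convex _ C(1)] by blast
  define h where "h = (\<lambda>v. Complex (u v) (- u (scaleC \<i> v)))"
  have h: "bounded_clinear h" unfolding h_def by (rule bounded_clinear_of_real_part(1)[OF u(1,2)])
  show thesis
  proof (rule that[OF h])
    fix v assume v: "v \<in> p_hull p x"
    \<comment> \<open>Rotating \<open>v\<close> inside the balanced hull turns the modulus of the
      difference into its real part, where the one-sided estimate for \<open>u\<close>
      applies.\<close>
    obtain c where c: "cmod c = 1" "c * (h v - \<psi> v) = of_real (cmod (h v - \<psi> v))" by (rule cmod_rotate)
    have cv: "scaleC c v \<in> p_hull p x" using p_hull_balanced[OF p x_summable v] c(1) by simp
    have vc: "v \<in> disc.carrier" using D_carrier[OF hull[OF v]] by simp
    have "cmod (h v - \<psi> v) = Re (c * (h v - \<psi> v))" unfolding c(2) by simp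
    also have "\<dots> = Re (h (scaleC c v) - \<psi> (scaleC c v))"
      by (simp add: scale[OF vc] bounded_clinear_scale[OF h] scaleC_complex_def right_diff_distrib)
    also have "\<dots> = u (scaleC c v) - Re (\<psi> (scaleC c v))" by (simp add: h_def)
    also have "\<dots> \<le> \<epsilon>" using u(3)[OF cv] by simp
    finally show "cmod (h v - \<psi> v) \<le> \<epsilon>" .
  qed
qed

section \<open>The inclusion of the disc space as a p-compact entire function\<close>

lemma inclusion_entire: "projl \<in> entire_functions (disc.space :: ('e + 'u) cspace)"
  unfolding entire_functions_def
proof (intro CollectI ballI)
  let ?F = "disc.space :: ('e + 'u) cspace"
  interpret F: complex_banach_space ?F by (rule disc.complex_banach_space_space)
  interpret M: Metric_space "points ?F" "vdist ?F" by (rule F.Metric_space_vdist)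
  obtain C where C: "0 < C" "\<And>v. v \<in> disc.carrier \<Longrightarrow> norm v \<le> C * disc.gauge v"
    by (rule disc.norm_le_gauge) blast
  have "continuous_map M.mtopology (Met_TC.mtopology :: 'e topology) projl"
    unfolding continuous_map_def
  proof (intro conjI)
    show "projl \<in> topspace M.mtopology \<rightarrow> topspace (Met_TC.mtopology :: 'e topology)" by simp
    show "\<forall>U. openin (Met_TC.mtopology :: 'e topology) U \<longrightarrow> openin M.mtopology {x \<in> topspace M.mtopology. projl x \<in> U}"
    proof (intro allI impI)
      fix U :: "'e set" assume "openin Met_TC.mtopology U"
      then have U: "open U" by simp
      show "openin M.mtopology {x \<in> topspace M.mtopology. projl x \<in> U}"
        unfolding M.openin_mtopology
      proof (intro conjI allI impI)
        fix a assume "a \<in> {x \<in> topspace M.mtopology. projl x \<in> U}"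
        then have "a \<in> Inl ` disc.carrier" "projl a \<in> U" unfolding M.topspace_mtopology by simp_all
        then obtain v where v: "a = Inl v" "v \<in> disc.carrier" "v \<in> U" by auto
        obtain e where e: "0 < e" "ball v e \<subseteq> U" using U v(3) open_contains_ball by blast
        have "M.mball a (e / C) \<subseteq> {x \<in> topspace M.mtopology. projl x \<in> U}"
        proof
          fix b assume "b \<in> M.mball a (e / C)"
          then obtain u where u: "b = Inl u" "u \<in> disc.carrier" "disc.gauge (v - u) < e / C"
            using v by (auto simp: disc.mball_space)
          have "norm (v - u) \<le> C * disc.gauge (v - u)" by (rule C(2)[OF disc.diff_carrier[OF v(2) u(2)]])
          also have "\<dots> < e" using u(3) C(1) by (simp add: field_simps)
          finally have "u \<in> U" using e(2) by (auto simp: dist_norm)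
          then show "b \<in> {x \<in> topspace M.mtopology. projl x \<in> U}"
            unfolding M.topspace_mtopology using u by simp
        qed
        then show "\<exists>r>0. M.mball a r \<subseteq> {x \<in> topspace M.mtopology. projl x \<in> U}"
          using e(1) C(1) by (intro exI[of _ "e / C"]) simp
      next
        show "{x \<in> topspace M.mtopology. projl x \<in> U} \<subseteq> points ?F"
          unfolding M.topspace_mtopology by blast
      qed
    qed
  qed
  then have cont: "continuous_map M.mtopology euclidean (projl :: 'e + 'u \<Rightarrow> 'e)" by simp
  fix a assume "a \<in> points ?F"
  then obtain v where v: "a = Inl v" "v \<in> disc.carrier" by auto
  \<comment> \<open>Expansion of a linear map about \<open>v\<close>: the value \<open>v\<close>,
    then the map itself. From two terms on the partial sums are exact, so any radius serves.\<close>
  define P :: "nat \<Rightarrow> 'e + 'u \<Rightarrow> 'e" where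
    "P m = (if m = 0 then (\<lambda>_. v) else if m = 1 then projl else (\<lambda>_. 0))" for m
  have P: "homogeneous_polynomial ?F m (P m)" for m
  proof -
    consider "m = 0" | "m = 1" | "1 < m" by linarith
    then show ?thesis
    proof cases
      case 1
      then show ?thesis
        by (auto simp: homogeneous_polynomial_def P_def multilinear_map_def intro!: exI[of _ "\<lambda>_. v"])
    next
      case 2
      have "multilinear_map ?F 1 (\<lambda>xs. projl (xs ! 0))"
        by (auto simp: multilinear_map_def length_Suc_conv)
      then show ?thesis using cont 2
        unfolding homogeneous_polynomial_def P_def
        by (intro conjI exI[of _ "\<lambda>xs. projl (xs ! 0)"]) simp_all
    next
      case 3
      have "scaleC c 0 = (0 :: 'e)" for c
        by (rule linear_0[OF bounded_linear.linear[OF bounded_linear_scaleC]])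
      then have "multilinear_map ?F m (\<lambda>_. 0 :: 'e)" by (simp add: multilinear_map_def)
      then show ?thesis using 3
        unfolding homogeneous_polynomial_def P_def
        by (intro conjI exI[of _ "\<lambda>_. 0"]) simp_all
    qed
  qed
  have sum: "(\<Sum>m<n. P m (vdiff ?F b a)) = projl b" if "2 \<le> n" and b: "b \<in> points ?F" for n b
  proof -
    obtain u where u: "b = Inl u" using b by auto
    have "(\<Sum>m<n. P m (vdiff ?F b a)) = (\<Sum>m<2. P m (vdiff ?F b a))"
      by (rule sum.mono_neutral_right) (use that in \<open>auto simp: P_def\<close>)
    also have "\<dots> = projl b" by (simp add: numeral_2_eq_2 P_def u v(1))
    finally show ?thesis .
  qed
  have "uniform_limit {b \<in> points ?F. vnorm ?F (vdiff ?F b a) < 1} (\<lambda>n b. \<Sum>m<n. P m (vdiff ?F b a)) projl sequentially"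
  proof (rule uniform_limitI)
    fix e :: real assume "0 < e"
    then show "\<forall>\<^sub>F n in sequentially. \<forall>b\<in>{b \<in> points ?F. vnorm ?F (vdiff ?F b a) < 1}.
        dist (\<Sum>m<n. P m (vdiff ?F b a)) (projl b) < e"
      unfolding eventually_sequentially by (intro exI[of _ 2]) (simp add: sum)
  qed
  then show "\<exists>r>0. \<exists>P. (\<forall>m. homogeneous_polynomial ?F m (P m)) \<and>
      uniform_limit {b \<in> points ?F. vnorm ?F (vdiff ?F b a) < r} (\<lambda>n b. \<Sum>m<n. P m (vdiff ?F b a)) projl sequentially"
    using P by (intro exI[of _ 1] conjI exI[of _ P]) auto
qed

text \<open>A unit ball for the gauge lies in a multiple of \<open>D\<close>, and \<open>D\<close>
  is relatively p-compact by construction.\<close>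

lemma inclusion_p_compact:
  "projl \<in> p_compact_entire_functions p (disc.space :: ('e + 'u) cspace)"
  unfolding p_compact_entire_functions_def
proof (intro CollectI conjI ballI inclusion_entire)
  let ?F = "disc.space :: ('e + 'u) cspace"
  interpret F: complex_banach_space ?F by (rule disc.complex_banach_space_space)
  interpret M: Metric_space "points ?F" "vdist ?F" by (rule F.Metric_space_vdist)
  fix a assume "a \<in> points ?F"
  then obtain v where v: "a = Inl v" "v \<in> disc.carrier" by auto
  define t where "t = disc.gauge v + 1"
  have "projl ` M.mball a 1 \<subseteq> (\<lambda>d. t *\<^sub>R d) ` D"
  proof
    fix u assume "u \<in> projl ` M.mball a 1"
    then have u: "u \<in> disc.carrier" "disc.gauge (v - u) < 1"
      using v by (auto simp: disc.mball_space)
    have "disc.gauge (u - v) < 1" using u disc.gauge_minus[OF disc.diff_carrier[OF v(2) u(1)]] by simp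
    then have "disc.gauge u \<le> t"
      using disc.gauge_add(2)[OF v(2) disc.diff_carrier[OF u(1) v(2)]] by (simp add: t_def)
    then show "u \<in> (\<lambda>d. t *\<^sub>R d) ` D"
      using disc.gauge_le_iff[OF u(1), of t] disc.gauge_nonneg[OF v(2)] by (simp add: t_def)
  qed
  moreover have "relatively_p_compact p D" using y by (auto simp: relatively_p_compact_iff)
  then have "relatively_p_compact p (scaleC (of_real t) ` D)"
    using bounded_clinear_scaleC[of "of_real t"] p
    by (intro relatively_p_compact_image) (auto simp: bounded_clinear_def)
  then have "relatively_p_compact p ((\<lambda>d. t *\<^sub>R d) ` D)" by (simp add: scaleC_of_real)
  ultimately have "relatively_p_compact p (projl ` M.mball a 1)" by (rule relatively_p_compact_mono[rotated])
  moreover have "a \<in> M.mball a 1" using \<open>a \<in> points ?F\<close> unfolding M.centre_in_mball_iff by simp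
  ultimately show "\<exists>V. openin M.mtopology V \<and> a \<in> V \<and> relatively_p_compact p (projl ` V)"
    using M.openin_mball by blast
qed

text \<open>Density provides \<open>g\<close> close to the inclusion in the derivative seminorm.
  Half of \<epsilon> pays for passing from the inclusion to the derivative of \<open>g\<close> at 0,
  the other half for replacing the functionals on the disc space by functionals on
  \<open>E\<close>.\<close>

lemma approximation_on_hull:
  assumes dense: "subtopology (nachbin_topology (disc.space :: ('e + 'u) cspace))
      (p_compact_entire_functions p disc.space) closure_of (entire_tensor disc.space :: ('e + 'u \<Rightarrow> 'e) set)
      = p_compact_entire_functions p disc.space" and \<epsilon>: "0 < \<epsilon>"
  obtains T where "finite_rank_operator T" "\<And>v. v \<in> closure (p_hull p x) \<Longrightarrow> norm (T v - v) \<le> \<epsilon>"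
proof -
  let ?F = "disc.space :: ('e + 'u) cspace"
  interpret F: complex_banach_space ?F by (rule disc.complex_banach_space_space)
  let ?J = "projl :: 'e + 'u \<Rightarrow> 'e"
  let ?U = "{g \<in> entire_functions ?F. F.derivative_seminorm (\<lambda>x. g x - ?J x) < \<epsilon> / 2}"
  have "openin (nachbin_topology ?F) ?U"
    unfolding nachbin_topology_def
    by (rule topology_generated_by_Basis, rule CollectI, rule exI[of _ F.derivative_seminorm],
        rule exI[of _ ?J], rule exI[of _ "\<epsilon> / 2"])
      (use F.ported_derivative_seminorm inclusion_entire \<epsilon> in simp)
  then have open_U: "openin (subtopology (nachbin_topology ?F) (p_compact_entire_functions p ?F))
      (?U \<inter> p_compact_entire_functions p ?F)"
    by (rule openin_subtopology_Int)
  have zero_seminorm: "F.derivative_seminorm (\<lambda>x. ?J x - ?J x) = 0"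
  proof -
    have "F.derivative_seminorm (\<lambda>x. scaleC 0 (?J x)) = cmod 0 * F.derivative_seminorm ?J"
      by (rule conjunct2[OF F.entire_seminorm_derivative_seminorm[unfolded entire_seminorm_def],
            rule_format, OF inclusion_entire])
    then show ?thesis by (simp add: scaleC_zero_left)
  qed
  have J: "?J \<in> ?U \<inter> p_compact_entire_functions p ?F"
    using inclusion_entire inclusion_p_compact zero_seminorm \<epsilon> by simp
  have cl: "?J \<in> subtopology (nachbin_topology ?F) (p_compact_entire_functions p ?F) closure_of entire_tensor ?F"
    unfolding dense by (rule inclusion_p_compact)
  have "\<exists>g. g \<in> entire_tensor ?F \<and> g \<in> ?U \<inter> p_compact_entire_functions p ?F"
    by (rule conjunct2[OF cl[unfolded in_closure_of], rule_format, OF conjI[OF J open_U]])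
  then obtain g where g: "g \<in> entire_tensor ?F" "g \<in> entire_functions ?F"
      "F.derivative_seminorm (\<lambda>x. g x - ?J x) < \<epsilon> / 2"
    by (elim exE conjE) simp
  obtain n :: nat and \<phi> e where \<phi>: "\<forall>j<n. \<phi> j \<in> entire_functions ?F"
    "\<forall>x\<in>points ?F. g x = (\<Sum>j<n. scaleC (\<phi> j x :: complex) (e j))"
    using g(1)[unfolded entire_tensor_def] by (elim CollectE exE conjE)
  \<comment> \<open>Functional and bound are packed into a pair, so that a single choice over the
    finitely many \<open>j\<close> selects both.\<close>
  define Q where "Q j z \<longleftrightarrow> 0 \<le> snd z \<and>
      (\<forall>x\<in>points ?F. deriv (\<lambda>\<zeta>. \<phi> j (vscale ?F \<zeta> x)) 0 = fst z x) \<and>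
      (\<forall>x\<in>points ?F. \<forall>y\<in>points ?F. fst z (vadd ?F x y) = fst z x + fst z y) \<and>
      (\<forall>x\<in>points ?F. \<forall>c. fst z (vscale ?F c x) = c * fst z x) \<and>
      (\<forall>x\<in>points ?F. cmod (fst z x) \<le> snd z * vnorm ?F x)"
    for j and z :: "('e + 'u \<Rightarrow> complex) \<times> real"
  have "\<forall>j\<in>{..<n}. \<exists>z. Q j z"
  proof
    fix j assume "j \<in> {..<n}"
    then have j: "j < n" by simp
    show "\<exists>z. Q j z"
    proof (rule F.entire_derivative_at_vzero[OF \<phi>(1)[rule_format, OF j]])
      fix \<psi> M
      assume "0 \<le> M" "\<And>x. x \<in> points ?F \<Longrightarrow> deriv (\<lambda>\<zeta>. \<phi> j (vscale ?F \<zeta> x)) 0 = \<psi> x"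
        "\<And>x y. x \<in> points ?F \<Longrightarrow> y \<in> points ?F \<Longrightarrow> \<psi> (vadd ?F x y) = \<psi> x + \<psi> y"
        "\<And>x c. x \<in> points ?F \<Longrightarrow> \<psi> (vscale ?F c x) = c * \<psi> x"
        "\<And>x. x \<in> points ?F \<Longrightarrow> cmod (\<psi> x) \<le> M * vnorm ?F x"
      then have "Q j (\<psi>, M)" unfolding Q_def fst_conv snd_conv by (intro conjI ballI allI)
      then show "\<exists>z. Q j z" by (rule exI)
    qed
  qed
  from bchoice[OF this] obtain z where z: "\<forall>j\<in>{..<n}. Q j (z j)" by (elim exE)
  define \<psi> where "\<psi> j = fst (z j)" for j
  define M where "M j = snd (z j)" for j
  have Qz: "Q j (z j)" if "j < n" for j using z that by simp
  note Qz' = Qz[unfolded Q_def, folded \<psi>_def M_def]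
  note \<psi> = Qz'[THEN conjunct1] Qz'[THEN conjunct2, THEN conjunct1]
    Qz'[THEN conjunct2, THEN conjunct2, THEN conjunct1]
    Qz'[THEN conjunct2, THEN conjunct2, THEN conjunct2, THEN conjunct1]
    Qz'[THEN conjunct2, THEN conjunct2, THEN conjunct2, THEN conjunct2]
  have near: "norm ((\<Sum>j<n. scaleC (\<psi> j (Inl v)) (e j)) - v) \<le> \<epsilon> / 2" if v: "v \<in> D" for v
  proof -
    let ?z = "(\<Sum>j<n. scaleC (\<psi> j (Inl v)) (e j)) - v"
    have vc: "v \<in> disc.carrier" "disc.gauge v \<le> 1" using D_carrier[OF v] by auto
    have vp: "Inl v \<in> points ?F" using vc by simp
    \<comment> \<open>With \<open>h\<close> norming the error vector, the pair of \<open>v\<close>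
      and \<open>h\<close> makes the line derivative equal to the norm of the error, which the
      seminorm then controls.\<close>
    obtain h where h: "bounded_clinear h" "\<And>y. cmod (h y) \<le> norm y" "h ?z = of_real (norm ?z)"
      by (rule norming_functional[of ?z]) blast
    have lin: "h (\<Sum>j<n. scaleC (c j) (e j)) = (\<Sum>j<n. c j * h (e j))" for c
      by (induction n) (simp_all add: bounded_clinear_zero[OF h(1)] bounded_clinear_add[OF h(1)]
          bounded_clinear_scale[OF h(1)] scaleC_complex_def)
    have pair: "(Inl v, h) \<in> F.unit_pairs" using vc h by (simp add: F.unit_pairs_def)
    have line: "h (g (vscale ?F \<zeta> (Inl v)) - ?J (vscale ?F \<zeta> (Inl v)))
        = (\<Sum>j<n. \<phi> j (vscale ?F \<zeta> (Inl v)) * h (e j)) - \<zeta> * h v" for \<zeta>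
    proof -
      have "vscale ?F \<zeta> (Inl v) \<in> points ?F" by (rule F.scale_closed[OF vp])
      from \<phi>(2)[rule_format, OF this] show ?thesis
        unfolding bounded_clinear_diff[OF h(1)]
        by (simp add: lin bounded_clinear_scale[OF h(1)] scaleC_complex_def)
    qed
    have "((\<lambda>\<zeta>. \<phi> j (vscale ?F \<zeta> (Inl v))) has_field_derivative \<psi> j (Inl v)) (at 0)" if "j < n" for j
      using F.entire_line_holomorphic[OF \<phi>(1)[rule_format, OF that] vp] \<psi>(2)[OF that, rule_format, OF vp]
      by (metis UNIV_I holomorphic_derivI open_UNIV)
    then have line_deriv: "((\<lambda>\<zeta>. (\<Sum>j<n. \<phi> j (vscale ?F \<zeta> (Inl v)) * h (e j)) - \<zeta> * h v)
        has_field_derivative (\<Sum>j<n. \<psi> j (Inl v) * h (e j)) - 1 * h v) (at 0)"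
      by (intro DERIV_diff DERIV_sum DERIV_cmult_right DERIV_ident) auto
    have "F.line_derivative (\<lambda>x. g x - ?J x) (Inl v, h) = (\<Sum>j<n. \<psi> j (Inl v) * h (e j)) - 1 * h v"
      unfolding F.line_derivative_def case_prod_conv line by (rule DERIV_imp_deriv[OF line_deriv])
    also have "\<dots> = h ?z" by (simp add: bounded_clinear_diff[OF h(1)] lin)
    finally have "F.line_derivative (\<lambda>x. g x - ?J x) (Inl v, h) = h ?z" .
    then have "norm ?z = cmod (F.line_derivative (\<lambda>x. g x - ?J x) (Inl v, h))" using h(3) by simp
    also have "\<dots> \<le> F.derivative_seminorm (\<lambda>x. g x - ?J x)"
      by (rule F.line_derivative_le_seminorm[OF entire_diff[OF g(2) inclusion_entire] pair])
    finally show ?thesis using g(3) by simp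
  qed
  \<comment> \<open>The tolerance per functional is scaled by the total size of the vectors
    \<open>e j\<close>; the added 1 covers the case where they all vanish.\<close>
  define \<eta> where "\<eta> = \<epsilon> / 2 / (1 + (\<Sum>j<n. norm (e j)))"
  have sum_nonneg: "0 \<le> (\<Sum>j<n. norm (e j))" by (rule sum_nonneg) simp
  then have \<eta>: "0 < \<eta>" "\<eta> * (\<Sum>j<n. norm (e j)) \<le> \<epsilon> / 2"
    using \<epsilon> by (auto simp: \<eta>_def field_simps)
  have "\<exists>h :: 'e \<Rightarrow> complex. bounded_clinear h \<and> (\<forall>v\<in>p_hull p x. cmod (h v - \<psi> j (Inl v)) \<le> \<eta>)" if j: "j < n" for j
  proof (rule functional_approximation[of "\<lambda>v. \<psi> j (Inl v)" "M j" \<eta>])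
    show "\<psi> j (Inl (u + v)) = \<psi> j (Inl u) + \<psi> j (Inl v)" if "u \<in> disc.carrier" "v \<in> disc.carrier" for u v
      using \<psi>(3)[OF j, rule_format, of "Inl u" "Inl v"] that by simp
    show "\<psi> j (Inl (scaleC c v)) = c * \<psi> j (Inl v)" if "v \<in> disc.carrier" for c v
      using \<psi>(4)[OF j, rule_format, of "Inl v" c] that by simp
    show "cmod (\<psi> j (Inl v)) \<le> M j * disc.gauge v" if "v \<in> disc.carrier" for v
      using \<psi>(5)[OF j, rule_format, of "Inl v"] that by simp
  qed (use \<psi>(1)[OF j] \<eta> in auto)
  then have "\<forall>j\<in>{..<n}. \<exists>h :: 'e \<Rightarrow> complex. bounded_clinear h \<and> (\<forall>v\<in>p_hull p x. cmod (h v - \<psi> j (Inl v)) \<le> \<eta>)"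
    by simp
  from bchoice[OF this] obtain H :: "nat \<Rightarrow> 'e \<Rightarrow> complex" where
    "\<forall>j\<in>{..<n}. bounded_clinear (H j) \<and> (\<forall>v\<in>p_hull p x. cmod (H j v - \<psi> j (Inl v)) \<le> \<eta>)"
    by (elim exE)
  then have h: "\<And>j. j < n \<Longrightarrow> bounded_clinear (H j)"
    "\<And>j v. j < n \<Longrightarrow> v \<in> p_hull p x \<Longrightarrow> cmod (H j v - \<psi> j (Inl v)) \<le> \<eta>"
    by simp_all
  define T where "T v = (\<Sum>j<n. scaleC (H j v) (e j))" for v
  have T: "bounded_clinear T"
    unfolding T_def[abs_def] by (intro bounded_clinear_sum bounded_clinear_rank_one h) simp
  have T_close: "norm (T v - v) \<le> \<epsilon>" if v: "v \<in> p_hull p x" for v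
  proof -
    have vD: "v \<in> D" using v \<Phi>_in_D by (auto simp: p_hull_eq)
    let ?S = "\<Sum>j<n. scaleC (\<psi> j (Inl v)) (e j)"
    have "T v - ?S = (\<Sum>j<n. scaleC (H j v - \<psi> j (Inl v)) (e j))"
      unfolding T_def sum_subtractf[symmetric]
      by (intro sum.cong refl) (metis add_diff_cancel diff_add_cancel scaleC_add_left)
    then have "norm (T v - ?S) \<le> (\<Sum>j<n. norm (scaleC (H j v - \<psi> j (Inl v)) (e j)))"
      by (simp add: norm_sum)
    also have "\<dots> \<le> (\<Sum>j<n. \<eta> * norm (e j))"
      unfolding norm_scaleC by (intro sum_mono mult_right_mono h(2) v) auto
    also have "\<dots> \<le> \<epsilon> / 2" using \<eta>(2) by (simp add: sum_distrib_left)
    finally have "norm (T v - ?S) \<le> \<epsilon> / 2" .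
    then show ?thesis using near[OF vD] norm_triangle_ineq[of "T v - ?S" "?S - v"] by simp
  qed
  show thesis
  proof (rule that)
    interpret vs: vector_space "scaleC :: complex \<Rightarrow> 'e \<Rightarrow> 'e" by (rule vector_space_scaleC)
    have "range T \<subseteq> vs.span (e ` {..<n})"
      unfolding T_def[abs_def] by (intro image_subsetI vs.span_sum vs.span_scale vs.span_base imageI)
    then show "finite_rank_operator T"
      using T unfolding finite_rank_operator_def bounded_clinear_def
      by (intro conjI exI[of _ "e ` {..<n}"]) simp_all
    \<comment> \<open>The functionals were approximated only on the hull itself; since
      \<open>T\<close> is continuous on \<open>E\<close>, the final estimate passes to its
      closure.\<close>
    have "closed {v. norm (T v - v) \<le> \<epsilon>}"
      using T unfolding bounded_clinear_def
      by (intro closed_Collect_le continuous_intros) (auto intro: linear_continuous_on)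
    moreover have "p_hull p x \<subseteq> {v. norm (T v - v) \<le> \<epsilon>}" using T_close by blast
    ultimately have "closure (p_hull p x) \<subseteq> {v. norm (T v - v) \<le> \<epsilon>}" by (rule closure_minimal[rotated])
    then show "norm (T v - v) \<le> \<epsilon>" if "v \<in> closure (p_hull p x)" for v using that by blast
  qed
qed

end

lemma dense_imp_approximation_property:
  assumes p: "1 \<le> p"
    and dense: "\<And>F :: ('e::complex_banach + 'u) cspace. complex_banach_space F \<Longrightarrow>
       subtopology (nachbin_topology F) (p_compact_entire_functions p F) closure_of
           (entire_tensor F :: ('e + 'u \<Rightarrow> 'e) set) = p_compact_entire_functions p F"
  shows "p_approximation_property p TYPE('e)"
  unfolding p_approximation_property_def
proof (intro allI impI)
  fix K :: "'e set" and \<epsilon> :: real assume K: "p_compact p K" and \<epsilon>: "0 < \<epsilon>"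
  obtain x where x: "p_summable p x" "K \<subseteq> closure (p_hull p x)"
    using K unfolding p_compact_def relatively_p_compact_iff by blast
  obtain w where w: "\<And>n. 0 < w n" "\<And>n. w n \<le> 1" "w \<longlonglongrightarrow> 0" "summable (\<lambda>n. norm (x n) powr p / w n)"
    by (rule summable_slower_weights[of "\<lambda>n. norm (x n) powr p"]) (use x(1) in \<open>auto simp: p_summable_def\<close>)
  \<comment> \<open>With this root of the weights, \<open>norm (y n) powr p\<close> equals
    \<open>norm (x n) powr p / w n\<close>, which is summable by the choice of
    \<open>w\<close>.\<close>
  define v where "v n = w n powr (1 / p)" for n
  define y where "y n = (1 / v n) *\<^sub>R x n" for n
  have v: "0 < v n" "v n \<le> 1" "v n powr p = w n" for n
    using w(1,2)[of n] p powr_mono2[of "1 / p" "w n" 1] by (simp_all add: v_def powr_powr)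
  have "p_hull_disc p x y v"
  proof
    show "p_summable p y"
      unfolding p_summable_def y_def
      using w(4) v by (simp add: powr_divide less_imp_le)
    show "v \<longlonglongrightarrow> 0"
      unfolding v_def[abs_def]
      using tendsto_powr'[OF w(3) tendsto_const, of "1 / p"] w(1) p by (simp add: less_imp_le)
    show "x n = v n *\<^sub>R y n" for n using v(1)[of n] by (simp add: y_def)
  qed (use p v in auto)
  then interpret p_hull_disc p x y v .
  \<comment> \<open>Half of \<epsilon> leaves room for the strict inequality of the
    supremum.\<close>
  obtain T where T: "finite_rank_operator T" "\<And>v. v \<in> closure (p_hull p x) \<Longrightarrow> norm (T v - v) \<le> \<epsilon> / 2"
    by (rule approximation_on_hull[OF dense[OF disc.complex_banach_space_space] half_gt_zero[OF \<epsilon>]]) blast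
  have "(SUP v\<in>K. ennreal (norm (T v - v))) \<le> ennreal (\<epsilon> / 2)"
    using x(2) T(2) by (intro SUP_least ennreal_leI) blast
  also have "\<dots> < ennreal \<epsilon>" using \<epsilon> by (simp add: ennreal_less_iff)
  finally show "\<exists>T. finite_rank_operator T \<and> (SUP v\<in>K. ennreal (norm (T v - v))) < ennreal \<epsilon>"
    using T(1) by blast
qed

theorem proposition4p7:
  fixes p :: real
  assumes "1 \<le> p"
  shows "p_approximation_property p TYPE('e::complex_banach) \<longleftrightarrow>
    (\<forall>F :: ('e + 'u) cspace. complex_banach_space F \<longrightarrow>
       subtopology (nachbin_topology F) (p_compact_entire_functions p F) closure_of
           (entire_tensor F :: ('e + 'u \<Rightarrow> 'e) set)
         = p_compact_entire_functions p F)"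
  using approximation_property_imp_dense[OF assms] dense_imp_approximation_property[OF assms]
  by blast

end
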